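(* Let $K$ be a field, $S=K[x,y]$, and let $I\subset S$ be a nonzero proper monomial ideal such that $R=S/I$ is Cohen-Macaulay. Let $\mu(I)$ be the minimal number of generators of $I$. Then $R$ is nearly Gorenstein if and only if one of the following holds: $\mu(I)=1$; or $\mu(I)=2$; or $\mu(I)=3$ and $I=(x^{a},x^{b}y^{c},y^{d})$ for some integers $a>b\ge0$, $0\le c<d$ satisfying the conditions: (i) $a-b=1$ or $b=1$, (ii) $d-c=1$ or $c=1$, and (iii) $b+c\ge1$.
   Context: For a Cohen-Macaulay positively graded $K$-algebra $R$ with graded maximal ideal $\mathfrak m$ and canonical module $\omega_R$, the canonical trace is the ideal $\operatorname{tr}(\omega_R)=\sum_{\varphi\in\operatorname{Hom}_R(\omega_R,R)}\varphi(\omega_R)$ of $R$; $R$ is called nearly Gorenstein if $\operatorname{tr}(\omega_R)\supseteq\mathfrak m$. In particular, Gorenstein rings (those with $\operatorname{tr}(\omega_R)=R$) are nearly Gorenstein. *)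

theory Defs
  imports
    "HOL-Algebra.Algebraic_Closure_Type"
    "HOL-Library.Extended_Nat"
    "HOL-Computational_Algebra.Polynomial"
begin

subsection \<open>Krull dimension, depth and number of generators\<close>

definition krull_dim :: "('a, 'm) ring_scheme \<Rightarrow> enat" where
  "krull_dim R = Sup {enat n | n.
     \<exists>P. (\<forall>i\<le>n. primeideal (P i) R) \<and> (\<forall>i<n. P i \<subset> P (Suc i))}"

text \<open>The second conjunct says that \<open>xs ! i\<close> is a nonzerodivisor modulo the ideal
  generated by the preceding elements.\<close>

definition regular_sequence :: "('a, 'm) ring_scheme \<Rightarrow> 'a list \<Rightarrow> bool" where
  "regular_sequence R xs \<longleftrightarrow>
     set xs \<subseteq> carrier R \<and>
     (\<forall>i<length xs. \<forall>a\<in>carrier R.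
        xs ! i \<otimes>\<^bsub>R\<^esub> a \<in> Idl\<^bsub>R\<^esub> (set (take i xs)) \<longrightarrow> a \<in> Idl\<^bsub>R\<^esub> (set (take i xs))) \<and>
     Idl\<^bsub>R\<^esub> (set xs) \<noteq> carrier R"

definition depth :: "('a, 'm) ring_scheme \<Rightarrow> 'a set \<Rightarrow> enat" where
  "depth R \<mm> = Sup {enat (length xs) | xs. regular_sequence R xs \<and> set xs \<subseteq> \<mm>}"

definition min_num_gens :: "('a, 'm) ring_scheme \<Rightarrow> 'a set \<Rightarrow> nat" where
  "min_num_gens R I =
     (LEAST n. \<exists>G. finite G \<and> card G = n \<and> G \<subseteq> carrier R \<and> I = Idl\<^bsub>R\<^esub> G)"


subsection \<open>Modules, homomorphisms and traces\<close>

text \<open>Modules in HOL-Algebra are records extending rings; the multiplication and the unit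
  of such a record play no role and are left undefined below.\<close>

definition regular_module :: "('a, 'm) ring_scheme \<Rightarrow> ('a, 'a) module" where
  "regular_module R = \<lparr>carrier = carrier R, monoid.mult = undefined, one = undefined,
     zero = \<zero>\<^bsub>R\<^esub>, add = add R, module.smult = monoid.mult R\<rparr>"

definition free_module :: "('a, 'm) ring_scheme \<Rightarrow> nat \<Rightarrow> ('a, nat \<Rightarrow> 'a) module" where
  "free_module R n = \<lparr>carrier = {..<n} \<rightarrow>\<^sub>E carrier R,
     monoid.mult = undefined, one = undefined,
     zero = (\<lambda>i\<in>{..<n}. \<zero>\<^bsub>R\<^esub>),
     add = (\<lambda>u v. \<lambda>i\<in>{..<n}. u i \<oplus>\<^bsub>R\<^esub> v i),
     module.smult = (\<lambda>r u. \<lambda>i\<in>{..<n}. r \<otimes>\<^bsub>R\<^esub> u i)\<rparr>"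

text \<open>The module \<open>M / N\<close> for a submodule \<open>N\<close>; its elements are the cosets of \<open>N\<close>.\<close>

definition quot_module ::
  "('a, 'm) ring_scheme \<Rightarrow> ('a, 'b, 'p) module_scheme \<Rightarrow> 'b set \<Rightarrow> ('a, 'b set) module" where
  "quot_module R M N = \<lparr>carrier = a_rcosets\<^bsub>M\<^esub> N,
     monoid.mult = undefined, one = undefined,
     zero = N,
     add = set_add M,
     module.smult = (\<lambda>r A. \<Union>x\<in>A. N +>\<^bsub>M\<^esub> (r \<odot>\<^bsub>M\<^esub> x))\<rparr>"

definition linear_maps ::
  "('a, 'm) ring_scheme \<Rightarrow> ('a, 'b, 'p) module_scheme \<Rightarrow> ('a, 'c, 'q) module_scheme \<Rightarrow> ('b \<Rightarrow> 'c) set"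
  where
  "linear_maps R M N = {f \<in> carrier M \<rightarrow>\<^sub>E carrier N.
     (\<forall>x\<in>carrier M. \<forall>y\<in>carrier M. f (x \<oplus>\<^bsub>M\<^esub> y) = f x \<oplus>\<^bsub>N\<^esub> f y) \<and>
     (\<forall>r\<in>carrier R. \<forall>x\<in>carrier M. f (r \<odot>\<^bsub>M\<^esub> x) = r \<odot>\<^bsub>N\<^esub> f x)}"

definition hom_module ::
  "('a, 'm) ring_scheme \<Rightarrow> ('a, 'b, 'p) module_scheme \<Rightarrow> ('a, 'c, 'q) module_scheme \<Rightarrow>
   ('a, 'b \<Rightarrow> 'c) module" where
  "hom_module R M N = \<lparr>carrier = linear_maps R M N,
     monoid.mult = undefined, one = undefined,
     zero = (\<lambda>x\<in>carrier M. \<zero>\<^bsub>N\<^esub>),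
     add = (\<lambda>f g. \<lambda>x\<in>carrier M. f x \<oplus>\<^bsub>N\<^esub> g x),
     module.smult = (\<lambda>r f. \<lambda>x\<in>carrier M. r \<odot>\<^bsub>N\<^esub> f x)\<rparr>"

definition trace_ideal :: "('a, 'm) ring_scheme \<Rightarrow> ('a, 'b, 'p) module_scheme \<Rightarrow> 'a set" where
  "trace_ideal R M = Idl\<^bsub>R\<^esub> (\<Union>\<phi>\<in>linear_maps R M (regular_module R). \<phi> ` carrier M)"


subsection \<open>Ext\<close>

text \<open>\<open>\<cdots> \<rightarrow> R\<^sup>r\<^sup>2 \<rightarrow> R\<^sup>r\<^sup>1 \<rightarrow> R\<^sup>r\<^sup>0 \<rightarrow> M \<rightarrow> 0\<close> is exact, where \<open>ri = r i\<close>,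
  the differentials are \<open>d i : R^(r (i+1)) \<rightarrow> R^(r i)\<close>, and \<open>\<epsilon>\<close> is the augmentation.
  The ranks may vanish from some index on.\<close>

definition free_resolution ::
  "('a, 'm) ring_scheme \<Rightarrow> ('a, 'b, 'p) module_scheme \<Rightarrow> (nat \<Rightarrow> nat) \<Rightarrow>
   (nat \<Rightarrow> (nat \<Rightarrow> 'a) \<Rightarrow> (nat \<Rightarrow> 'a)) \<Rightarrow> ((nat \<Rightarrow> 'a) \<Rightarrow> 'b) \<Rightarrow> bool" where
  "free_resolution R M r d \<epsilon> \<longleftrightarrow>
     (let F = (\<lambda>i. free_module R (r i)) in
      \<epsilon> \<in> linear_maps R (F 0) M \<and>
      (\<forall>i. d i \<in> linear_maps R (F (Suc i)) (F i)) \<and>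
      \<epsilon> ` carrier (F 0) = carrier M \<and>
      d 0 ` carrier (F 1) = {v \<in> carrier (F 0). \<epsilon> v = \<zero>\<^bsub>M\<^esub>} \<and>
      (\<forall>i. d (Suc i) ` carrier (F (Suc (Suc i))) =
           {v \<in> carrier (F (Suc i)). d i v = \<zero>\<^bsub>F i\<^esub>}))"

text \<open>The \<open>i\<close>-th cohomology of the complex \<open>Hom(F, N)\<close>.\<close>

definition hom_cohomology ::
  "('a, 'm) ring_scheme \<Rightarrow> (nat \<Rightarrow> nat) \<Rightarrow> (nat \<Rightarrow> (nat \<Rightarrow> 'a) \<Rightarrow> (nat \<Rightarrow> 'a)) \<Rightarrow>
   ('a, 'c, 'q) module_scheme \<Rightarrow> nat \<Rightarrow> ('a, ((nat \<Rightarrow> 'a) \<Rightarrow> 'c) set) module" where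
  "hom_cohomology R r d N i =
     (let F = (\<lambda>i. free_module R (r i));
          C = (\<lambda>i. hom_module R (F i) N);
          \<delta> = (\<lambda>i f. compose (carrier (F (Suc i))) f (d i));
          Z = {f \<in> carrier (C i). \<delta> i f = \<zero>\<^bsub>C (Suc i)\<^esub>};
          B = (case i of 0 \<Rightarrow> {\<zero>\<^bsub>C 0\<^esub>} | Suc j \<Rightarrow> \<delta> j ` carrier (C j))
      in quot_module R ((C i)\<lparr>carrier := Z\<rparr>) B)"

text \<open>The isomorphism class does not depend on the chosen resolution by free modules of
  finite rank, which exists if \<open>R\<close> is Noetherian and \<open>M\<close> is finitely generated.\<close>

definition Ext ::
  "('a, 'm) ring_scheme \<Rightarrow> ('a, 'b, 'p) module_scheme \<Rightarrow> ('a, 'c, 'q) module_scheme \<Rightarrow> nat \<Rightarrow>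
   ('a, ((nat \<Rightarrow> 'a) \<Rightarrow> 'c) set) module" where
  "Ext R M N i =
     (case (SOME (r, d). \<exists>\<epsilon>. free_resolution R M r d \<epsilon>) of (r, d) \<Rightarrow> hom_cohomology R r d N i)"


subsection \<open>Quotients of the polynomial ring in two variables\<close>

text \<open>\<open>K[x,y]\<close> is \<open>K[x][y]\<close>: the coefficients of the outer polynomial (in \<open>y\<close>) are
  polynomials in \<open>x\<close>.\<close>

abbreviation Kxy :: "'k::field poly poly ring" where
  "Kxy \<equiv> ring_of_type_algebra"

definition xy :: "nat \<Rightarrow> nat \<Rightarrow> 'k::field poly poly" where
  "xy i j = [:[:0, 1:]:] ^ i * [:0, 1:] ^ j"

definition monomial_ideal :: "'k::field poly poly set \<Rightarrow> bool" where
  "monomial_ideal I \<longleftrightarrow> (\<exists>E. I = Idl\<^bsub>Kxy\<^esub> ((\<lambda>(i, j). xy i j) ` E))"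

definition graded_max_ideal :: "'k::field poly poly set \<Rightarrow> 'k poly poly set set" where
  "graded_max_ideal I = (\<lambda>f. I +>\<^bsub>Kxy\<^esub> f) ` (Idl\<^bsub>Kxy\<^esub> {xy 1 0, xy 0 1})"

text \<open>For a positively graded algebra, depth and dimension may be taken at the graded
  maximal ideal.\<close>

definition cohen_macaulay_quot :: "'k::field poly poly set \<Rightarrow> bool" where
  "cohen_macaulay_quot I \<longleftrightarrow>
     depth (Kxy Quot I) (graded_max_ideal I) = krull_dim (Kxy Quot I)"

text \<open>A module over \<open>S\<close> that is annihilated by \<open>I\<close>, regarded as a module over \<open>S / I\<close>.\<close>

definition descend_module :: "('a, 'b, 'p) module_scheme \<Rightarrow> ('a set, 'b) module" where
  "descend_module M = \<lparr>carrier = carrier M, monoid.mult = undefined, one = undefined,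
     zero = \<zero>\<^bsub>M\<^esub>, add = add M, module.smult = (\<lambda>A. module.smult M (SOME s. s \<in> A))\<rparr>"

text \<open>With \<open>S = K[x,y]\<close> and \<open>R = S/I\<close> of dimension \<open>e\<close>, the canonical module of \<open>R\<close> is
  \<open>Ext\<close> of \<open>R\<close> into \<open>S\<close> over \<open>S\<close> in degree \<open>2 - e\<close>; the grading shift \<open>S(-2)\<close> is dropped,
  since it does not affect the trace.\<close>

definition canonical_module ::
  "'k::field poly poly set \<Rightarrow> ('k poly poly set, ((nat \<Rightarrow> 'k poly poly) \<Rightarrow> 'k poly poly) set) module"
  where
  "canonical_module I = descend_module
     (Ext Kxy (quot_module Kxy (regular_module Kxy) I) (regular_module Kxy)
        (2 - the_enat (krull_dim (Kxy Quot I))))"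

definition canonical_trace :: "'k::field poly poly set \<Rightarrow> 'k poly poly set set" where
  "canonical_trace I = trace_ideal (Kxy Quot I) (canonical_module I)"

text \<open>Meaningful if \<open>K[x,y]/I\<close> is Cohen-Macaulay.\<close>

definition nearly_gorenstein_quot :: "'k::field poly poly set \<Rightarrow> bool" where
  "nearly_gorenstein_quot I \<longleftrightarrow> graded_max_ideal I \<subseteq> canonical_trace I"

end

theory Submission
  imports Defs "HOL-Library.Function_Algebras"
begin

text \<open>
  A nonzero monomial ideal \<open>I\<close> of \<open>S = K[x,y]\<close> is generated by the corners
  \<open>g\<^sub>k = x^(a k) y^(b k)\<close>, \<open>k \<le> n\<close>, of a staircase \<open>a 0 > \<dots> > a n\<close>, \<open>b 0 < \<dots> < b n\<close>, and
  \<open>\<mu>(I) = n + 1\<close> because the coefficients at the corners identify \<open>I / (x,y)I\<close> with \<open>K^(n+1)\<close>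
  (\<open>monomial_ideal_staircase\<close>, \<open>min_num_gens_J\<close>). If \<open>n \<ge> 1\<close>, the class of
  \<open>x^(a 0 - 1) y^(b 1 - 1)\<close> in \<open>R = S/I\<close> is a nonzero element killed by \<open>x\<close> and \<open>y\<close>, so \<open>R\<close>
  has depth 0. Being Cohen-Macaulay, \<open>R\<close> then has dimension 0, which means that
  \<open>a n = 0\<close> and \<open>b 0 = 0\<close>. If \<open>n = 0\<close>, \<open>R\<close> is a hypersurface of dimension 1, its canonical
  module is isomorphic to \<open>R\<close>, and the trace is \<open>R\<close>.

  The relations \<open>y^(b (k+1) - b k) g\<^sub>k = x^(a k - a (k+1)) g\<^sub>k\<^sub>+\<^sub>1\<close> between consecutive corners
  generate all syzygies, which gives the Hilbert-Burch resolution
  \<open>0 \<rightarrow> S^n \<rightarrow> S^(n+1) \<rightarrow> S\<close> of \<open>R\<close> (\<open>resolves_staircase\<close>). For \<open>n \<ge> 1\<close> the canonical module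
  is the cokernel of the transpose of the last map \<open>hb\<close>. Hence a homomorphism from the canonical module
  to \<open>R\<close> is a vector \<open>v \<in> S^n\<close>, taken modulo \<open>I\<close>, such that all entries of \<open>hb v\<close> lie in \<open>I\<close>,
  and the trace is generated by the entries of these vectors (\<open>trace_top_Ext_memI\<close>,
  \<open>trace_top_Ext_subset\<close>).

  Call such vectors admissible. For \<open>n = 1\<close> the vector with entry 1 is admissible and the trace is
  \<open>R\<close>. For \<open>n \<ge> 2\<close>, suppose that \<open>x\<close> lies in the trace. Then some admissible \<open>v\<close> has an entry \<open>v\<^sub>k\<close>
  with a nonzero coefficient at 1 or \<open>x\<close>. In the next entry of \<open>hb v\<close> it is
  multiplied by \<open>x^(a k - a (k+1))\<close> and compared with a multiple of \<open>y\<close>, so that a pure power of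
  \<open>x\<close> survives and must lie in \<open>I\<close>: \<open>a 0 + a (k+1) \<le> a k + 1\<close>. This is impossible for
  \<open>n \<ge> 3\<close>, and for \<open>n = 2\<close> it says \<open>a 1 = 1\<close> or \<open>a 0 - a 1 = 1\<close>. Exchanging \<open>x\<close> and \<open>y\<close>
  gives the condition on \<open>b\<close>. Conversely these conditions allow explicit admissible vectors with
  an entry \<open>x\<close>, respectively \<open>y\<close> (\<open>nearly_gorenstein_three_gens\<close>).

  Since \<open>Ext\<close> is computed from a resolution about which nothing is known, the trace has to be
  compared between two resolutions. This is the comparison theorem of homological algebra
  (\<open>chain_map_exists\<close>, \<open>null_homotopic\<close>), applied in \<open>functional_mod_transfer\<close>. The same
  homotopy argument shows that \<open>I\<close> annihilates \<open>Ext\<close> (\<open>cocycle_annihilated\<close>).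
\<close>

section \<open>Ideals and residue rings of a commutative ring type\<close>

lemma rta_simps [simp]:
  "carrier (ring_of_type_algebra :: 'a::comm_ring_1 ring) = UNIV"
  "\<zero>\<^bsub>(ring_of_type_algebra :: 'a ring)\<^esub> = 0"
  "\<one>\<^bsub>(ring_of_type_algebra :: 'a ring)\<^esub> = 1"
  "x \<oplus>\<^bsub>(ring_of_type_algebra :: 'a ring)\<^esub> y = x + y"
  "x \<otimes>\<^bsub>(ring_of_type_algebra :: 'a ring)\<^esub> y = x * y"
  by (auto simp: ring_of_type_algebra_def)

lemma cring_rta: "cring (ring_of_type_algebra :: 'a::comm_ring_1 ring)"
  by (rule cring_from_type_algebra)

lemma rta_minus [simp]:
  "\<ominus>\<^bsub>(ring_of_type_algebra :: 'a::comm_ring_1 ring)\<^esub> x = - x"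
proof -
  interpret cring "ring_of_type_algebra :: 'a ring" by (rule cring_rta)
  show ?thesis
    by (rule minus_equality) auto
qed

lemma ideal_rta_iff:
  "ideal J (ring_of_type_algebra :: 'a::comm_ring_1 ring) \<longleftrightarrow>
     0 \<in> J \<and> (\<forall>a\<in>J. \<forall>b\<in>J. a + b \<in> J) \<and> (\<forall>c. \<forall>a\<in>J. c * a \<in> J)"
proof
  assume "ideal J (ring_of_type_algebra :: 'a ring)"
  then interpret ideal J "ring_of_type_algebra :: 'a ring" .
  show "0 \<in> J \<and> (\<forall>a\<in>J. \<forall>b\<in>J. a + b \<in> J) \<and> (\<forall>c. \<forall>a\<in>J. c * a \<in> J)"
    using additive_subgroup.zero_closed[OF is_additive_subgroup] additive_subgroup.a_closed[OF is_additive_subgroup] I_l_closed by simp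
next
  assume J: "0 \<in> J \<and> (\<forall>a\<in>J. \<forall>b\<in>J. a + b \<in> J) \<and> (\<forall>c. \<forall>a\<in>J. c * a \<in> J)"
  interpret cring "ring_of_type_algebra :: 'a ring" by (rule cring_rta)
  show "ideal J (ring_of_type_algebra :: 'a ring)"
  proof (rule idealI)
    have "- a \<in> J" if "a \<in> J" for a
      using J that by (metis mult_minus1)
    then show "subgroup J (add_monoid (ring_of_type_algebra :: 'a ring))"
      by (intro add.subgroupI) (use J in \<open>auto simp flip: a_inv_def\<close>)
    show "x \<otimes>\<^bsub>ring_of_type_algebra\<^esub> a \<in> J" "a \<otimes>\<^bsub>ring_of_type_algebra\<^esub> x \<in> J" if "a \<in> J" for a x
      using J that by (simp, metis rta_simps(5) mult.commute)
  qed (rule ring_axioms)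
qed

context
  fixes J :: "'a::comm_ring_1 set"
  assumes J: "ideal J ring_of_type_algebra"
begin

lemma ideal_rta_zero: "0 \<in> J"
  and ideal_rta_add: "a \<in> J \<Longrightarrow> b \<in> J \<Longrightarrow> a + b \<in> J"
  and ideal_rta_mult: "a \<in> J \<Longrightarrow> c * a \<in> J"
  using J by (auto simp: ideal_rta_iff)

lemma ideal_rta_mult_right: "a \<in> J \<Longrightarrow> a * c \<in> J"
  using ideal_rta_mult[of a c] by (simp add: mult.commute)

lemma ideal_rta_uminus: "a \<in> J \<Longrightarrow> - a \<in> J"
  using ideal_rta_mult[of a "-1"] by simp

lemma ideal_rta_diff: "a \<in> J \<Longrightarrow> b \<in> J \<Longrightarrow> a - b \<in> J"
  using ideal_rta_add[of a "-b"] ideal_rta_uminus[of b] by simp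

lemma ideal_rta_sum: "(\<And>i. i \<in> A \<Longrightarrow> f i \<in> J) \<Longrightarrow> sum f A \<in> J"
  by (induction A rule: infinite_finite_induct) (auto intro: ideal_rta_zero ideal_rta_add)

end

abbreviation coset :: "'a::comm_ring_1 set \<Rightarrow> 'a \<Rightarrow> 'a set" where
  "coset J s \<equiv> J +>\<^bsub>ring_of_type_algebra\<^esub> s"

abbreviation quot :: "'a::comm_ring_1 set \<Rightarrow> 'a set ring" where
  "quot J \<equiv> ring_of_type_algebra Quot J"

lemma genideal_rta: "ideal (Idl\<^bsub>ring_of_type_algebra\<^esub> G) (ring_of_type_algebra :: 'a::comm_ring_1 ring)"
  using ring.genideal_ideal[OF cring.axioms(1)[OF cring_rta], of G] by simp

lemma genideal_rta_superset: "G \<subseteq> Idl\<^bsub>(ring_of_type_algebra :: 'a::comm_ring_1 ring)\<^esub> G"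
  using ring.genideal_self[OF cring.axioms(1)[OF cring_rta], of G] by simp

lemma genideal_rta_least:
  "ideal J (ring_of_type_algebra :: 'a::comm_ring_1 ring) \<Longrightarrow> G \<subseteq> J \<Longrightarrow> Idl\<^bsub>ring_of_type_algebra\<^esub> G \<subseteq> J"
  using ring.genideal_minimal[OF cring.axioms(1)[OF cring_rta]] by metis

lemma mem_genideal_insert:
  "f \<in> Idl\<^bsub>(ring_of_type_algebra :: 'a::comm_ring_1 ring)\<^esub> {u, v} \<longleftrightarrow> (\<exists>p q. f = p * u + q * v)"
proof
  have "ideal {f. \<exists>p q. f = p * u + q * v} ring_of_type_algebra"
    unfolding ideal_rta_iff
  proof (intro conjI ballI allI)
    show "0 \<in> {f. \<exists>p q. f = p * u + q * v}"
      by (auto intro!: exI[of _ 0])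
  next
    fix a b assume "a \<in> {f. \<exists>p q. f = p * u + q * v}" "b \<in> {f. \<exists>p q. f = p * u + q * v}"
    then obtain p q p' q' where "a = p * u + q * v" "b = p' * u + q' * v" by auto
    then have "a + b = (p + p') * u + (q + q') * v" by (simp add: algebra_simps)
    then show "a + b \<in> {f. \<exists>p q. f = p * u + q * v}" by blast
  next
    fix c a assume "a \<in> {f. \<exists>p q. f = p * u + q * v}"
    then obtain p q where "a = p * u + q * v" by auto
    then have "c * a = (c * p) * u + (c * q) * v" by (simp add: algebra_simps)
    then show "c * a \<in> {f. \<exists>p q. f = p * u + q * v}" by blast
  qed
  moreover have "{u, v} \<subseteq> {f. \<exists>p q. f = p * u + q * v}"
    using add_0_left add_0_right mult_1 mult_zero_left by (smt (verit) insertE mem_Collect_eq singletonD subsetI)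
  ultimately have "Idl\<^bsub>ring_of_type_algebra\<^esub> {u, v} \<subseteq> {f. \<exists>p q. f = p * u + q * v}"
    by (rule genideal_rta_least)
  then show "f \<in> Idl\<^bsub>ring_of_type_algebra\<^esub> {u, v} \<Longrightarrow> \<exists>p q. f = p * u + q * v" by auto
next
  have uv: "u \<in> Idl\<^bsub>ring_of_type_algebra\<^esub> {u, v}" "v \<in> Idl\<^bsub>ring_of_type_algebra\<^esub> {u, v}"
    using genideal_rta_superset[of "{u, v}"] by auto
  show "\<exists>p q. f = p * u + q * v \<Longrightarrow> f \<in> Idl\<^bsub>ring_of_type_algebra\<^esub> {u, v}"
    using ideal_rta_add[OF genideal_rta] ideal_rta_mult[OF genideal_rta] uv by blast
qed

context
  fixes J :: "'a::comm_ring_1 set"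
  assumes J: "ideal J ring_of_type_algebra"
begin

interpretation ideal J "ring_of_type_algebra :: 'a ring" by (rule J)
interpretation Q: cring "quot J"
  using quotient_is_cring[OF cring_rta] .

lemma mem_coset_iff: "t \<in> coset J s \<longleftrightarrow> t - s \<in> J"
  by (force simp: a_r_coset_def')

lemma coset_eq_iff: "coset J s = coset J t \<longleftrightarrow> s - t \<in> J"
proof
  assume "coset J s = coset J t"
  moreover have "s \<in> coset J s" by (simp add: mem_coset_iff ideal_rta_zero[OF J])
  ultimately show "s - t \<in> J" by (simp add: mem_coset_iff)
next
  assume st: "s - t \<in> J"
  have "u - s \<in> J \<longleftrightarrow> u - t \<in> J" for u
    using ideal_rta_add[OF J _ st, of "u - s"] ideal_rta_diff[OF J _ st, of "u - t"] by auto
  then show "coset J s = coset J t" by (auto simp: mem_coset_iff)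
qed

lemma quot_carrier: "carrier (quot J) = range (coset J)"
  by (auto simp: FactRing_def A_RCOSETS_def')

lemma quot_add: "coset J s \<oplus>\<^bsub>quot J\<^esub> coset J t = coset J (s + t)"
  using a_rcos_sum[of s t] by (simp add: FactRing_def)

lemma quot_mult: "coset J s \<otimes>\<^bsub>quot J\<^esub> coset J t = coset J (s * t)"
  using rcoset_mult_add[of s t] by (simp add: FactRing_def)

lemma coset_zero: "coset J 0 = J"
  by (auto simp: mem_coset_iff)

lemma quot_zero: "\<zero>\<^bsub>quot J\<^esub> = coset J 0"
  by (simp add: FactRing_def coset_zero)

lemma quot_one: "\<one>\<^bsub>quot J\<^esub> = coset J 1"
  by (simp add: FactRing_def)

lemma cring_quot: "cring (quot J)"
  by (rule Q.cring_axioms)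

lemma ideal_quot_iff:
  "ideal P (quot J) \<longleftrightarrow> (\<exists>K. ideal K ring_of_type_algebra \<and> J \<subseteq> K \<and> P = coset J ` K)"
proof
  assume P: "ideal P (quot J)"
  interpret P: ideal P "quot J" by (rule P)
  have sub: "P \<subseteq> range (coset J)" using P.a_subset by (simp add: quot_carrier)
  have "ideal {s. coset J s \<in> P} ring_of_type_algebra"
    unfolding ideal_rta_iff
    using P.zero_closed P.a_closed P.I_l_closed quot_carrier
    by (auto simp flip: quot_zero quot_add quot_mult)
  moreover have "J \<subseteq> {s. coset J s \<in> P}"
  proof
    fix s assume "s \<in> J"
    then have "coset J s = coset J 0" by (simp add: coset_eq_iff)
    then show "s \<in> {s. coset J s \<in> P}" using P.zero_closed by (simp add: quot_zero)
  qed
  moreover have "P = coset J ` {s. coset J s \<in> P}" using sub by auto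
  ultimately show "\<exists>K. ideal K ring_of_type_algebra \<and> J \<subseteq> K \<and> P = coset J ` K" by blast
next
  assume "\<exists>K. ideal K ring_of_type_algebra \<and> J \<subseteq> K \<and> P = coset J ` K"
  then obtain K where K: "ideal K ring_of_type_algebra" "J \<subseteq> K" "P = coset J ` K" by blast
  show "ideal P (quot J)"
    using ring_ideal_imp_quot_ideal[OF J K(1)] K(3) by simp
qed

lemma coset_in_image_iff:
  assumes "ideal K ring_of_type_algebra" "J \<subseteq> K"
  shows "coset J s \<in> coset J ` K \<longleftrightarrow> s \<in> K"
proof
  assume "coset J s \<in> coset J ` K"
  then obtain k where "k \<in> K" "s - k \<in> J" by (auto simp: coset_eq_iff)
  then show "s \<in> K" using ideal_rta_add[OF assms(1), of k "s - k"] assms(2) by auto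
qed auto

text \<open>
  Together with \<open>ideal_quot_iff\<close> this moves all questions about primes of the residue ring to
  the ring itself, where primality is a statement about ordinary multiplication.
\<close>

lemma primeideal_quot_iff:
  "primeideal P (quot J) \<longleftrightarrow>
     (\<exists>K. ideal K ring_of_type_algebra \<and> J \<subseteq> K \<and> P = coset J ` K \<and> 1 \<notin> K \<and>
        (\<forall>a b. a * b \<in> K \<longrightarrow> a \<in> K \<or> b \<in> K))" (is "?L \<longleftrightarrow> (\<exists>K. ?R K)")
proof
  assume ?L
  then interpret P: primeideal P "quot J" .
  obtain K where K: "ideal K ring_of_type_algebra" "J \<subseteq> K" "P = coset J ` K"
    using P.ideal_axioms ideal_quot_iff by blast
  have "1 \<notin> K"
  proof
    assume "1 \<in> K"
    then have "\<one>\<^bsub>quot J\<^esub> \<in> P" using K(3) by (simp add: quot_one)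
    then show False using P.I_notcarr P.one_imp_carrier by blast
  qed
  moreover have "a \<in> K \<or> b \<in> K" if "a * b \<in> K" for a b
    using P.I_prime[of "coset J a" "coset J b"] that coset_in_image_iff[OF K(1,2)] K(3)
    by (auto simp: quot_mult quot_carrier)
  ultimately show "\<exists>K. ?R K" using K by blast
next
  assume "\<exists>K. ?R K"
  then obtain K where K: "ideal K ring_of_type_algebra" "J \<subseteq> K" "P = coset J ` K" "1 \<notin> K"
    and pr: "\<And>a b. a * b \<in> K \<Longrightarrow> a \<in> K \<or> b \<in> K" by blast
  show ?L
  proof (intro primeideal.intro primeideal_axioms.intro)
    show "ideal P (quot J)" using K ideal_quot_iff by blast
    show "cring (quot J)" by (rule cring_quot)
    show "carrier (quot J) \<noteq> P"
      using K(3,4) coset_in_image_iff[OF K(1,2), of 1] quot_carrier by (metis rangeI)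
  next
    fix A B assume AB: "A \<in> carrier (quot J)" "B \<in> carrier (quot J)" "A \<otimes>\<^bsub>quot J\<^esub> B \<in> P"
    then obtain a b where ab: "A = coset J a" "B = coset J b" by (auto simp: quot_carrier)
    then have "a * b \<in> K"
      using AB(3) K(3) coset_in_image_iff[OF K(1,2), of "a * b"] by (simp add: quot_mult)
    then show "A \<in> P \<or> B \<in> P"
      using pr ab K(3) by blast
  qed
qed

end

section \<open>Vectors and linear maps\<close>

text \<open>
  An element of the free module of rank \<open>n\<close> is represented by a function on all of \<open>nat\<close>, of which
  only the first \<open>n\<close> entries matter, and a linear map is one that is defined on all such functions
  and ignores the other entries. In this way linear maps form a plain function space, and
  compositions, sums and differences of them carry no side conditions.
\<close>

definition vscale :: "'a::comm_ring_1 \<Rightarrow> (nat \<Rightarrow> 'a) \<Rightarrow> nat \<Rightarrow> 'a" where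
  "vscale c v = (\<lambda>i. c * v i)"

lemma vscale_apply [simp]: "vscale c v i = c * v i"
  by (simp add: vscale_def)

lemma module_vscale: "Modules.module vscale"
  by unfold_locales (auto simp: fun_eq_iff algebra_simps)

lemma module_times: "Modules.module ((*) :: 'a::comm_ring_1 \<Rightarrow> _)"
  by unfold_locales (auto simp: algebra_simps)

abbreviation vlin :: "((nat \<Rightarrow> 'a::comm_ring_1) \<Rightarrow> nat \<Rightarrow> 'a) \<Rightarrow> bool" where
  "vlin \<equiv> Modules.module_hom vscale vscale"

abbreviation slin :: "((nat \<Rightarrow> 'a::comm_ring_1) \<Rightarrow> 'a) \<Rightarrow> bool" where
  "slin \<equiv> Modules.module_hom vscale (*)"

lemma vlinI: "(\<And>u v. f (u + v) = f u + f v) \<Longrightarrow> (\<And>c v. f (vscale c v) = vscale c (f v)) \<Longrightarrow> vlin f"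
  by (simp add: module_hom_iff module_vscale)

lemma slinI: "(\<And>u v. f (u + v) = f u + f v) \<Longrightarrow> (\<And>c v. f (vscale c v) = c * f v) \<Longrightarrow> slin f"
  by (simp add: module_hom_iff module_vscale module_times)

lemmas lin_add = Modules.module_hom.add
lemmas lin_scale = Modules.module_hom.scale
lemmas lin_diff = Modules.module_hom.diff
lemmas lin_zero = Modules.module_hom.zero

lemma lin_comp: "vlin f \<Longrightarrow> Modules.module_hom vscale s g \<Longrightarrow> Modules.module_hom vscale s (\<lambda>v. g (f v))"
  using module_hom_compose[of vscale vscale f s g] by (simp add: o_def)

definition trunc :: "nat \<Rightarrow> (nat \<Rightarrow> 'a::zero) \<Rightarrow> nat \<Rightarrow> 'a" where
  "trunc n v = (\<lambda>i. if i < n then v i else 0)"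

definition unit_vec :: "nat \<Rightarrow> nat \<Rightarrow> 'a::zero_neq_one" where
  "unit_vec j = (\<lambda>i. if i = j then 1 else 0)"

lemma trunc_trunc [simp]: "trunc n (trunc n v) = trunc n v"
  by (simp add: trunc_def fun_eq_iff)

lemma trunc_add [simp]: "trunc n (u + v) = trunc n u + trunc n (v :: nat \<Rightarrow> 'a::comm_ring_1)"
  by (simp add: trunc_def fun_eq_iff)

lemma trunc_diff [simp]: "trunc n (u - v) = trunc n u - trunc n (v :: nat \<Rightarrow> 'a::comm_ring_1)"
  by (simp add: trunc_def fun_eq_iff)

lemma trunc_vscale [simp]: "trunc n (vscale c v) = vscale c (trunc n v)"
  by (simp add: trunc_def fun_eq_iff)

lemma trunc_zero [simp]: "trunc n 0 = (0 :: nat \<Rightarrow> 'a::comm_ring_1)"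
  by (simp add: trunc_def fun_eq_iff)

lemma vlin_trunc: "vlin (trunc n)"
  by (rule vlinI) auto

lemma sum_fun_apply: "(sum f A) i = (\<Sum>j\<in>A. f j i)" for f :: "_ \<Rightarrow> nat \<Rightarrow> 'a::comm_ring_1"
  by (induction A rule: infinite_finite_induct) auto

lemma trunc_expand: "trunc n v = (\<Sum>j<n. vscale (v j) (unit_vec j :: nat \<Rightarrow> 'a::comm_ring_1))"
proof
  fix i
  have "(\<Sum>j<n. vscale (v j) (unit_vec j)) i = (\<Sum>j<n. if j = i then v i else 0)"
    unfolding sum_fun_apply by (rule sum.cong) (auto simp: unit_vec_def)
  then show "trunc n v i = (\<Sum>j<n. vscale (v j) (unit_vec j)) i"
    by (simp add: trunc_def)
qed

text \<open>
  The lifting property of free modules. The relation \<open>P\<close> is a submodule of a product of two free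
  modules; if each basis vector is related to something, a linear choice exists. Taking
  \<open>P u w\<close> to be an equation \<open>f u = g w\<close> gives the usual lifting along \<open>g\<close>, and an equation
  modulo an ideal is covered as well.
\<close>

lemma free_lift:
  fixes P :: "(nat \<Rightarrow> 'a::comm_ring_1) \<Rightarrow> (nat \<Rightarrow> 'a) \<Rightarrow> bool"
  assumes zero: "P 0 0"
    and add: "\<And>u w u' w'. P u w \<Longrightarrow> P u' w' \<Longrightarrow> P (u + u') (w + w')"
    and scale: "\<And>c u w. P u w \<Longrightarrow> P (vscale c u) (vscale c w)"
    and basis: "\<And>j. j < n \<Longrightarrow> \<exists>w. trunc m w = w \<and> P (unit_vec j) w"
  obtains h where "vlin h" "\<And>v. h (trunc n v) = h v" "\<And>v. trunc m (h v) = h v"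
    "\<And>v. P (trunc n v) (h v)"
proof -
  obtain w where w: "\<And>j. j < n \<Longrightarrow> trunc m (w j) = w j" "\<And>j. j < n \<Longrightarrow> P (unit_vec j) (w j)"
    using basis by metis
  define h where "h = (\<lambda>v. \<Sum>j<n. vscale (v j) (w j))"
  show ?thesis
  proof (rule that)
    show "vlin h"
      by (rule vlinI) (auto simp: h_def fun_eq_iff sum_fun_apply algebra_simps sum.distrib sum_distrib_left)
    show "h (trunc n v) = h v" for v
      unfolding h_def by (rule sum.cong) (auto simp: trunc_def)
    have "trunc m (w j) i = w j i" if "j < n" for j i using w(1) that by simp
    then have "w j i = 0" if "j < n" "\<not> i < m" for i j using that by (metis trunc_def)
    then show "trunc m (h v) = h v" for v
      by (auto simp: fun_eq_iff trunc_def h_def sum_fun_apply)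
    have "P (\<Sum>j\<in>A. vscale (v j) (unit_vec j)) (\<Sum>j\<in>A. vscale (v j) (w j))"
      if "A \<subseteq> {..<n}" for A v
      using finite_subset[OF that finite_lessThan] that
      by (induction A rule: finite_induct) (auto intro: zero add scale w(2))
    then show "P (trunc n v) (h v)" for v
      unfolding trunc_expand h_def by blast
  qed
qed

section \<open>Comparison of free resolutions\<close>

text \<open>
  A free resolution of \<open>R/J\<close> with ranks \<open>r\<close>, differentials \<open>D\<close> and an augmentation \<open>e\<close> which is
  lifted to \<open>R\<close>: the composite of \<open>e\<close> with the projection to \<open>R/J\<close> is the augmentation proper.
\<close>

definition resolves :: "'a::comm_ring_1 set \<Rightarrow> (nat \<Rightarrow> nat) \<Rightarrow> (nat \<Rightarrow> (nat \<Rightarrow> 'a) \<Rightarrow> nat \<Rightarrow> 'a) \<Rightarrow>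
    ((nat \<Rightarrow> 'a) \<Rightarrow> 'a) \<Rightarrow> bool" where
  "resolves J r D e \<longleftrightarrow>
     slin e \<and> (\<forall>v. e (trunc (r 0) v) = e v) \<and> (\<exists>v. e v - 1 \<in> J) \<and>
     (\<forall>i. vlin (D i)) \<and> (\<forall>i v. D i (trunc (r (Suc i)) v) = D i v) \<and>
     (\<forall>i v. trunc (r i) (D i v) = D i v) \<and>
     (\<forall>v. e v \<in> J \<longleftrightarrow> (\<exists>w. trunc (r 0) v = D 0 w)) \<and>
     (\<forall>i v. D i v = 0 \<longleftrightarrow> (\<exists>w. trunc (r (Suc i)) v = D (Suc i) w))"

context
  fixes J :: "'a::comm_ring_1 set" and r D e
  assumes res: "resolves J r D e"
begin

lemma
  shows res_slin: "slin e"
    and res_aug_trunc: "e (trunc (r 0) v) = e v"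
    and res_aug_one: "\<exists>v. e v - 1 \<in> J"
    and res_vlin: "vlin (D i)"
    and res_diff_trunc: "D i (trunc (r (Suc i)) v) = D i v"
    and res_trunc_diff: "trunc (r i) (D i v) = D i v"
    and res_exact_aug: "e v \<in> J \<longleftrightarrow> (\<exists>w. trunc (r 0) v = D 0 w)"
    and res_exact: "D i v = 0 \<longleftrightarrow> (\<exists>w. trunc (r (Suc i)) v = D (Suc i) w)"
  using res by (simp_all add: resolves_def)

lemma res_aug_diff: "e (D 0 v) \<in> J"
  using res_exact_aug res_trunc_diff by blast

lemma res_diff_diff: "D i (D (Suc i) v) = 0"
  using res_exact res_trunc_diff by blast

end


text \<open>
  An endomorphism of a resolution that induces zero on the resolved module is null homotopic: the
  homotopy is built degree by degree, since \<open>\<phi> - h D\<close> is killed by the differential and can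
  be lifted by exactness.
\<close>

lemma null_homotopic:
  fixes \<phi> :: "nat \<Rightarrow> (nat \<Rightarrow> 'a::comm_ring_1) \<Rightarrow> nat \<Rightarrow> 'a"
  assumes res: "resolves J r D e"
    and lin: "\<And>i. vlin (\<phi> i)" and trunc: "\<And>i v. trunc (r i) (\<phi> i v) = \<phi> i v"
    and chain: "\<And>i v. \<phi> i (D i v) = D i (\<phi> (Suc i) v)"
    and aug: "\<And>v. e (\<phi> 0 v) \<in> J"
  obtains h h' where "vlin h" "vlin h'"
    "\<And>v. \<phi> (Suc i) (trunc (r (Suc i)) v) = D (Suc i) (h' v) + h (D i v)"
proof -
  note D = res_vlin[OF res]
  note lins = lin_add[OF lin] lin_scale[OF lin] lin_zero[OF lin] lin_add[OF D] lin_scale[OF D] lin_zero[OF D]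
  have step: "\<exists>h'. vlin h' \<and> (\<forall>v. trunc (r (Suc (Suc i))) (h' v) = h' v) \<and>
      (\<forall>v. D (Suc i) (h' v) = \<phi> (Suc i) (trunc (r (Suc i)) v) - h (D i v))"
    if h: "vlin h" "\<And>v. D i (h (D i v)) = \<phi> i (D i v)" "\<And>v. trunc (r (Suc i)) (h v) = h v" for h i
  proof -
    have "\<exists>w. trunc (r (Suc (Suc i))) w = w \<and> D (Suc i) w = \<phi> (Suc i) u - h (D i u)" for u
    proof -
      have "D i (\<phi> (Suc i) u - h (D i u)) = 0"
        by (simp add: lin_diff[OF D] h(2) chain)
      then obtain w where w: "trunc (r (Suc i)) (\<phi> (Suc i) u - h (D i u)) = D (Suc i) w"
        using res_exact[OF res] by blast
      then show ?thesis
        by (intro exI[of _ "trunc (r (Suc (Suc i))) w"]) (simp add: res_diff_trunc[OF res] trunc h(3))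
    qed
    then obtain h' where "vlin h'" "\<And>v. trunc (r (Suc (Suc i))) (h' v) = h' v"
      "\<And>v. D (Suc i) (h' v) = \<phi> (Suc i) (trunc (r (Suc i)) v) - h (D i (trunc (r (Suc i)) v))"
      by (rule_tac free_lift[of "\<lambda>u w. D (Suc i) w = \<phi> (Suc i) u - h (D i u)" "r (Suc i)" "r (Suc (Suc i))"])
        (auto simp: lins lin_add[OF h(1)] lin_scale[OF h(1)] lin_zero[OF h(1)]
          Modules.module.scale_right_diff_distrib[OF module_vscale] add_diff_add)
    then show ?thesis by (auto simp: res_diff_trunc[OF res])
  qed
  have "\<exists>h. vlin h \<and> (\<forall>v. D i (h (D i v)) = \<phi> i (D i v)) \<and> (\<forall>v. trunc (r (Suc i)) (h v) = h v)" for i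
  proof (induction i)
    case 0
    have "\<exists>w. trunc (r (Suc 0)) w = w \<and> D 0 w = \<phi> 0 u" for u
    proof -
      obtain w where w: "trunc (r 0) (\<phi> 0 u) = D 0 w"
        using res_exact_aug[OF res] aug by blast
      then show ?thesis
        by (intro exI[of _ "trunc (r (Suc 0)) w"]) (simp add: res_diff_trunc[OF res] trunc)
    qed
    then obtain h where "vlin h" "\<And>v. trunc (r (Suc 0)) (h v) = h v"
      "\<And>v. D 0 (h v) = \<phi> 0 (trunc (r 0) v)"
      by (rule_tac free_lift[of "\<lambda>u w. D 0 w = \<phi> 0 u" "r 0" "r (Suc 0)"]) (auto simp: lins)
    then show ?case by (metis res_trunc_diff[OF res])
  next
    case (Suc i)
    then obtain h where h: "vlin h" "\<And>v. D i (h (D i v)) = \<phi> i (D i v)" "\<And>v. trunc (r (Suc i)) (h v) = h v"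
      by blast
    from step[OF this] obtain h' where h': "vlin h'" "\<And>v. trunc (r (Suc (Suc i))) (h' v) = h' v"
      "\<And>v. D (Suc i) (h' v) = \<phi> (Suc i) (trunc (r (Suc i)) v) - h (D i v)" by blast
    have "D (Suc i) (h' (D (Suc i) v)) = \<phi> (Suc i) (D (Suc i) v)" for v
      by (simp add: h'(3) res_trunc_diff[OF res] res_diff_diff[OF res] lin_zero[OF h(1)])
    then show ?case using h' by blast
  qed
  then obtain h where h: "vlin h" "\<And>v. D i (h (D i v)) = \<phi> i (D i v)" "\<And>v. trunc (r (Suc i)) (h v) = h v"
    by blast
  from step[OF this] obtain h' where h': "vlin h'"
    "\<And>v. D (Suc i) (h' v) = \<phi> (Suc i) (trunc (r (Suc i)) v) - h (D i v)" by blast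
  show ?thesis
    using that[OF h(1) h'(1)] h'(2) by (metis diff_add_cancel)
qed

text \<open>
  The comparison theorem: the identity of \<open>R/J\<close> lifts to a chain map between any two
  resolutions, by repeated lifting along the exact target complex.
\<close>

lemma chain_map_exists:
  fixes J :: "'a::comm_ring_1 set"
  assumes J: "ideal J ring_of_type_algebra"
    and F: "resolves J r D e" and G: "resolves J r' D' e'"
  obtains \<alpha> where "\<And>i. vlin (\<alpha> i)" "\<And>i v. trunc (r' i) (\<alpha> i v) = \<alpha> i v"
    "\<And>i v. \<alpha> i (trunc (r i) v) = \<alpha> i v"
    "\<And>i v. \<alpha> i (D i v) = D' i (\<alpha> (Suc i) v)" "\<And>v. e' (\<alpha> 0 v) - e v \<in> J"
proof -
  note D = res_vlin[OF F] and D' = res_vlin[OF G]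
  note lins = lin_add[OF D] lin_scale[OF D] lin_zero[OF D] lin_add[OF D'] lin_scale[OF D'] lin_zero[OF D']
  have e0: "e 0 = 0" "e' 0 = 0" by (simp_all add: lin_zero[OF res_slin[OF F]] lin_zero[OF res_slin[OF G]])
  define Q where "Q = (\<lambda>i a. vlin a \<and> (\<forall>v. trunc (r' i) (a v) = a v) \<and> (\<forall>v. a (trunc (r i) v) = a v) \<and>
      (case i of 0 \<Rightarrow> \<forall>v. e' (a v) - e v \<in> J | Suc j \<Rightarrow> \<forall>v. D' j (a (D i v)) = 0))"
  have "\<exists>\<alpha>. \<forall>i. Q i (\<alpha> i) \<and> (\<forall>v. \<alpha> i (D i v) = D' i (\<alpha> (Suc i) v))"
  proof (rule dependent_nat_choice)
    obtain v1 where v1: "e' v1 - 1 \<in> J" using res_aug_one[OF G] by blast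
    have "\<exists>w. trunc (r' 0) w = w \<and> e' w - e u \<in> J" for u
    proof -
      have "e' (trunc (r' 0) (vscale (e u) v1)) - e u = e u * (e' v1 - 1)"
        by (simp add: res_aug_trunc[OF G] lin_scale[OF res_slin[OF G]] algebra_simps del: trunc_vscale)
      then show ?thesis using v1 ideal_rta_mult[OF J] by (metis trunc_trunc)
    qed
    moreover have "e' (w + w') - e (u + u') \<in> J" if "e' w - e u \<in> J" "e' w' - e u' \<in> J" for u u' w w'
      using ideal_rta_add[OF J that]
      by (simp add: lin_add[OF res_slin[OF F]] lin_add[OF res_slin[OF G]] algebra_simps)
    moreover have "e' (vscale c w) - e (vscale c u) \<in> J" if "e' w - e u \<in> J" for c u w
      using ideal_rta_mult[OF J that, of c]
      by (simp add: lin_scale[OF res_slin[OF F]] lin_scale[OF res_slin[OF G]] algebra_simps)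
    ultimately obtain a where "vlin a" "\<And>v. trunc (r' 0) (a v) = a v" "\<And>v. a (trunc (r 0) v) = a v"
        "\<And>v. e' (a v) - e (trunc (r 0) v) \<in> J"
      by (rule_tac free_lift[of "\<lambda>u w. e' w - e u \<in> J" "r 0" "r' 0"])
        (auto simp: e0 ideal_rta_zero[OF J])
    then show "\<exists>a. Q 0 a" by (auto simp: Q_def res_aug_trunc[OF F])
  next
    fix a i assume a: "Q i a"
    then have a': "vlin a" "\<And>v. trunc (r' i) (a v) = a v" by (auto simp: Q_def)
    have "\<exists>w. trunc (r' (Suc i)) w = w \<and> D' i w = a (D i u)" for u
    proof -
      have "\<exists>w. trunc (r' i) (a (D i u)) = D' i w"
      proof (cases i)
        case 0
        have "e' (a (D 0 u)) - e (D 0 u) \<in> J" using a 0 by (auto simp: Q_def)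
        from ideal_rta_add[OF J this res_aug_diff[OF F, of u]]
        show ?thesis using 0 res_exact_aug[OF G] by simp
      next
        case (Suc j)
        then show ?thesis using a res_exact[OF G] by (auto simp: Q_def)
      qed
      then show ?thesis by (metis a'(2) res_diff_trunc[OF G] trunc_trunc)
    qed
    then obtain b where b: "vlin b" "\<And>v. trunc (r' (Suc i)) (b v) = b v"
        "\<And>v. b (trunc (r (Suc i)) v) = b v" "\<And>v. D' i (b v) = a (D i (trunc (r (Suc i)) v))"
      by (rule_tac free_lift[of "\<lambda>u w. D' i w = a (D i u)" "r (Suc i)" "r' (Suc i)"])
        (auto simp: lins lin_add[OF a'(1)] lin_scale[OF a'(1)] lin_zero[OF a'(1)])
    then have b4: "D' i (b v) = a (D i v)" for v by (simp add: res_diff_trunc[OF F])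
    have "Q (Suc i) b"
      using b b4 by (auto simp: Q_def res_diff_diff[OF F] lin_zero[OF a'(1)])
    then show "\<exists>b. Q (Suc i) b \<and> (\<forall>v. a (D i v) = D' i (b v))" using b4 by auto
  qed
  then obtain \<alpha> where \<alpha>: "\<And>i. Q i (\<alpha> i)" "\<And>i v. \<alpha> i (D i v) = D' i (\<alpha> (Suc i) v)" by blast
  moreover have "e' (\<alpha> 0 v) - e v \<in> J" for v using \<alpha>(1)[of 0] by (simp add: Q_def)
  ultimately show ?thesis
    using that[of \<alpha>] by (simp add: Q_def)
qed

section \<open>Homomorphisms from cohomology to the residue ring\<close>

definition cocycle :: "(nat \<Rightarrow> nat) \<Rightarrow> (nat \<Rightarrow> (nat \<Rightarrow> 'a::comm_ring_1) \<Rightarrow> nat \<Rightarrow> 'a) \<Rightarrow> nat \<Rightarrow>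
    ((nat \<Rightarrow> 'a) \<Rightarrow> 'a) \<Rightarrow> bool" where
  "cocycle r D i z \<longleftrightarrow> slin z \<and> (\<forall>v. z (trunc (r i) v) = z v) \<and> (\<forall>v. z (D i v) = 0)"

text \<open>
  An \<open>R\<close>-linear map from the cohomology of the dual complex in degree \<open>Suc k\<close> to \<open>R/J\<close>, written
  without quotients: a function on cocycles with values in \<open>R\<close> that is linear modulo \<open>J\<close> and maps
  coboundaries into \<open>J\<close>. The values of such functions, modulo \<open>J\<close>, generate the trace.
\<close>

definition functional_mod :: "'a::comm_ring_1 set \<Rightarrow> (nat \<Rightarrow> nat) \<Rightarrow>
    (nat \<Rightarrow> (nat \<Rightarrow> 'a) \<Rightarrow> nat \<Rightarrow> 'a) \<Rightarrow> nat \<Rightarrow> (((nat \<Rightarrow> 'a) \<Rightarrow> 'a) \<Rightarrow> 'a) \<Rightarrow> bool" where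
  "functional_mod J r D k \<psi> \<longleftrightarrow>
     (\<forall>z z'. cocycle r D (Suc k) z \<longrightarrow> cocycle r D (Suc k) z' \<longrightarrow>
        \<psi> (\<lambda>v. z v + z' v) - (\<psi> z + \<psi> z') \<in> J) \<and>
     (\<forall>c z. cocycle r D (Suc k) z \<longrightarrow> \<psi> (\<lambda>v. c * z v) - c * \<psi> z \<in> J) \<and>
     (\<forall>u. slin u \<longrightarrow> \<psi> (\<lambda>v. u (D k v)) \<in> J)"

lemma cocycle_boundary:
  assumes "resolves J r D e" "slin u"
  shows "cocycle r D (Suc k) (\<lambda>v. u (D k v))"
  unfolding cocycle_def
  by (simp add: lin_comp[OF res_vlin[OF assms(1)] assms(2)] res_diff_trunc[OF assms(1)]
      res_diff_diff[OF assms(1)] lin_zero[OF assms(2)])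

lemma cocycle_add:
  assumes "cocycle r D i z" "cocycle r D i z'"
  shows "cocycle r D i (\<lambda>v. z v + z' v)"
  using assms unfolding cocycle_def
  by (auto intro!: slinI simp: lin_add[of vscale "(*)"] lin_scale[of vscale "(*)"] algebra_simps)

lemma cocycle_scale:
  assumes "cocycle r D i z"
  shows "cocycle r D i (\<lambda>v. c * z v)"
  using assms unfolding cocycle_def
  by (auto intro!: slinI simp: lin_add[of vscale "(*)"] lin_scale[of vscale "(*)"] algebra_simps)

text \<open>
  The dual of a null homotopic map sends cocycles to coboundaries.
\<close>

lemma homotopic_cocycles:
  fixes z :: "(nat \<Rightarrow> 'a::comm_ring_1) \<Rightarrow> 'a"
  assumes res: "resolves J r D e"
    and z: "cocycle r D (Suc k) z"
    and lin: "\<And>i. vlin (\<phi> i)" and trunc: "\<And>i v. trunc (r i) (\<phi> i v) = \<phi> i v"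
    and chain: "\<And>i v. \<phi> i (D i v) = D i (\<phi> (Suc i) v)"
    and aug: "\<And>v. e (\<phi> 0 v) \<in> J"
  obtains u where "slin u" "\<And>v. z (\<phi> (Suc k) (trunc (r (Suc k)) v)) = u (D k v)"
proof -
  obtain h h' where h: "vlin h" "vlin h'"
    "\<And>v. \<phi> (Suc k) (trunc (r (Suc k)) v) = D (Suc k) (h' v) + h (D k v)"
    using null_homotopic[of J r D e \<phi> k, OF res lin trunc chain aug] by blast
  have zlin: "slin z" using z by (simp add: cocycle_def)
  show ?thesis
  proof (rule that)
    show "slin (\<lambda>v. z (h v))" by (rule lin_comp[OF h(1) zlin])
    show "z (\<phi> (Suc k) (trunc (r (Suc k)) v)) = z (h (D k v))" for v
      using z by (simp add: h(3) lin_add[OF zlin] cocycle_def)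
  qed
qed

text \<open>
  Multiplication by an element of \<open>J\<close> induces zero on \<open>R/J\<close>, so it is null homotopic on the
  resolution and kills the cohomology.
\<close>

lemma cocycle_annihilated:
  assumes J: "ideal J ring_of_type_algebra" and res: "resolves J r D e"
    and z: "cocycle r D (Suc k) z" and a: "a \<in> J"
  obtains u where "slin u" "\<And>v. a * z v = u (D k v)"
proof -
  note D = res_vlin[OF res]
  have zlin: "slin z" using z by (simp add: cocycle_def)
  obtain u where u: "slin u"
    "\<And>v. z (vscale a (trunc (r (Suc k)) (trunc (r (Suc k)) v))) = u (D k v)"
  proof (rule homotopic_cocycles[of J r D e k z "\<lambda>i v. vscale a (trunc (r i) v)", OF res z])
    show "vlin (\<lambda>v. vscale a (trunc (r i) v))" for i
      by (rule vlinI) (auto simp: fun_eq_iff trunc_def algebra_simps)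
    show "vscale a (trunc (r i) (D i v)) = D i (vscale a (trunc (r (Suc i)) v))" for i v
      by (simp add: res_trunc_diff[OF res] lin_scale[OF D] res_diff_trunc[OF res])
    show "e (vscale a (trunc (r 0) v)) \<in> J" for v
      using ideal_rta_mult_right[OF J a] by (simp add: lin_scale[OF res_slin[OF res]])
  qed auto
  moreover have "z (vscale a (trunc (r (Suc k)) v)) = a * z v" for v
    using z by (simp add: lin_scale[OF zlin] cocycle_def)
  ultimately show ?thesis using that by simp
qed

text \<open>
  The trace does not depend on the resolution. With chain maps \<open>\<alpha>\<close> and \<open>\<beta>\<close> in opposite
  directions, the functional \<open>\<psi>\<close> is pulled back along \<open>\<beta>\<close> and the cocycle \<open>z\<close> along \<open>\<alpha>\<close>. As
  \<open>\<alpha> \<circ> \<beta>\<close> is homotopic to the identity, the value changes only by an element of \<open>J\<close>.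
\<close>

lemma functional_mod_transfer:
  fixes J :: "'a::comm_ring_1 set"
  assumes J: "ideal J ring_of_type_algebra"
    and F: "resolves J r D e" and G: "resolves J r' D' e'"
    and \<psi>: "functional_mod J r' D' k \<psi>" and z: "cocycle r' D' (Suc k) z"
  obtains \<psi>1 z1 where "functional_mod J r D k \<psi>1" "cocycle r D (Suc k) z1" "\<psi>1 z1 - \<psi> z \<in> J"
proof -
  obtain \<alpha> where \<alpha>: "\<And>i. vlin (\<alpha> i)" "\<And>i v. trunc (r' i) (\<alpha> i v) = \<alpha> i v"
    "\<And>i v. \<alpha> i (trunc (r i) v) = \<alpha> i v"
    "\<And>i v. \<alpha> i (D i v) = D' i (\<alpha> (Suc i) v)" "\<And>v. e' (\<alpha> 0 v) - e v \<in> J"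
    using chain_map_exists[OF J F G] by metis
  obtain \<beta> where \<beta>: "\<And>i. vlin (\<beta> i)" "\<And>i v. trunc (r i) (\<beta> i v) = \<beta> i v"
    "\<And>i v. \<beta> i (trunc (r' i) v) = \<beta> i v"
    "\<And>i v. \<beta> i (D' i v) = D i (\<beta> (Suc i) v)" "\<And>v. e (\<beta> 0 v) - e' v \<in> J"
    using chain_map_exists[OF J G F] by metis
  have zlin: "slin z" using z by (simp add: cocycle_def)
  \<comment> \<open>\<open>trunc (r' i)\<close> is the identity of the free module of rank \<open>r' i\<close>\<close>
  define \<phi> where "\<phi> = (\<lambda>i v. \<alpha> i (\<beta> i v) - trunc (r' i) v)"
  obtain u where u: "slin u" "\<And>v. z (\<phi> (Suc k) (trunc (r' (Suc k)) v)) = u (D' k v)"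
  proof (rule homotopic_cocycles[OF G z])
    show "vlin (\<phi> i)" for i
      unfolding \<phi>_def
      by (rule vlinI) (simp_all add: lin_add[OF \<alpha>(1)] lin_add[OF \<beta>(1)] lin_scale[OF \<alpha>(1)]
          lin_scale[OF \<beta>(1)] Modules.module.scale_right_diff_distrib[OF module_vscale])
    show "trunc (r' i) (\<phi> i v) = \<phi> i v" for i v
      by (simp add: \<phi>_def \<alpha>(2))
    show "\<phi> i (D' i v) = D' i (\<phi> (Suc i) v)" for i v
      by (simp add: \<phi>_def \<alpha>(4) \<beta>(4) res_trunc_diff[OF G] res_diff_trunc[OF G] lin_diff[OF res_vlin[OF G]])
    show "e' (\<phi> 0 v) \<in> J" for v
      using ideal_rta_add[OF J \<alpha>(5)[of "\<beta> 0 v"] \<beta>(5)[of v]]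
      by (simp add: \<phi>_def lin_diff[OF res_slin[OF G]] res_aug_trunc[OF G])
  qed auto
  have coc: "cocycle r' D' (Suc k) (\<lambda>v. w (\<beta> (Suc k) v))" if w: "cocycle r D (Suc k) w" for w
    using w lin_comp[OF \<beta>(1)] by (auto simp: cocycle_def \<beta>(3,4))
  have coc': "cocycle r D (Suc k) (\<lambda>v. z (\<alpha> (Suc k) v))"
    using z lin_comp[OF \<alpha>(1)] by (auto simp: cocycle_def \<alpha>(3,4))
  show ?thesis
  proof (rule that[OF _ coc'])
    show "functional_mod J r D k (\<lambda>w. \<psi> (\<lambda>v. w (\<beta> (Suc k) v)))"
      unfolding functional_mod_def
    proof (intro conjI allI impI)
      fix u :: "(nat \<Rightarrow> 'a) \<Rightarrow> 'a" assume "slin u"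
      then have "slin (\<lambda>v. u (\<beta> k v))" by (rule lin_comp[OF \<beta>(1)])
      then show "\<psi> (\<lambda>v. u (D k (\<beta> (Suc k) v))) \<in> J"
        using \<psi> by (auto simp: functional_mod_def simp flip: \<beta>(4))
    qed (use \<psi> coc in \<open>auto simp: functional_mod_def\<close>)
    have "z (\<alpha> (Suc k) (\<beta> (Suc k) v)) = z v + u (D' k v)" for v
      using u(2)[of v] z by (simp add: \<phi>_def \<beta>(3) lin_diff[OF zlin] cocycle_def algebra_simps)
    then have eq: "(\<lambda>v. z (\<alpha> (Suc k) (\<beta> (Suc k) v))) = (\<lambda>v. z v + u (D' k v))" by simp
    have "\<psi> (\<lambda>v. z v + u (D' k v)) - (\<psi> z + \<psi> (\<lambda>v. u (D' k v))) \<in> J"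
      "\<psi> (\<lambda>v. u (D' k v)) \<in> J"
      using \<psi> z cocycle_boundary[OF G u(1)] u(1) by (auto simp: functional_mod_def)
    from ideal_rta_add[OF J this]
    show "\<psi> (\<lambda>v. z (\<alpha> (Suc k) (\<beta> (Suc k) v))) - \<psi> z \<in> J"
      unfolding eq by simp
  qed
qed

section \<open>Free resolutions as records of modules\<close>

text \<open>
  Translates a function on \<open>nat\<close> into the extensional functions on \<open>{..<n}\<close> that form the carrier
  of \<open>free_module\<close>; \<open>trunc\<close> is the translation back.
\<close>

definition emb :: "nat \<Rightarrow> (nat \<Rightarrow> 'a) \<Rightarrow> nat \<Rightarrow> 'a" where
  "emb n v = restrict v {..<n}"

abbreviation fmod :: "nat \<Rightarrow> ('a::comm_ring_1, nat \<Rightarrow> 'a) module" where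
  "fmod n \<equiv> free_module (ring_of_type_algebra :: 'a ring) n"

abbreviation reg :: "('a::comm_ring_1, 'a) module" where
  "reg \<equiv> regular_module (ring_of_type_algebra :: 'a ring)"

abbreviation qmod :: "'a::comm_ring_1 set \<Rightarrow> ('a, 'a set) module" where
  "qmod J \<equiv> quot_module (ring_of_type_algebra :: 'a ring) reg J"

lemma emb_trunc [simp]: "emb n (trunc n v) = emb n v"
  by (auto simp: emb_def trunc_def)

lemma trunc_emb [simp]: "trunc n (emb n v) = trunc n v"
  by (auto simp: emb_def trunc_def)

lemma emb_emb [simp]: "emb n (emb n v) = emb n v"
  by (auto simp: emb_def)

lemma emb_eq_iff: "emb n u = emb n v \<longleftrightarrow> trunc n u = trunc n (v :: nat \<Rightarrow> 'a::comm_ring_1)"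
  unfolding emb_def trunc_def fun_eq_iff restrict_def by auto

lemma fmod_carrier: "carrier (fmod n) = range (emb n)"
proof -
  have "u = emb n u" if "u \<in> carrier (fmod n)" for u :: "nat \<Rightarrow> 'a"
    using that by (auto simp: free_module_def emb_def PiE_def extensional_def)
  moreover have "emb n u \<in> carrier (fmod n)" for u :: "nat \<Rightarrow> 'a"
    by (auto simp: free_module_def emb_def)
  ultimately show ?thesis by blast
qed

lemma emb_in_carrier [simp]: "emb n v \<in> carrier (fmod n)"
  by (simp add: fmod_carrier)

lemma emb_id: "u \<in> carrier (fmod n) \<Longrightarrow> emb n u = u"
  by (auto simp: fmod_carrier)

lemma fmod_ops:
  "emb n u \<oplus>\<^bsub>fmod n\<^esub> emb n v = emb n (u + v)"
  "c \<odot>\<^bsub>fmod n\<^esub> emb n u = emb n (vscale c u)"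
  "\<zero>\<^bsub>fmod n\<^esub> = emb n (0 :: nat \<Rightarrow> 'a::comm_ring_1)"
  by (auto simp: free_module_def emb_def)

lemma reg_ops [simp]:
  "carrier (reg :: ('a::comm_ring_1, 'a) module) = UNIV"
  "a \<oplus>\<^bsub>reg\<^esub> b = a + (b :: 'a)"
  "c \<odot>\<^bsub>reg\<^esub> b = c * (b :: 'a)"
  "\<zero>\<^bsub>reg\<^esub> = (0 :: 'a)"
  by (auto simp: regular_module_def)

context
  fixes J :: "'a::comm_ring_1 set"
  assumes J: "ideal J ring_of_type_algebra"
begin

lemma reg_coset: "J +>\<^bsub>reg\<^esub> s = coset J s"
  by (simp add: a_r_coset_def')

lemma qmod_ops:
  "carrier (qmod J) = range (coset J)"
  "coset J a \<oplus>\<^bsub>qmod J\<^esub> coset J b = coset J (a + b)"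
  "c \<odot>\<^bsub>qmod J\<^esub> coset J b = coset J (c * b)"
  "\<zero>\<^bsub>qmod J\<^esub> = coset J 0"
proof -
  show "carrier (qmod J) = range (coset J)"
    by (auto simp: quot_module_def A_RCOSETS_def' reg_coset)
  show "coset J a \<oplus>\<^bsub>qmod J\<^esub> coset J b = coset J (a + b)"
    using quot_add[OF J, of a b] by (simp add: quot_module_def FactRing_def set_add_def')
  show "\<zero>\<^bsub>qmod J\<^esub> = coset J 0"
    by (simp add: quot_module_def coset_zero[OF J])
  have "coset J (c * x) = coset J (c * b)" if "x \<in> coset J b" for x
    using that ideal_rta_mult[OF J, of "x - b" c]
    by (simp add: mem_coset_iff[OF J] coset_eq_iff[OF J] algebra_simps)
  moreover have "b \<in> coset J b" by (simp add: mem_coset_iff[OF J] ideal_rta_zero[OF J])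
  ultimately have "(\<Union>x\<in>coset J b. coset J (c * x)) = coset J (c * b)" by blast
  then show "c \<odot>\<^bsub>qmod J\<^esub> coset J b = coset J (c * b)"
    by (simp add: quot_module_def reg_coset)
qed

end

lemma linear_map_fmod_vlin:
  assumes "f \<in> linear_maps ring_of_type_algebra (fmod n) (fmod m :: ('a::comm_ring_1, _) module)"
  shows "vlin (\<lambda>v. trunc m (f (emb n v)))"
    and "f (emb n v) = emb m (f (emb n v))"
proof -
  have f: "f (emb n v) = emb m (f (emb n v))" for v
    using assms emb_id[of "f (emb n v)" m] by (auto simp: linear_maps_def PiE_iff)
  then show "f (emb n v) = emb m (f (emb n v))" .
  have "f (emb n u \<oplus>\<^bsub>fmod n\<^esub> emb n v) = f (emb n u) \<oplus>\<^bsub>fmod m\<^esub> f (emb n v)" for u v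
    using assms by (simp add: linear_maps_def)
  also have "f (emb n u) \<oplus>\<^bsub>fmod m\<^esub> f (emb n v) = emb m (f (emb n u) + f (emb n v))" for u v
    by (subst (1 2) f) (rule fmod_ops)
  finally have "trunc m (f (emb n (u + v))) = trunc m (f (emb n u)) + trunc m (f (emb n v))" for u v
    by (simp add: fmod_ops)
  moreover have "f (c \<odot>\<^bsub>fmod n\<^esub> emb n u) = c \<odot>\<^bsub>fmod m\<^esub> f (emb n u)" for u c
    using assms by (simp add: linear_maps_def)
  then have "f (c \<odot>\<^bsub>fmod n\<^esub> emb n u) = emb m (vscale c (f (emb n u)))" for u c
    using f[of u] fmod_ops(2)[of m c "f (emb n u)"] by metis
  then have "trunc m (f (emb n (vscale c u))) = vscale c (trunc m (f (emb n u)))" for u c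
    by (simp add: fmod_ops)
  ultimately show "vlin (\<lambda>v. trunc m (f (emb n v)))"
    by (intro vlinI) auto
qed

lemma linear_map_reg_iff:
  fixes f :: "(nat \<Rightarrow> 'a::comm_ring_1) \<Rightarrow> 'a"
  shows "f \<in> linear_maps ring_of_type_algebra (fmod n) reg \<longleftrightarrow>
     slin (\<lambda>v. f (emb n v)) \<and> f \<in> extensional (carrier (fmod n))"
proof
  assume f: "f \<in> linear_maps ring_of_type_algebra (fmod n) reg"
  then have "f (emb n u \<oplus>\<^bsub>fmod n\<^esub> emb n v) = f (emb n u) + f (emb n v)" for u v
    by (simp add: linear_maps_def)
  moreover have "f (c \<odot>\<^bsub>fmod n\<^esub> emb n u) = c * f (emb n u)" for c u
    using f by (simp add: linear_maps_def)
  ultimately show "slin (\<lambda>v. f (emb n v)) \<and> f \<in> extensional (carrier (fmod n))"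
    using f by (auto intro!: slinI simp: linear_maps_def PiE_def fmod_ops)
next
  assume f: "slin (\<lambda>v. f (emb n v)) \<and> f \<in> extensional (carrier (fmod n))"
  then have "f (emb n (u + v)) = f (emb n u) + f (emb n v)" "f (emb n (vscale c u)) = c * f (emb n u)" for u v c
    using lin_add[of vscale "(*)" "\<lambda>v. f (emb n v)"] lin_scale[of vscale "(*)" "\<lambda>v. f (emb n v)"] by auto
  then show "f \<in> linear_maps ring_of_type_algebra (fmod n) reg"
    using f by (auto simp: linear_maps_def PiE_def fmod_carrier fmod_ops)
qed

definition total_diff where
  "total_diff r d = (\<lambda>i v. trunc (r i) (d i (emb (r (Suc i)) v)))"

text \<open>
  The augmentation has values in \<open>R/J\<close>. Lifting the images of the basis vectors to \<open>R\<close> yields the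
  linear map \<open>e\<close>; this is an instance of \<open>free_lift\<close> with a target of rank 1.
\<close>

lemma free_resolution_total:
  fixes J :: "'a::comm_ring_1 set"
  assumes J: "ideal J ring_of_type_algebra"
    and res: "free_resolution ring_of_type_algebra (qmod J) r d \<epsilon>"
  shows "\<exists>e. resolves J r (total_diff r d) e"
    and "d i (emb (r (Suc i)) v) = emb (r i) (total_diff r d i v)"
proof -
  have eps: "\<epsilon> \<in> linear_maps ring_of_type_algebra (fmod (r 0)) (qmod J)"
    and d: "\<And>i. d i \<in> linear_maps ring_of_type_algebra (fmod (r (Suc i))) (fmod (r i))"
    and surj: "\<epsilon> ` carrier (fmod (r 0)) = carrier (qmod J)"
    and ex0: "d 0 ` carrier (fmod (r 1)) = {v \<in> carrier (fmod (r 0)). \<epsilon> v = \<zero>\<^bsub>qmod J\<^esub>}"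
    and ex: "\<And>i. d (Suc i) ` carrier (fmod (r (Suc (Suc i)))) =
           {v \<in> carrier (fmod (r (Suc i))). d i v = \<zero>\<^bsub>fmod (r i)\<^esub>}"
    using res by (auto simp: free_resolution_def Let_def)
  have demb: "d i (emb (r (Suc i)) v) = emb (r i) (total_diff r d i v)" for i v
    using linear_map_fmod_vlin(2)[OF d[of i], of v] unfolding total_diff_def by (metis emb_trunc)
  then show "d i (emb (r (Suc i)) v) = emb (r i) (total_diff r d i v)" .
  have epsc: "\<epsilon> (emb (r 0) u) \<in> range (coset J)" for u
    using eps by (auto simp: linear_maps_def simp flip: qmod_ops(1)[OF J])
  have lin1: "\<epsilon> (emb (r 0) (u + v)) = coset J (a + b)"
    if "\<epsilon> (emb (r 0) u) = coset J a" "\<epsilon> (emb (r 0) v) = coset J b" for u v a b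
  proof -
    have "\<epsilon> (emb (r 0) u \<oplus>\<^bsub>fmod (r 0)\<^esub> emb (r 0) v) = \<epsilon> (emb (r 0) u) \<oplus>\<^bsub>qmod J\<^esub> \<epsilon> (emb (r 0) v)"
      using eps by (simp add: linear_maps_def)
    then show ?thesis by (simp only: that fmod_ops qmod_ops[OF J])
  qed
  have lin2: "\<epsilon> (emb (r 0) (vscale c u)) = coset J (c * a)"
    if "\<epsilon> (emb (r 0) u) = coset J a" for u a c
  proof -
    have "\<epsilon> (c \<odot>\<^bsub>fmod (r 0)\<^esub> emb (r 0) u) = c \<odot>\<^bsub>qmod J\<^esub> \<epsilon> (emb (r 0) u)"
      using eps by (simp add: linear_maps_def)
    then show ?thesis by (simp only: that fmod_ops qmod_ops[OF J])
  qed
  obtain h where h: "vlin h" "\<And>v. h (trunc (r 0) v) = h v"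
     "\<And>v. \<epsilon> (emb (r 0) (trunc (r 0) v)) = coset J (h v 0)"
  proof (rule free_lift[of "\<lambda>u w. \<epsilon> (emb (r 0) u) = coset J (w 0)" "r 0" 1])
    obtain a where a: "\<epsilon> (emb (r 0) 0) = coset J a" using epsc by blast
    then show "\<epsilon> (emb (r 0) 0) = coset J (0 0)"
      using lin2[OF a, of 0] by (simp add: vscale_def zero_fun_def)
  next
    fix j
    obtain a where a: "\<epsilon> (emb (r 0) (unit_vec j)) = coset J a" using epsc by blast
    then show "\<exists>w. trunc 1 w = w \<and> \<epsilon> (emb (r 0) (unit_vec j)) = coset J (w 0)"
      by (intro exI[of _ "trunc 1 (\<lambda>_. a)"]) (simp add: trunc_def fun_eq_iff)
  qed (auto simp: lin1 lin2)
  define e where "e = (\<lambda>v. h v 0)"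
  have e: "\<epsilon> (emb (r 0) v) = coset J (e v)" for v using h(3) by (simp add: e_def)
  have "resolves J r (total_diff r d) e"
    unfolding resolves_def
  proof (intro conjI allI)
    show "slin e" unfolding e_def
      by (rule slinI) (simp_all add: lin_add[OF h(1)] lin_scale[OF h(1)])
    show "e (trunc (r 0) v) = e v" for v by (simp add: e_def h(2))
    have "coset J 1 \<in> \<epsilon> ` carrier (fmod (r 0))" using surj qmod_ops(1)[OF J] by simp
    then obtain v where "coset J (e v) = coset J 1" by (auto simp: fmod_carrier e)
    then show "\<exists>v. e v - 1 \<in> J" using coset_eq_iff[OF J] by blast
    show "vlin (total_diff r d i)" for i
      using linear_map_fmod_vlin(1)[OF d] by (simp add: total_diff_def)
    show "total_diff r d i (trunc (r (Suc i)) v) = total_diff r d i v" for i v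
      by (simp add: total_diff_def)
    show "trunc (r i) (total_diff r d i v) = total_diff r d i v" for i v
      by (simp add: total_diff_def)
    have img: "emb (r i) v \<in> d i ` carrier (fmod (r (Suc i))) \<longleftrightarrow> (\<exists>w. trunc (r i) v = total_diff r d i w)" for i v
    proof -
      have "emb (r i) v \<in> d i ` carrier (fmod (r (Suc i))) \<longleftrightarrow> (\<exists>w. emb (r i) v = d i (emb (r (Suc i)) w))"
        by (auto simp: fmod_carrier)
      also have "\<dots> \<longleftrightarrow> (\<exists>w. trunc (r i) v = trunc (r i) (total_diff r d i w))"
        by (simp add: demb emb_eq_iff)
      finally show ?thesis by (simp add: total_diff_def)
    qed
    show "e v \<in> J \<longleftrightarrow> (\<exists>w. trunc (r 0) v = total_diff r d 0 w)" for v
    proof -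
      have "e v \<in> J \<longleftrightarrow> emb (r 0) v \<in> d 0 ` carrier (fmod (r 1))"
        unfolding ex0 using qmod_ops(4)[OF J] coset_eq_iff[OF J, of "e v" 0] by (simp add: e)
      then show ?thesis using img[of 0 v] by simp
    qed
    show "total_diff r d i v = 0 \<longleftrightarrow> (\<exists>w. trunc (r (Suc i)) v = total_diff r d (Suc i) w)" for i v
    proof -
      have "total_diff r d i v = 0 \<longleftrightarrow> trunc (r i) (total_diff r d i v) = trunc (r i) 0"
        by (simp add: total_diff_def)
      also have "\<dots> \<longleftrightarrow> emb (r (Suc i)) v \<in> d (Suc i) ` carrier (fmod (r (Suc (Suc i))))"
        unfolding ex by (simp add: fmod_ops demb emb_eq_iff)
      finally show ?thesis using img[of "Suc i" v] by simp
    qed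
  qed
  then show "\<exists>e. resolves J r (total_diff r d) e" by blast
qed

lemma range_set_eqI:
  "A \<subseteq> range g \<Longrightarrow> B \<subseteq> range g \<Longrightarrow> (\<And>v. g v \<in> A \<longleftrightarrow> g v \<in> B) \<Longrightarrow> A = B"
  by blast

lemma resolves_free_resolution:
  fixes J :: "'a::comm_ring_1 set"
  assumes J: "ideal J ring_of_type_algebra" and res: "resolves J r D e"
  shows "free_resolution ring_of_type_algebra (qmod J) r
     (\<lambda>i. \<lambda>u\<in>carrier (fmod (r (Suc i))). emb (r i) (D i u)) (\<lambda>u\<in>carrier (fmod (r 0)). coset J (e u))"
proof -
  note D = res_vlin[OF res] and elin = res_slin[OF res]
  have De: "D i (emb (r (Suc i)) v) = D i v" for i v
    by (metis res_diff_trunc[OF res] trunc_emb)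
  have ee: "e (emb (r 0) v) = e v" for v
    by (metis res_aug_trunc[OF res] trunc_emb)
  have img: "(\<exists>w. emb (r i) v = emb (r i) (D i w)) \<longleftrightarrow> (\<exists>w. trunc (r i) v = D i w)" for i v
    by (simp add: emb_eq_iff res_trunc_diff[OF res])
  obtain v1 where v1: "e v1 - 1 \<in> J" using res_aug_one[OF res] by blast
  have aug: "(\<lambda>u\<in>carrier (fmod (r 0)). coset J (e u)) \<in> linear_maps ring_of_type_algebra (fmod (r 0)) (qmod J)"
    by (auto simp: linear_maps_def fmod_carrier fmod_ops qmod_ops[OF J] ee lin_add[OF elin] lin_scale[OF elin])
  have diff: "(\<lambda>u\<in>carrier (fmod (r (Suc i))). emb (r i) (D i u))
     \<in> linear_maps ring_of_type_algebra (fmod (r (Suc i))) (fmod (r i))" for i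
    by (auto simp: linear_maps_def fmod_carrier fmod_ops De lin_add[OF D] lin_scale[OF D])
  have "coset J s \<in> (\<lambda>u\<in>carrier (fmod (r 0)). coset J (e u)) ` carrier (fmod (r 0))" for s
  proof -
    have "e (emb (r 0) (vscale s v1)) - s \<in> J"
      using ideal_rta_mult[OF J v1, of s] by (simp add: ee lin_scale[OF elin] algebra_simps)
    then have "coset J s = coset J (e (emb (r 0) (vscale s v1)))"
      using coset_eq_iff[OF J] by metis
    then show ?thesis by (intro image_eqI[of _ _ "emb (r 0) (vscale s v1)"]) auto
  qed
  then have surj: "(\<lambda>u\<in>carrier (fmod (r 0)). coset J (e u)) ` carrier (fmod (r 0)) = carrier (qmod J)"
    using aug by (auto simp: qmod_ops[OF J] linear_maps_def)
  have "v \<in> (\<lambda>u\<in>carrier (fmod (r (Suc i))). emb (r i) (D i u)) ` carrier (fmod (r (Suc i))) \<longleftrightarrow>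
      (\<exists>w. v = emb (r i) (D i w))" for i v
    by (auto simp: fmod_carrier De image_iff)
  then have mem: "emb (r i) v \<in> (\<lambda>u\<in>carrier (fmod (r (Suc i))). emb (r i) (D i u)) ` carrier (fmod (r (Suc i))) \<longleftrightarrow>
      (\<exists>w. trunc (r i) v = D i w)" for i v
    using img by simp
  have sub: "(\<lambda>u\<in>carrier (fmod (r (Suc i))). emb (r i) (D i u)) ` carrier (fmod (r (Suc i))) \<subseteq> range (emb (r i))" for i
    by (auto simp: image_iff)
  have ex0: "(\<lambda>u\<in>carrier (fmod (r (Suc 0))). emb (r 0) (D 0 u)) ` carrier (fmod (r (Suc 0))) =
       {v \<in> carrier (fmod (r 0)). (\<lambda>u\<in>carrier (fmod (r 0)). coset J (e u)) v = \<zero>\<^bsub>qmod J\<^esub>}" (is "?L = ?R")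
  proof -
    have "emb (r 0) v \<in> ?L \<longleftrightarrow> emb (r 0) v \<in> ?R" for v
      unfolding mem by (simp add: qmod_ops[OF J] ee coset_eq_iff[OF J] res_exact_aug[OF res])
    moreover have "?R \<subseteq> range (emb (r 0))" by (auto simp: fmod_carrier)
    ultimately show ?thesis using sub[of 0] by (intro range_set_eqI[of _ "emb (r 0)"])
  qed
  have ex: "(\<lambda>u\<in>carrier (fmod (r (Suc (Suc i)))). emb (r (Suc i)) (D (Suc i) u)) ` carrier (fmod (r (Suc (Suc i)))) =
       {v \<in> carrier (fmod (r (Suc i))). (\<lambda>u\<in>carrier (fmod (r (Suc i))). emb (r i) (D i u)) v = \<zero>\<^bsub>fmod (r i)\<^esub>}"
    (is "?L = ?R") for i
  proof -
    have "emb (r (Suc i)) v \<in> ?L \<longleftrightarrow> emb (r (Suc i)) v \<in> ?R" for v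
      unfolding mem by (simp add: fmod_ops De emb_eq_iff res_trunc_diff[OF res] res_exact[OF res])
    moreover have "?R \<subseteq> range (emb (r (Suc i)))" by (auto simp: fmod_carrier)
    ultimately show ?thesis using sub[of "Suc i"] by (intro range_set_eqI[of _ "emb (r (Suc i))"])
  qed
  show ?thesis
    unfolding free_resolution_def Let_def
    using aug diff surj ex0 ex by simp
qed

section \<open>Cohomology classes\<close>

abbreviation (input) on_fmod :: "nat \<Rightarrow> ((nat \<Rightarrow> 'a::comm_ring_1) \<Rightarrow> 'b) \<Rightarrow> (nat \<Rightarrow> 'a) \<Rightarrow> 'b" where
  "on_fmod n z \<equiv> restrict z (carrier (fmod n :: ('a, _) module))"

text \<open>
  The coset of the cocycle \<open>z\<close> modulo coboundaries, restricted to the carrier on which the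
  elements of \<open>hom_cohomology\<close> live.
\<close>

definition coh_class :: "(nat \<Rightarrow> nat) \<Rightarrow> (nat \<Rightarrow> (nat \<Rightarrow> 'a::comm_ring_1) \<Rightarrow> nat \<Rightarrow> 'a) \<Rightarrow> nat \<Rightarrow>
    ((nat \<Rightarrow> 'a) \<Rightarrow> 'a) \<Rightarrow> ((nat \<Rightarrow> 'a) \<Rightarrow> 'a) set" where
  "coh_class r D k z = (\<lambda>u. on_fmod (r (Suc k)) (\<lambda>v. u (D k v) + z v)) ` Collect slin"

context
  fixes J :: "'a::comm_ring_1 set" and r :: "nat \<Rightarrow> nat" and d and \<epsilon> and D and k :: nat
  assumes J: "ideal J ring_of_type_algebra"
    and res: "free_resolution ring_of_type_algebra (qmod J) r d \<epsilon>"
    and D_def: "D = total_diff r d"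
begin

lemma diff_emb: "d i (emb (r (Suc i)) v) = emb (r i) (D i v)"
  unfolding D_def by (rule free_resolution_total(2)[OF J res])

lemma obtain_resolves: obtains e where "resolves J r D e"
  using free_resolution_total(1)[OF J res] by (auto simp: D_def)

lemma trunc_total_diff: "trunc (r i) (D i v) = D i v"
  by (simp add: D_def total_diff_def)

lemma cocycle_emb:
  assumes "cocycle r D i z"
  shows "z (emb (r i) v) = z v"
  using assms by (metis cocycle_def trunc_emb)

lemma cocycle_set:
  "{f \<in> linear_maps ring_of_type_algebra (fmod (r (Suc k))) reg.
     compose (carrier (fmod (r (Suc (Suc k))))) f (d (Suc k)) = (\<lambda>x\<in>carrier (fmod (r (Suc (Suc k)))). 0)} =
   on_fmod (r (Suc k)) ` Collect (cocycle r D (Suc k))" (is "?Z = _")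
proof (intro equalityI subsetI)
  fix f assume f: "f \<in> ?Z"
  define z where "z = (\<lambda>v. f (emb (r (Suc k)) v))"
  have "f = on_fmod (r (Suc k)) z"
    using f by (auto simp: linear_map_reg_iff z_def emb_id fun_eq_iff extensional_def restrict_def)
  moreover have "z (D (Suc k) v) = 0" for v
  proof -
    have "compose (carrier (fmod (r (Suc (Suc k))))) f (d (Suc k)) (emb (r (Suc (Suc k))) v) = 0"
      using f by simp
    then show ?thesis by (simp add: compose_def diff_emb z_def)
  qed
  then have "cocycle r D (Suc k) z"
    using f by (simp add: cocycle_def z_def linear_map_reg_iff)
  ultimately show "f \<in> on_fmod (r (Suc k)) ` Collect (cocycle r D (Suc k))" by blast
next
  fix f assume "f \<in> on_fmod (r (Suc k)) ` Collect (cocycle r D (Suc k))"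
  then obtain z where z: "cocycle r D (Suc k) z" and f: "f = on_fmod (r (Suc k)) z" by blast
  have fz: "f (emb (r (Suc k)) v) = z v" for v
    using f cocycle_emb[OF z] by simp
  have "f \<in> linear_maps ring_of_type_algebra (fmod (r (Suc k))) reg"
    unfolding linear_map_reg_iff fz using z by (simp add: cocycle_def f)
  moreover have "compose (carrier (fmod (r (Suc (Suc k))))) f (d (Suc k)) = (\<lambda>x\<in>carrier (fmod (r (Suc (Suc k)))). 0)"
  proof
    fix x
    show "compose (carrier (fmod (r (Suc (Suc k))))) f (d (Suc k)) x = (\<lambda>x\<in>carrier (fmod (r (Suc (Suc k)))). 0) x"
    proof (cases "x \<in> carrier (fmod (r (Suc (Suc k))))")
      case True
      then obtain w where w: "x = emb (r (Suc (Suc k))) w" by (auto simp: fmod_carrier)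
      show ?thesis unfolding w compose_def using z by (simp add: diff_emb fz) (simp add: cocycle_def)
    qed (simp add: compose_def)
  qed
  ultimately show "f \<in> ?Z" by simp
qed

lemma boundary_set:
  "(\<lambda>f. compose (carrier (fmod (r (Suc k)))) f (d k)) ` linear_maps ring_of_type_algebra (fmod (r k)) reg =
   ((\<lambda>u. on_fmod (r (Suc k)) (\<lambda>v. u (D k v))) ` Collect slin)" (is "?B = ?B'")
proof (intro equalityI subsetI)
  fix f assume "f \<in> ?B"
  then obtain g where g: "g \<in> linear_maps ring_of_type_algebra (fmod (r k)) reg"
    and f: "f = compose (carrier (fmod (r (Suc k)))) g (d k)" by blast
  have "f = on_fmod (r (Suc k)) (\<lambda>v. g (emb (r k) (D k v)))"
    unfolding f compose_def by (rule restrict_ext) (metis diff_emb emb_id)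
  moreover have "slin (\<lambda>v. g (emb (r k) v))" using g by (simp add: linear_map_reg_iff)
  ultimately show "f \<in> ?B'" by (intro image_eqI[of _ _ "\<lambda>v. g (emb (r k) v)"]) simp_all
next
  fix f assume "f \<in> ?B'"
  then obtain u where u: "slin u" and f: "f = on_fmod (r (Suc k)) (\<lambda>v. u (D k v))" by blast
  define g where "g = (\<lambda>w\<in>carrier (fmod (r k)). u (trunc (r k) w))"
  have "g \<in> linear_maps ring_of_type_algebra (fmod (r k)) reg"
    unfolding linear_map_reg_iff g_def using lin_comp[OF vlin_trunc u] by simp
  moreover have "f = compose (carrier (fmod (r (Suc k)))) g (d k)"
    unfolding f compose_def
  proof (rule restrict_ext)
    fix x :: "nat \<Rightarrow> 'a" assume "x \<in> carrier (fmod (r (Suc k)))"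
    then have "d k x = emb (r k) (D k x)" by (metis diff_emb emb_id)
    then show "u (D k x) = g (d k x)" by (simp add: g_def trunc_total_diff)
  qed
  ultimately show "f \<in> ?B" by blast
qed

lemma hom_cohomology_eq:
  "hom_cohomology ring_of_type_algebra r d reg (Suc k) = quot_module ring_of_type_algebra
     ((hom_module ring_of_type_algebra (fmod (r (Suc k))) reg)\<lparr>carrier := on_fmod (r (Suc k)) ` Collect (cocycle r D (Suc k))\<rparr>)
     ((\<lambda>u. on_fmod (r (Suc k)) (\<lambda>v. u (D k v))) ` Collect slin)"
  unfolding hom_cohomology_def Let_def
  by (simp add: hom_module_def cocycle_set boundary_set)

lemma class_coset:
  "((\<lambda>u. on_fmod (r (Suc k)) (\<lambda>v. u (D k v))) ` Collect slin) +>\<^bsub>(hom_module ring_of_type_algebra (fmod (r (Suc k))) reg)\<lparr>carrier := on_fmod (r (Suc k)) ` Collect (cocycle r D (Suc k))\<rparr>\<^esub> on_fmod (r (Suc k)) z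
     = coh_class r D k z"
proof -
  have eq: "(\<lambda>x\<in>carrier (fmod (r (Suc k))). on_fmod (r (Suc k)) (\<lambda>v. u (D k v)) x + on_fmod (r (Suc k)) z x) = on_fmod (r (Suc k)) (\<lambda>v. u (D k v) + z v)" for u
    by (rule restrict_ext) simp
  then show ?thesis
    unfolding coh_class_def a_r_coset_def' by (simp add: hom_module_def UNION_singleton_eq_range image_image eq del: restrict_apply)
qed

lemma slin_add: "slin u \<Longrightarrow> slin u' \<Longrightarrow> slin (\<lambda>v. u v + u' (v :: nat \<Rightarrow> 'a))"
  by (rule slinI) (auto simp: lin_add[of vscale "(*)"] lin_scale[of vscale "(*)"] algebra_simps)

lemma slin_scale: "slin u \<Longrightarrow> slin (\<lambda>v. c * u (v :: nat \<Rightarrow> 'a))"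
  by (rule slinI) (auto simp: lin_add[of vscale "(*)"] lin_scale[of vscale "(*)"] algebra_simps)

lemma slin_zero: "slin (\<lambda>v :: nat \<Rightarrow> 'a. 0)"
  by (rule slinI) auto

lemma rs_eq_iff:
  assumes "cocycle r D (Suc k) z" "cocycle r D (Suc k) z'"
  shows "on_fmod (r (Suc k)) z = on_fmod (r (Suc k)) z' \<longleftrightarrow> z = z'"
proof
  assume "on_fmod (r (Suc k)) z = on_fmod (r (Suc k)) z'"
  then have "on_fmod (r (Suc k)) z (emb (r (Suc k)) v) = on_fmod (r (Suc k)) z' (emb (r (Suc k)) v)" for v by simp
  then show "z = z'" using assms by (auto simp: cocycle_emb)
qed auto

lemma class_eq_iff:
  assumes z: "cocycle r D (Suc k) z" and z': "cocycle r D (Suc k) z'"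
  shows "coh_class r D k z = coh_class r D k z' \<longleftrightarrow> (\<exists>u. slin u \<and> z = (\<lambda>v. u (D k v) + z' v))"
proof
  obtain e where e: "resolves J r D e" by (rule obtain_resolves)
  assume "coh_class r D k z = coh_class r D k z'"
  moreover have "on_fmod (r (Suc k)) z \<in> coh_class r D k z"
    unfolding coh_class_def by (rule image_eqI[of _ _ "\<lambda>_. 0"]) (simp_all add: slin_zero)
  ultimately have "on_fmod (r (Suc k)) z \<in> coh_class r D k z'" by simp
  then obtain u where u: "slin u" "on_fmod (r (Suc k)) z = on_fmod (r (Suc k)) (\<lambda>v. u (D k v) + z' v)"
    unfolding coh_class_def by blast
  then show "\<exists>u. slin u \<and> z = (\<lambda>v. u (D k v) + z' v)"
    using rs_eq_iff[OF z cocycle_add[OF cocycle_boundary[OF e u(1)] z']] by blast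
next
  assume "\<exists>u. slin u \<and> z = (\<lambda>v. u (D k v) + z' v)"
  then obtain u where u: "slin u" "z = (\<lambda>v. u (D k v) + z' v)" by blast
  show "coh_class r D k z = coh_class r D k z'"
  proof (intro equalityI subsetI)
    fix f assume "f \<in> coh_class r D k z"
    then obtain w where w: "slin w" "f = on_fmod (r (Suc k)) (\<lambda>v. w (D k v) + z v)" unfolding coh_class_def by blast
    then have "f = on_fmod (r (Suc k)) (\<lambda>v. (\<lambda>x. w x + u x) (D k v) + z' v)"
      by (simp add: u(2) add.assoc)
    then show "f \<in> coh_class r D k z'" using slin_add[OF w(1) u(1)] unfolding coh_class_def by (intro image_eqI) auto
  next
    fix f assume "f \<in> coh_class r D k z'"
    then obtain w where w: "slin w" "f = on_fmod (r (Suc k)) (\<lambda>v. w (D k v) + z' v)" unfolding coh_class_def by blast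
    then have "f = on_fmod (r (Suc k)) (\<lambda>v. (\<lambda>x. w x + (-1) * u x) (D k v) + z v)"
      by (simp add: u(2))
    then show "f \<in> coh_class r D k z" using slin_add[OF w(1) slin_scale[OF u(1), of "-1"]] unfolding coh_class_def by (intro image_eqI) auto
  qed
qed

lemma cohomology_carrier: "carrier (hom_cohomology ring_of_type_algebra r d reg (Suc k)) = coh_class r D k ` Collect (cocycle r D (Suc k))"
  unfolding hom_cohomology_eq by (auto simp: quot_module_def A_RCOSETS_def' class_coset)

lemma cohomology_add: "coh_class r D k z \<oplus>\<^bsub>hom_cohomology ring_of_type_algebra r d reg (Suc k)\<^esub> coh_class r D k z' = coh_class r D k (\<lambda>v. z v + z' v)"
proof -
  have eq: "(\<lambda>x\<in>carrier (fmod (r (Suc k))). on_fmod (r (Suc k)) (\<lambda>v. u (D k v) + z v) x + on_fmod (r (Suc k)) (\<lambda>v. u' (D k v) + z' v) x) =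
     on_fmod (r (Suc k)) (\<lambda>v. (\<lambda>x. u x + u' x) (D k v) + (z v + z' v))" for u u'
    by (rule restrict_ext) simp
  have "coh_class r D k z \<oplus>\<^bsub>hom_cohomology ring_of_type_algebra r d reg (Suc k)\<^esub> coh_class r D k z' =
     (\<lambda>(u, u'). on_fmod (r (Suc k)) (\<lambda>v. (\<lambda>x. u x + u' x) (D k v) + (z v + z' v))) ` (Collect slin \<times> Collect slin)"
    unfolding hom_cohomology_eq coh_class_def
    by (simp add: quot_module_def set_add_def' hom_module_def eq UNION_singleton_eq_range image_image del: restrict_apply)
      auto
  also have "\<dots> = coh_class r D k (\<lambda>v. z v + z' v)"
  proof (intro equalityI subsetI)
    fix f assume "f \<in> coh_class r D k (\<lambda>v. z v + z' v)"
    then obtain u where u: "slin u" "f = on_fmod (r (Suc k)) (\<lambda>v. u (D k v) + (z v + z' v))"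
      unfolding coh_class_def by blast
    then show "f \<in> (\<lambda>(u, u'). on_fmod (r (Suc k)) (\<lambda>v. (\<lambda>x. u x + u' x) (D k v) + (z v + z' v))) ` (Collect slin \<times> Collect slin)"
      using slin_zero by (intro image_eqI[of _ _ "(u, \<lambda>_. 0)"]) auto
  next
    fix f assume "f \<in> (\<lambda>(u, u'). on_fmod (r (Suc k)) (\<lambda>v. (\<lambda>x. u x + u' x) (D k v) + (z v + z' v))) ` (Collect slin \<times> Collect slin)"
    then obtain u u' where "slin u" "slin u'"
      "f = on_fmod (r (Suc k)) (\<lambda>v. (\<lambda>x. u x + u' x) (D k v) + (z v + z' v))" by auto
    then show "f \<in> coh_class r D k (\<lambda>v. z v + z' v)"
      unfolding coh_class_def by (intro image_eqI[of _ _ "\<lambda>x. u x + u' x"]) (auto intro: slin_add)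
  qed
  finally show ?thesis .
qed

lemma cohomology_smult:
  assumes z: "cocycle r D (Suc k) z"
  shows "c \<odot>\<^bsub>hom_cohomology ring_of_type_algebra r d reg (Suc k)\<^esub> coh_class r D k z = coh_class r D k (\<lambda>v. c * z v)"
proof -
  obtain e where e: "resolves J r D e" by (rule obtain_resolves)
  have eq: "(\<lambda>x\<in>carrier (fmod (r (Suc k))). c * on_fmod (r (Suc k)) (\<lambda>v. u (D k v) + z v) x) =
     on_fmod (r (Suc k)) (\<lambda>v. c * (u (D k v) + z v))" for u
    by (rule restrict_ext) simp
  have cong: "coh_class r D k (\<lambda>v. c * (u (D k v) + z v)) = coh_class r D k (\<lambda>v. c * z v)" if u: "slin u" for u
    using class_eq_iff[OF cocycle_scale[OF cocycle_add[OF cocycle_boundary[OF e u] z], of c] cocycle_scale[OF z, of c]]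
      slin_scale[OF u, of c] by (simp add: distrib_left) blast
  have "(\<Union>f\<in>coh_class r D k z. ((\<lambda>u. on_fmod (r (Suc k)) (\<lambda>v. u (D k v))) ` Collect slin)
       +>\<^bsub>(hom_module ring_of_type_algebra (fmod (r (Suc k))) reg)\<lparr>carrier := on_fmod (r (Suc k)) ` Collect (cocycle r D (Suc k))\<rparr>\<^esub>
       (\<lambda>x\<in>carrier (fmod (r (Suc k))). c * f x)) =
     (\<Union>u\<in>Collect slin. coh_class r D k (\<lambda>v. c * (u (D k v) + z v)))"
    by (subst (1) coh_class_def) (simp only: image_image eq, simp only: class_coset)
  also have "\<dots> = coh_class r D k (\<lambda>v. c * z v)"
    using cong slin_zero by blast
  finally show ?thesis
    unfolding hom_cohomology_eq by (simp add: quot_module_def hom_module_def)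
qed

end

section \<open>The trace of an Ext module\<close>

text \<open>
  The resolution chosen inside \<open>Ext\<close> exists as soon as some resolution does.
\<close>

lemma Ext_eq_hom_cohomology:
  fixes J :: "'a::comm_ring_1 set"
  assumes J: "ideal J ring_of_type_algebra" and res: "resolves J r' D' e'"
  obtains r d \<epsilon> where "free_resolution ring_of_type_algebra (qmod J) r d \<epsilon>"
    "\<And>i. Ext ring_of_type_algebra (qmod J) (reg :: ('a, 'a) module) i = hom_cohomology ring_of_type_algebra r d reg i"
proof -
  define P where "P = (\<lambda>(r, d). \<exists>\<epsilon>. free_resolution ring_of_type_algebra (qmod J) r d \<epsilon>)"
  have "\<exists>p. P p"
    using resolves_free_resolution[OF J res] unfolding P_def by blast
  then have "P (SOME p. P p)" by (rule someI_ex)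
  moreover obtain r d where rd: "(SOME p. P p) = (r, d)" by fastforce
  ultimately obtain \<epsilon> where "free_resolution ring_of_type_algebra (qmod J) r d \<epsilon>"
    by (auto simp: P_def)
  moreover have "Ext ring_of_type_algebra (qmod J) reg i = hom_cohomology ring_of_type_algebra r d reg i" for i
    using rd by (simp add: Ext_def P_def)
  ultimately show ?thesis by (rule that)
qed

context
  fixes J :: "'a::comm_ring_1 set" and r d \<epsilon> D k M
  assumes J: "ideal J ring_of_type_algebra"
    and res: "free_resolution ring_of_type_algebra (qmod J) r d \<epsilon>"
    and D_def: "D = total_diff r d"
    and M_def: "M = descend_module (hom_cohomology ring_of_type_algebra r d reg (Suc k))"
begin

lemma descend_carrier: "carrier M = coh_class r D k ` Collect (cocycle r D (Suc k))"
  using cohomology_carrier[OF J res D_def] by (simp add: M_def descend_module_def)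

lemma descend_add: "coh_class r D k z \<oplus>\<^bsub>M\<^esub> coh_class r D k z' = coh_class r D k (\<lambda>v. z v + z' v)"
  using cohomology_add[OF J res D_def] by (simp add: M_def descend_module_def)

text \<open>
  The action of a residue class on \<open>descend_module\<close> uses an arbitrary representative. All
  representatives act in the same way because \<open>J\<close> annihilates the cohomology.
\<close>

lemma descend_smult:
  assumes z: "cocycle r D (Suc k) z"
  shows "coset J s \<odot>\<^bsub>M\<^esub> coh_class r D k z = coh_class r D k (\<lambda>v. s * z v)"
proof -
  obtain e where e: "resolves J r D e" by (rule obtain_resolves[OF J res D_def])
  define t where "t = (SOME t. t \<in> coset J s)"
  have "s \<in> coset J s" by (simp add: mem_coset_iff[OF J] ideal_rta_zero[OF J])
  then have "t \<in> coset J s" unfolding t_def by (rule someI)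
  then have ts: "t - s \<in> J" by (simp add: mem_coset_iff[OF J])
  obtain u where u: "slin u" "\<And>v. (t - s) * z v = u (D k v)"
    using cocycle_annihilated[OF J e z ts] by blast
  have "t * z v = u (D k v) + s * z v" for v
    using u(2)[of v] by (simp add: algebra_simps)
  then have "coh_class r D k (\<lambda>v. t * z v) = coh_class r D k (\<lambda>v. s * z v)"
    using class_eq_iff[OF J res D_def cocycle_scale[OF z, of t] cocycle_scale[OF z, of s]] u(1) by blast
  then show ?thesis
    using cohomology_smult[OF J res D_def z, of t] by (simp add: M_def descend_module_def t_def)
qed

lemma linear_map_functional:
  assumes f: "f \<in> linear_maps (quot J) M (regular_module (quot J))" and C: "C \<in> carrier M"
  obtains \<psi> z where "functional_mod J r D k \<psi>" "cocycle r D (Suc k) z" "f C = coset J (\<psi> z)"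
proof -
  obtain e where e: "resolves J r D e" by (rule obtain_resolves[OF J res D_def])
  define \<psi> where "\<psi> = (\<lambda>z. SOME s. f (coh_class r D k z) = coset J s)"
  have \<psi>: "f (coh_class r D k z) = coset J (\<psi> z)" if "cocycle r D (Suc k) z" for z
  proof -
    have "f (coh_class r D k z) \<in> range (coset J)"
      using f that by (auto simp: linear_maps_def descend_carrier regular_module_def simp flip: quot_carrier[OF J])
    then have "\<exists>s. f (coh_class r D k z) = coset J s" by blast
    then show ?thesis unfolding \<psi>_def by (rule someI_ex)
  qed
  have add: "\<psi> (\<lambda>v. z v + z' v) - (\<psi> z + \<psi> z') \<in> J"
    if z: "cocycle r D (Suc k) z" "cocycle r D (Suc k) z'" for z z'
  proof -
    have "f (coh_class r D k z \<oplus>\<^bsub>M\<^esub> coh_class r D k z') =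
        f (coh_class r D k z) \<oplus>\<^bsub>quot J\<^esub> f (coh_class r D k z')"
      using f z by (simp add: linear_maps_def descend_carrier regular_module_def)
    then show ?thesis
      by (simp add: descend_add \<psi> z cocycle_add quot_add[OF J] coset_eq_iff[OF J])
  qed
  have scale: "\<psi> (\<lambda>v. c * z v) - c * \<psi> z \<in> J" if z: "cocycle r D (Suc k) z" for c z
  proof -
    have "f (coset J c \<odot>\<^bsub>M\<^esub> coh_class r D k z) = coset J c \<otimes>\<^bsub>quot J\<^esub> f (coh_class r D k z)"
      using f z by (simp add: linear_maps_def descend_carrier regular_module_def quot_carrier[OF J])
    then show ?thesis
      by (simp add: descend_smult \<psi> z cocycle_scale quot_mult[OF J] coset_eq_iff[OF J])
  qed
  have "\<psi> (\<lambda>v. u (D k v)) \<in> J" if u: "slin u" for u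
  proof -
    have c: "cocycle r D (Suc k) (\<lambda>v. u (D k v))" by (rule cocycle_boundary[OF e u])
    have c0: "cocycle r D (Suc k) (\<lambda>v. 0 * u (D k v))" by (rule cocycle_scale[OF c])
    have "coh_class r D k (\<lambda>v. u (D k v)) = coh_class r D k (\<lambda>v. 0 * u (D k v))"
      using class_eq_iff[OF J res D_def c c0] u by auto
    then have "\<psi> (\<lambda>v. u (D k v)) - \<psi> (\<lambda>v. 0 * u (D k v)) \<in> J"
      using \<psi>[OF c] \<psi>[OF c0] coset_eq_iff[OF J] by metis
    from ideal_rta_add[OF J this scale[OF c, of 0]] show ?thesis by simp
  qed
  with add scale have "functional_mod J r D k \<psi>" by (simp add: functional_mod_def)
  moreover obtain z where "cocycle r D (Suc k) z" "C = coh_class r D k z" using C by (auto simp: descend_carrier)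
  ultimately show ?thesis using that \<psi> by blast
qed

lemma functional_linear_map:
  assumes \<psi>: "functional_mod J r D k \<psi>" and z: "cocycle r D (Suc k) z"
  obtains f C where "f \<in> linear_maps (quot J) M (regular_module (quot J))" "C \<in> carrier M"
    "f C = coset J (\<psi> z)"
proof -
  obtain e where e: "resolves J r D e" by (rule obtain_resolves[OF J res D_def])
  define f where "f = (\<lambda>C\<in>carrier M. coset J (\<psi> (SOME z. cocycle r D (Suc k) z \<and> coh_class r D k z = C)))"
  have f: "f (coh_class r D k z) = coset J (\<psi> z)" if z: "cocycle r D (Suc k) z" for z
  proof -
    define y where "y = (SOME y. cocycle r D (Suc k) y \<and> coh_class r D k y = coh_class r D k z)"
    have y: "cocycle r D (Suc k) y" "coh_class r D k y = coh_class r D k z"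
      unfolding y_def using someI[of "\<lambda>y. cocycle r D (Suc k) y \<and> coh_class r D k y = coh_class r D k z" z] z by auto
    then obtain u where u: "slin u" "y = (\<lambda>v. u (D k v) + z v)"
      using class_eq_iff[OF J res D_def y(1) z] by blast
    have "\<psi> y - (\<psi> (\<lambda>v. u (D k v)) + \<psi> z) \<in> J" "\<psi> (\<lambda>v. u (D k v)) \<in> J"
      using \<psi> u cocycle_boundary[OF e u(1)] z unfolding functional_mod_def by blast+
    from ideal_rta_add[OF J this] have "coset J (\<psi> y) = coset J (\<psi> z)"
      by (simp add: coset_eq_iff[OF J])
    then show ?thesis using z by (simp add: f_def descend_carrier flip: y_def)
  qed
  have "f \<in> linear_maps (quot J) M (regular_module (quot J))"
    unfolding linear_maps_def
  proof (intro CollectI conjI ballI)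
    show "f \<in> carrier M \<rightarrow>\<^sub>E carrier (regular_module (quot J))"
      by (auto simp: f_def regular_module_def quot_carrier[OF J])
    fix C C' assume "C \<in> carrier M" "C' \<in> carrier M"
    then obtain z z' where z: "cocycle r D (Suc k) z" "C = coh_class r D k z"
      "cocycle r D (Suc k) z'" "C' = coh_class r D k z'" by (auto simp: descend_carrier)
    have "\<psi> (\<lambda>v. z v + z' v) - (\<psi> z + \<psi> z') \<in> J"
      using \<psi> z by (simp add: functional_mod_def)
    then show "f (C \<oplus>\<^bsub>M\<^esub> C') = f C \<oplus>\<^bsub>regular_module (quot J)\<^esub> f C'"
      by (simp add: z descend_add f cocycle_add regular_module_def quot_add[OF J] coset_eq_iff[OF J])
  next
    fix A C assume "A \<in> carrier (quot J)" "C \<in> carrier M"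
    then obtain c z where z: "A = coset J c" "cocycle r D (Suc k) z" "C = coh_class r D k z"
      by (auto simp: descend_carrier quot_carrier[OF J])
    have "\<psi> (\<lambda>v. c * z v) - c * \<psi> z \<in> J"
      using \<psi> z by (simp add: functional_mod_def)
    then show "f (A \<odot>\<^bsub>M\<^esub> C) = A \<odot>\<^bsub>regular_module (quot J)\<^esub> f C"
      by (simp add: z descend_smult f cocycle_scale regular_module_def quot_mult[OF J] coset_eq_iff[OF J])
  qed
  moreover have "coh_class r D k z \<in> carrier M" using z by (simp add: descend_carrier)
  ultimately show ?thesis using that f[OF z] by blast
qed

end

text \<open>
  This theorem and \<open>trace_Ext_subset\<close> compute the trace of \<open>Ext(R/J, R)\<close> from any resolution of
  \<open>R/J\<close>, not just from the one that is chosen in the definition of \<open>Ext\<close>.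
\<close>

theorem trace_Ext_memI:
  fixes J :: "'a::comm_ring_1 set"
  assumes J: "ideal J ring_of_type_algebra" and G: "resolves J r' D' e'"
    and \<psi>: "functional_mod J r' D' k \<psi>" and z: "cocycle r' D' (Suc k) z"
  shows "coset J (\<psi> z) \<in> trace_ideal (quot J) (descend_module (Ext ring_of_type_algebra (qmod J) reg (Suc k)))"
proof -
  obtain r d \<epsilon> where res: "free_resolution ring_of_type_algebra (qmod J) r d \<epsilon>"
    and Ext: "\<And>i. Ext ring_of_type_algebra (qmod J) (reg :: ('a, 'a) module) i = hom_cohomology ring_of_type_algebra r d reg i"
    using Ext_eq_hom_cohomology[OF J G] by metis
  obtain e where e: "resolves J r (total_diff r d) e" by (rule obtain_resolves[OF J res refl])
  obtain \<psi>1 z1 where 1: "functional_mod J r (total_diff r d) k \<psi>1" "cocycle r (total_diff r d) (Suc k) z1"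
     "\<psi>1 z1 - \<psi> z \<in> J"
    using functional_mod_transfer[OF J e G \<psi> z] by metis
  obtain f C where "f \<in> linear_maps (quot J) (descend_module (hom_cohomology ring_of_type_algebra r d reg (Suc k))) (regular_module (quot J))"
    "C \<in> carrier (descend_module (hom_cohomology ring_of_type_algebra r d reg (Suc k)))"
    "f C = coset J (\<psi>1 z1)"
    using functional_linear_map[OF J res refl refl 1(1,2)] by metis
  moreover have "coset J (\<psi>1 z1) = coset J (\<psi> z)" using 1(3) by (simp add: coset_eq_iff[OF J])
  ultimately have "coset J (\<psi> z) \<in> (\<Union>f\<in>linear_maps (quot J) (descend_module (Ext ring_of_type_algebra (qmod J) reg (Suc k)))
      (regular_module (quot J)). f ` carrier (descend_module (Ext ring_of_type_algebra (qmod J) reg (Suc k))))"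
    unfolding Ext by (metis UN_I imageI)
  moreover have "(\<Union>f\<in>linear_maps (quot J) (descend_module (Ext ring_of_type_algebra (qmod J) reg (Suc k)))
      (regular_module (quot J)). f ` carrier (descend_module (Ext ring_of_type_algebra (qmod J) reg (Suc k))))
      \<subseteq> trace_ideal (quot J) (descend_module (Ext ring_of_type_algebra (qmod J) reg (Suc k)))"
    unfolding trace_ideal_def
    by (rule ring.genideal_self[OF cring.axioms(1)[OF cring_quot[OF J]]])
      (auto simp: linear_maps_def regular_module_def)
  ultimately show ?thesis by blast
qed

theorem trace_Ext_subset:
  fixes J :: "'a::comm_ring_1 set"
  assumes J: "ideal J ring_of_type_algebra" and G: "resolves J r' D' e'"
    and K: "ideal K ring_of_type_algebra" "J \<subseteq> K"
    and sub: "{\<psi> z |\<psi> z. functional_mod J r' D' k \<psi> \<and> cocycle r' D' (Suc k) z} \<subseteq> K"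
  shows "trace_ideal (quot J) (descend_module (Ext ring_of_type_algebra (qmod J) reg (Suc k))) \<subseteq> coset J ` K"
proof -
  obtain r d \<epsilon> where res: "free_resolution ring_of_type_algebra (qmod J) r d \<epsilon>"
    and Ext: "\<And>i. Ext ring_of_type_algebra (qmod J) (reg :: ('a, 'a) module) i = hom_cohomology ring_of_type_algebra r d reg i"
    using Ext_eq_hom_cohomology[OF J G] by metis
  obtain e where e: "resolves J r (total_diff r d) e" by (rule obtain_resolves[OF J res refl])
  have "f C \<in> coset J ` K"
    if f: "f \<in> linear_maps (quot J) (descend_module (hom_cohomology ring_of_type_algebra r d reg (Suc k))) (regular_module (quot J))"
      and C: "C \<in> carrier (descend_module (hom_cohomology ring_of_type_algebra r d reg (Suc k)))" for f C
  proof -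
    obtain \<psi> z where 1: "functional_mod J r (total_diff r d) k \<psi>" "cocycle r (total_diff r d) (Suc k) z"
      "f C = coset J (\<psi> z)"
      using linear_map_functional[OF J res refl refl f C] by metis
    obtain \<psi>1 z1 where 2: "functional_mod J r' D' k \<psi>1" "cocycle r' D' (Suc k) z1" "\<psi>1 z1 - \<psi> z \<in> J"
      using functional_mod_transfer[OF J G e 1(1,2)] by metis
    have "coset J (\<psi>1 z1) = f C" using 2(3) 1(3) by (simp add: coset_eq_iff[OF J])
    then show ?thesis using sub 2(1,2) by blast
  qed
  moreover have "ideal (coset J ` K) (quot J)"
    using ideal_quot_iff[OF J] K by blast
  ultimately show ?thesis
    unfolding trace_ideal_def Ext
    by (intro ring.genideal_minimal[OF cring.axioms(1)[OF cring_quot[OF J]]]) auto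
qed

definition coord_functional :: "nat \<Rightarrow> (nat \<Rightarrow> 'a) \<Rightarrow> 'a" where
  "coord_functional i v = v i"

lemma slin_expand:
  assumes "slin z" "\<And>v. z (trunc n v) = z v"
  shows "z v = (\<Sum>i<n. z (unit_vec i) * v i)"
proof -
  have "z v = z (\<Sum>j<n. vscale (v j) (unit_vec j))"
    using assms(2) by (simp flip: trunc_expand)
  also have "\<dots> = (\<Sum>i<n. z (unit_vec i) * v i)"
    by (simp add: Modules.module_hom.sum[OF assms(1)] lin_scale[OF assms(1)] mult.commute)
  finally show ?thesis .
qed

section \<open>The trace of the last Ext module\<close>

text \<open>
  If the next differential vanishes, every functional on the free module \<open>R^r\<close> dual to the last
  term is a cocycle. A map \<open>\<psi>\<close> to \<open>R/J\<close> is then given by the vector \<open>v\<close> of its values on the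
  coordinate functionals, and \<open>\<psi>\<close> vanishes on coboundaries precisely if \<open>D k v\<close> vanishes modulo
  \<open>J\<close>, because \<open>\<psi>\<close> applied to the coboundary of the \<open>j\<close>-th coordinate is \<open>D k v j\<close>.
\<close>

lemma functional_mod_top_value:
  fixes J :: "'a::comm_ring_1 set"
  assumes J: "ideal J ring_of_type_algebra" and res: "resolves J r D e"
    and top: "\<And>v. D (Suc k) v = 0"
    and \<psi>: "functional_mod J r D k \<psi>" and z: "cocycle r D (Suc k) z"
  obtains v where "\<And>j. j < r k \<Longrightarrow> D k v j \<in> J"
    "\<psi> z - (\<Sum>i<r (Suc k). z (unit_vec i) * v i) \<in> J"
proof -
  define co where "co = (\<lambda>i v. if i < r (Suc k) then v i else (0::'a))"
  define v where "v = (\<lambda>i. \<psi> (co i))"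
  have co: "cocycle r D (Suc k) (co i)" for i
    unfolding cocycle_def co_def top by (auto intro!: slinI simp: trunc_def)
  have expand: "\<psi> z - (\<Sum>i<r (Suc k). z (unit_vec i) * v i) \<in> J" if z: "cocycle r D (Suc k) z" for z
  proof -
    have "cocycle r D (Suc k) (\<lambda>w. \<Sum>i<m. z (unit_vec i) * co i w) \<and>
      \<psi> (\<lambda>w. \<Sum>i<m. z (unit_vec i) * co i w) - (\<Sum>i<m. z (unit_vec i) * v i) \<in> J" for m
    proof (induction m)
      case 0
      have "cocycle r D (Suc k) (\<lambda>w. 0 * z w)" by (rule cocycle_scale[OF z])
      moreover have "\<psi> (\<lambda>w. 0 * z w) - 0 * \<psi> z \<in> J"
        using \<psi> z unfolding functional_mod_def by blast
      ultimately show ?case by simp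
    next
      case (Suc m)
      let ?s = "\<lambda>w. \<Sum>i<m. z (unit_vec i) * co i w" and ?t = "\<lambda>w. z (unit_vec m) * co m w"
      have c: "cocycle r D (Suc k) ?t" by (rule cocycle_scale[OF co])
      have "\<psi> (\<lambda>w. ?s w + ?t w) - (\<psi> ?s + \<psi> ?t) \<in> J" "\<psi> ?t - z (unit_vec m) * v m \<in> J"
        using \<psi> Suc c co unfolding functional_mod_def v_def by blast+
      from ideal_rta_add[OF J ideal_rta_add[OF J this] conjunct2[OF Suc]] cocycle_add[OF conjunct1[OF Suc] c]
      show ?case by (simp add: algebra_simps)
    qed
    moreover have "(\<lambda>w. \<Sum>i<r (Suc k). z (unit_vec i) * co i w) = z"
    proof
      fix w show "(\<Sum>i<r (Suc k). z (unit_vec i) * co i w) = z w"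
        using slin_expand[of z "r (Suc k)" w] z by (simp add: cocycle_def co_def)
    qed
    ultimately show ?thesis by metis
  qed
  have "D k v j \<in> J" if "j < r k" for j
  proof -
    have lin: "slin (\<lambda>w. w j)" by (rule slinI) auto
    have 1: "\<psi> (\<lambda>w. D k w j) \<in> J" using \<psi> lin unfolding functional_mod_def by blast
    have 2: "\<psi> (\<lambda>w. D k w j) - (\<Sum>i<r (Suc k). D k (unit_vec i) j * v i) \<in> J"
      by (rule expand[OF cocycle_boundary[OF res lin]])
    from ideal_rta_diff[OF J 1 2] have "(\<Sum>i<r (Suc k). D k (unit_vec i) j * v i) \<in> J"
      by simp
    moreover have "D k v j = (\<Sum>i<r (Suc k). D k (unit_vec i) j * v i)"
      by (rule slin_expand[OF lin_comp[OF res_vlin[OF res] lin]]) (simp add: res_diff_trunc[OF res])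
    ultimately show ?thesis by simp
  qed
  then show ?thesis using that expand[OF z] by blast
qed

lemma functional_mod_topI:
  fixes J :: "'a::comm_ring_1 set"
  assumes J: "ideal J ring_of_type_algebra" and res: "resolves J r D e"
    and v: "\<And>j. j < r k \<Longrightarrow> D k v j \<in> J"
  shows "functional_mod J r D k (\<lambda>z. \<Sum>i<r (Suc k). z (unit_vec i) * v i)"
  unfolding functional_mod_def
proof (intro conjI allI impI)
  fix u :: "(nat \<Rightarrow> 'a) \<Rightarrow> 'a" assume u: "slin u"
  have "(\<Sum>i<r (Suc k). u (D k (unit_vec i)) * v i) = u (D k v)"
    by (rule slin_expand[symmetric, OF lin_comp[OF res_vlin[OF res] u]]) (simp add: res_diff_trunc[OF res])
  also have "\<dots> = (\<Sum>j<r k. u (trunc (r k) (unit_vec j)) * D k v j)"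
    using slin_expand[OF lin_comp[OF vlin_trunc u], of "r k" "r k" "D k v"] by (simp add: res_trunc_diff[OF res])
  also have "\<dots> \<in> J"
    by (rule ideal_rta_sum[OF J]) (auto intro: ideal_rta_mult[OF J] v)
  finally show "(\<Sum>i<r (Suc k). u (D k (unit_vec i)) * v i) \<in> J" .
qed (auto simp: ideal_rta_zero[OF J] algebra_simps sum.distrib sum_distrib_left)

theorem trace_top_Ext_memI:
  fixes J :: "'a::comm_ring_1 set"
  assumes J: "ideal J ring_of_type_algebra" and res: "resolves J r D e"
    and top: "\<And>v. D (Suc k) v = 0"
    and v: "\<And>j. j < r k \<Longrightarrow> D k v j \<in> J" and i: "i < r (Suc k)"
  shows "coset J (v i) \<in> trace_ideal (quot J) (descend_module (Ext ring_of_type_algebra (qmod J) reg (Suc k)))"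
proof -
  have "cocycle r D (Suc k) (\<lambda>v. v i)"
    unfolding cocycle_def using i by (auto intro!: slinI simp: top trunc_def)
  from trace_Ext_memI[OF J res functional_mod_topI[OF J res v] this]
  have "coset J (\<Sum>l<r (Suc k). unit_vec l i * v l) \<in> trace_ideal (quot J) (descend_module (Ext ring_of_type_algebra (qmod J) reg (Suc k)))"
    by simp
  also have "(\<Sum>l<r (Suc k). unit_vec l i * v l) = (\<Sum>l<r (Suc k). if l = i then v l else 0)"
    by (rule sum.cong) (auto simp: unit_vec_def)
  finally show ?thesis using i by simp
qed

theorem trace_top_Ext_subset:
  fixes J :: "'a::comm_ring_1 set"
  assumes J: "ideal J ring_of_type_algebra" and res: "resolves J r D e"
    and top: "\<And>v. D (Suc k) v = 0"
    and K: "ideal K ring_of_type_algebra" "J \<subseteq> K"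
    and sub: "\<And>v. \<forall>j<r k. D k v j \<in> J \<Longrightarrow> \<forall>i<r (Suc k). v i \<in> K"
  shows "trace_ideal (quot J) (descend_module (Ext ring_of_type_algebra (qmod J) reg (Suc k))) \<subseteq> coset J ` K"
proof (rule trace_Ext_subset[OF J res K], rule subsetI)
  fix t assume "t \<in> {\<psi> z |\<psi> z. functional_mod J r D k \<psi> \<and> cocycle r D (Suc k) z}"
  then obtain \<psi> z where "t = \<psi> z \<and> functional_mod J r D k \<psi> \<and> cocycle r D (Suc k) z"
    unfolding mem_Collect_eq by (elim exE)
  then have \<psi>: "functional_mod J r D k \<psi>" "cocycle r D (Suc k) z" and t: "t = \<psi> z"
    by simp_all
  obtain v where v: "\<And>j. j < r k \<Longrightarrow> D k v j \<in> J" "\<psi> z - (\<Sum>i<r (Suc k). z (unit_vec i) * v i) \<in> J"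
    using functional_mod_top_value[where D = D and r = r and k = k, OF J res top \<psi>] by metis
  have s: "(\<Sum>i<r (Suc k). z (unit_vec i) * v i) \<in> K"
    using sub[of v] v(1) by (intro ideal_rta_sum[OF K(1)] ideal_rta_mult[OF K(1)]) auto
  from v(2) K(2) have "\<psi> z - (\<Sum>i<r (Suc k). z (unit_vec i) * v i) \<in> K" by blast
  from ideal_rta_add[OF K(1) this s] show "t \<in> K" by (simp add: t)
qed

section \<open>Monomial ideals\<close>

definition mcoeff :: "'k::field poly poly \<Rightarrow> nat \<Rightarrow> nat \<Rightarrow> 'k" where
  "mcoeff f i j = coeff (coeff f j) i"

lemma mcoeff_simps [simp]:
  "mcoeff 0 i j = 0" "mcoeff (f + g) i j = mcoeff f i j + mcoeff g i j"
  "mcoeff (f - g) i j = mcoeff f i j - mcoeff g i j" "mcoeff (- f) i j = - mcoeff f i j"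
  by (simp_all add: mcoeff_def)

lemma mcoeff_sum: "mcoeff (sum f A) i j = (\<Sum>a\<in>A. mcoeff (f a) i j)"
  by (induction A rule: infinite_finite_induct) auto

lemma mcoeff_eqI: "(\<And>i j. mcoeff f i j = mcoeff g i j) \<Longrightarrow> f = g"
  by (simp add: mcoeff_def poly_eq_iff)

lemma xy_monom: "xy i j = monom (monom 1 i) j"
proof -
  have "([:[:0, 1:]:] :: 'a poly poly) ^ i = [:monom 1 i:]"
    by (simp add: monom_altdef poly_const_pow)
  then show ?thesis by (simp add: xy_def monom_altdef)
qed

lemma mcoeff_xy_mult:
  "mcoeff (xy a b * f) i j = (if a \<le> i \<and> b \<le> j then mcoeff f (i - a) (j - b) else 0)"
  by (auto simp: mcoeff_def xy_monom coeff_monom_mult)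

lemma mcoeff_xy: "mcoeff (xy a b) i j = (if i = a \<and> j = b then 1 else 0)"
  by (auto simp: mcoeff_def xy_monom)

lemma mcoeff_mult:
  "mcoeff (f * g) i j = (\<Sum>l\<le>j. \<Sum>k\<le>i. mcoeff f k l * mcoeff g (i - k) (j - l))"
  by (simp add: mcoeff_def coeff_mult coeff_sum)

lemma xy_mult: "xy a b * xy c d = xy (a + c) (b + d)"
  by (simp add: xy_def power_add mult_ac)

lemma xy_0_0: "xy 0 0 = 1"
  by (simp add: xy_def)

lemma xy_nonzero: "xy a b \<noteq> (0 :: 'k::field poly poly)"
  by (metis mcoeff_xy mcoeff_simps(1) zero_neq_one)

lemma mcoeff_expand:
  "f = (\<Sum>j\<le>degree f. \<Sum>i\<le>degree (coeff f j). [:[:mcoeff f i j:]:] * xy i j)"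
proof -
  have "f = (\<Sum>j\<le>degree f. monom (coeff f j) j)"
    by (rule poly_as_sum_of_monoms[symmetric])
  also have "\<dots> = (\<Sum>j\<le>degree f. \<Sum>i\<le>degree (coeff f j). [:[:mcoeff f i j:]:] * xy i j)"
  proof (rule sum.cong)
    fix j
    have "monom (coeff f j) j = monom (\<Sum>i\<le>degree (coeff f j). monom (coeff (coeff f j) i) i) j"
      by (simp add: poly_as_sum_of_monoms)
    also have "\<dots> = (\<Sum>i\<le>degree (coeff f j). monom (monom (coeff (coeff f j) i) i) j)"
      by (rule poly_eqI) (simp add: coeff_sum)
    also have "\<dots> = (\<Sum>i\<le>degree (coeff f j). [:[:mcoeff f i j:]:] * xy i j)"
      by (simp add: xy_monom mcoeff_def smult_monom)
    finally show "monom (coeff f j) j = (\<Sum>i\<le>degree (coeff f j). [:[:mcoeff f i j:]:] * xy i j)" .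
  qed simp
  finally show ?thesis .
qed

definition up_closed :: "(nat \<times> nat) set \<Rightarrow> bool" where
  "up_closed U \<longleftrightarrow> (\<forall>i j i' j'. (i, j) \<in> U \<longrightarrow> i \<le> i' \<longrightarrow> j \<le> j' \<longrightarrow> (i', j') \<in> U)"

text \<open>
  The ideal of all polynomials whose support lies in \<open>U\<close>; it is a monomial ideal if \<open>U\<close> is
  upward closed.
\<close>

definition mono_ideal :: "(nat \<times> nat) set \<Rightarrow> 'k::field poly poly set" where
  "mono_ideal U = {f. \<forall>i j. mcoeff f i j \<noteq> 0 \<longrightarrow> (i, j) \<in> U}"

lemma ideal_mono_ideal:
  assumes "up_closed U"
  shows "ideal (mono_ideal U) Kxy"
  unfolding ideal_rta_iff
proof (intro conjI ballI allI)
  fix h f :: "'k::field poly poly" assume f: "f \<in> mono_ideal U"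
  have "(i, j) \<in> U" if "mcoeff (h * f) i j \<noteq> 0" for i j
  proof -
    obtain l where l: "l \<le> j" "(\<Sum>k\<le>i. mcoeff h k l * mcoeff f (i - k) (j - l)) \<noteq> 0"
      using \<open>mcoeff (h * f) i j \<noteq> 0\<close> unfolding mcoeff_mult by (metis (no_types, lifting) sum.neutral atMost_iff)
    then obtain k where "k \<le> i" "mcoeff f (i - k) (j - l) \<noteq> 0"
      by (metis (no_types, lifting) sum.neutral atMost_iff mult_zero_right)
    then have "(i - k, j - l) \<in> U" using f by (simp add: mono_ideal_def)
    then show ?thesis using assms unfolding up_closed_def by (metis diff_le_self)
  qed
  then show "h * f \<in> mono_ideal U" by (simp add: mono_ideal_def)
next
  fix f g :: "'k::field poly poly" assume "f \<in> mono_ideal U" "g \<in> mono_ideal U"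
  then show "f + g \<in> mono_ideal U"
    unfolding mono_ideal_def by (simp, metis add.right_neutral)
qed (simp add: mono_ideal_def)

lemma xy_in_mono_ideal_iff: "xy i j \<in> mono_ideal U \<longleftrightarrow> (i, j) \<in> U"
  by (auto simp: mono_ideal_def mcoeff_xy)

text \<open>
  Every polynomial is a linear combination of the monomials in its support.
\<close>

lemma mono_ideal_subset_iff:
  fixes K :: "'k::field poly poly set"
  assumes K: "ideal K Kxy"
  shows "mono_ideal U \<subseteq> K \<longleftrightarrow> (\<forall>(i, j)\<in>U. xy i j \<in> K)"
proof
  assume "mono_ideal U \<subseteq> K"
  then show "\<forall>(i, j)\<in>U. xy i j \<in> K" using xy_in_mono_ideal_iff by blast
next
  assume U: "\<forall>(i, j)\<in>U. xy i j \<in> K"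
  show "mono_ideal U \<subseteq> K"
  proof
    fix f :: "'k poly poly" assume f: "f \<in> mono_ideal U"
    have "[:[:mcoeff f i j:]:] * xy i j \<in> K" for i j
    proof (cases "mcoeff f i j = 0")
      case False
      then have "(i, j) \<in> U" using f by (simp add: mono_ideal_def)
      then have "xy i j \<in> K" using U by auto
      then show ?thesis by (rule ideal_rta_mult[OF K])
    qed (simp add: ideal_rta_zero[OF K])
    then show "f \<in> K"
      by (subst mcoeff_expand) (intro ideal_rta_sum[OF K])
  qed
qed

definition up :: "(nat \<times> nat) set \<Rightarrow> (nat \<times> nat) set" where
  "up E = {(i, j). \<exists>(a, b)\<in>E. a \<le> i \<and> b \<le> j}"

lemma up_closed_up: "up_closed (up E)"
  unfolding up_closed_def up_def by (blast intro: le_trans)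

lemma Idl_monomials: "Idl\<^bsub>Kxy\<^esub> ((\<lambda>(i, j). xy i j) ` E) = mono_ideal (up E)"
proof
  show "Idl\<^bsub>Kxy\<^esub> ((\<lambda>(i, j). xy i j) ` E) \<subseteq> mono_ideal (up E)"
    by (rule genideal_rta_least[OF ideal_mono_ideal[OF up_closed_up]])
      (force simp: xy_in_mono_ideal_iff up_def)
  have "xy i j \<in> Idl\<^bsub>Kxy\<^esub> ((\<lambda>(i, j). xy i j) ` E)" if "(i, j) \<in> up E" for i j
  proof -
    obtain a b where ab: "(a, b) \<in> E" "a \<le> i" "b \<le> j" using \<open>(i, j) \<in> up E\<close> by (auto simp: up_def)
    then have "xy a b \<in> Idl\<^bsub>Kxy\<^esub> ((\<lambda>(i, j). xy i j) ` E)"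
      using genideal_rta_superset by force
    from ideal_rta_mult[OF genideal_rta this, of "xy (i - a) (j - b)"]
    show ?thesis using ab by (simp add: xy_mult)
  qed
  then show "mono_ideal (up E) \<subseteq> Idl\<^bsub>Kxy\<^esub> ((\<lambda>(i, j). xy i j) ` E)"
    unfolding mono_ideal_subset_iff[OF genideal_rta] by auto
qed

lemma xy_dvdI:
  assumes "\<And>i j. mcoeff f i j \<noteq> 0 \<Longrightarrow> a \<le> i \<and> b \<le> j"
  shows "xy a b dvd f"
proof -
  have "f \<in> mono_ideal (up {(a, b)})" using assms by (auto simp: mono_ideal_def up_def)
  then have "f \<in> Idl\<^bsub>Kxy\<^esub> {xy a b, xy a b}" by (simp flip: Idl_monomials)
  then show ?thesis unfolding mem_genideal_insert by auto
qed

section \<open>Staircases and the Hilbert-Burch resolution\<close>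

locale staircase =
  fixes n :: nat and a b :: "nat \<Rightarrow> nat"
  assumes a_less: "k < n \<Longrightarrow> a (Suc k) < a k"
    and b_less: "k < n \<Longrightarrow> b k < b (Suc k)"
begin

lemma a_mono: "j \<le> k \<Longrightarrow> k \<le> n \<Longrightarrow> a k + (k - j) \<le> a j"
proof (induction k rule: dec_induct)
  case (step k)
  then show ?case using a_less[of k] by simp
qed simp

lemma b_mono: "j \<le> k \<Longrightarrow> k \<le> n \<Longrightarrow> b j + (k - j) \<le> b k"
proof (induction k rule: dec_induct)
  case (step k)
  then show ?case using b_less[of k] by simp
qed simp

definition exps :: "(nat \<times> nat) set" where
  "exps = up ((\<lambda>k. (a k, b k)) ` {..n})"

lemma mem_exps: "(i, j) \<in> exps \<longleftrightarrow> (\<exists>k\<le>n. a k \<le> i \<and> b k \<le> j)"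
  by (auto simp: exps_def up_def)

lemma up_closed_exps: "up_closed exps"
  unfolding exps_def by (rule up_closed_up)

definition gen :: "nat \<Rightarrow> 'k::field poly poly" where
  "gen k = xy (a k) (b k)"

lemma mono_ideal_exps: "mono_ideal exps = Idl\<^bsub>Kxy\<^esub> (gen ` {..n})"
  unfolding exps_def Idl_monomials[symmetric] by (simp add: image_image gen_def)

abbreviation J :: "'k::field poly poly set" where
  "J \<equiv> mono_ideal exps"

lemma ideal_J: "ideal J Kxy"
  by (rule ideal_mono_ideal[OF up_closed_exps])

lemma mem_J_iff: "f \<in> J \<longleftrightarrow> (\<exists>w. f = (\<Sum>j\<le>n. w j * gen j))"
proof
  have "ideal {f. \<exists>w. f = (\<Sum>j\<le>n. w j * gen j)} (Kxy :: 'a poly poly ring)"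
    unfolding ideal_rta_iff
  proof (intro conjI ballI allI; clarsimp)
    show "\<exists>w. (\<Sum>j\<le>n. w j * gen j) = (0 :: 'a poly poly)"
      by (rule exI[of _ "\<lambda>_. 0"]) simp
    show "\<exists>w''. (\<Sum>j\<le>n. w j * gen j) + (\<Sum>j\<le>n. w' j * gen j) = (\<Sum>j\<le>n. w'' j * gen j :: 'a poly poly)" for w w'
      by (rule exI[of _ "\<lambda>j. w j + w' j"]) (simp add: algebra_simps sum.distrib)
    show "\<exists>w'. c * (\<Sum>j\<le>n. w j * gen j) = (\<Sum>j\<le>n. w' j * gen j :: 'a poly poly)" for c w
      by (rule exI[of _ "\<lambda>j. c * w j"]) (simp add: mult.assoc sum_distrib_left)
  qed
  moreover have "gen k = (\<Sum>j\<le>n. (if j = k then 1 else 0) * gen j :: 'a poly poly)" if "k \<le> n" for k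
    using that by (simp add: if_distrib[of "\<lambda>x. x * _"] cong: if_cong)
  then have "gen ` {..n} \<subseteq> {f. \<exists>w. f = (\<Sum>j\<le>n. w j * gen j :: 'a poly poly)}"
    by (intro image_subsetI CollectI exI[of _ "\<lambda>j. if j = _ then 1 else 0"]) auto
  ultimately have "Idl\<^bsub>Kxy\<^esub> (gen ` {..n}) \<subseteq> {f. \<exists>w. f = (\<Sum>j\<le>n. w j * gen j :: 'a poly poly)}"
    by (rule genideal_rta_least)
  then show "\<exists>w. f = (\<Sum>j\<le>n. w j * gen j)" if "f \<in> J"
    using subsetD[OF \<open>Idl\<^bsub>Kxy\<^esub> (gen ` {..n}) \<subseteq> _\<close>, of f] that unfolding mono_ideal_exps by simp
next
  have "gen k \<in> J" if "k \<le> n" for k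
    using that by (auto simp: gen_def xy_in_mono_ideal_iff mem_exps)
  then show "\<exists>w. f = (\<Sum>j\<le>n. w j * gen j) \<Longrightarrow> f \<in> J"
    by (auto intro!: ideal_rta_sum[OF ideal_J] ideal_rta_mult[OF ideal_J])
qed

definition rank :: "nat \<Rightarrow> nat" where
  "rank i = (if i = 0 then 1 else if i = 1 then Suc n else if i = 2 then n else 0)"

text \<open>
  The second differential of the Hilbert-Burch resolution: it sends the \<open>k\<close>-th basis vector to
  \<open>y^(b (k+1) - b k) e\<^sub>k - x^(a k - a (k+1)) e\<^sub>k\<^sub>+\<^sub>1\<close>.
\<close>

definition hb :: "(nat \<Rightarrow> 'k::field poly poly) \<Rightarrow> nat \<Rightarrow> 'k poly poly" where
  "hb u j = (if j < n then xy 0 (b (Suc j) - b j) * u j else 0)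
      - (if 0 < j \<and> j \<le> n then xy (a (j - 1) - a j) 0 * u (j - 1) else 0)"

definition diff :: "nat \<Rightarrow> (nat \<Rightarrow> 'k::field poly poly) \<Rightarrow> nat \<Rightarrow> 'k poly poly" where
  "diff i = (if i = 0 then (\<lambda>w j. if j = 0 then \<Sum>l\<le>n. w l * gen l else 0) else if i = 1 then hb else (\<lambda>_ _. 0))"

lemma hb_gen:
  assumes "j \<le> n"
  shows "hb u j * gen j = (if j < n then xy (a j) (b (Suc j)) * u j else 0)
     - (if 0 < j then xy (a (j - 1)) (b j) * u (j - 1) else 0)"
proof -
  have 1: "xy 0 (b (Suc j) - b j) * u j * gen j = xy (a j) (b (Suc j)) * u j" if "j < n"
  proof -
    have "xy 0 (b (Suc j) - b j) * u j * gen j = xy 0 (b (Suc j) - b j) * gen j * u j"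
      by (simp only: mult_ac)
    also have "xy 0 (b (Suc j) - b j) * gen j = xy (a j) (b (Suc j))"
      using b_less[OF that] by (simp add: gen_def xy_mult)
    finally show ?thesis .
  qed
  have 2: "xy (a (j - 1) - a j) 0 * u (j - 1) * gen j = xy (a (j - 1)) (b j) * u (j - 1)" if "0 < j"
  proof -
    have "xy (a (j - 1) - a j) 0 * u (j - 1) * gen j = xy (a (j - 1) - a j) 0 * gen j * u (j - 1)"
      by (simp only: mult_ac)
    also have "xy (a (j - 1) - a j) 0 * gen j = xy (a (j - 1)) (b j)"
      using a_less[of "j - 1"] assms that by (cases j) (auto simp: gen_def xy_mult)
    finally show ?thesis .
  qed
  show ?thesis
    by (cases "j < n"; cases "0 < j")
      (simp_all only: hb_def left_diff_distrib assms 1 2 if_True if_False mult_zero_left simp_thms)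
qed

text \<open>
  The two summands of consecutive entries of \<open>hb u\<close> cancel after multiplication by the corners, so
  only the last one survives.
\<close>

lemma hb_partial_sum:
  "k \<le> n \<Longrightarrow> (\<Sum>j<k. hb u j * gen j) = (if 0 < k then xy (a (k - 1)) (b k) * u (k - 1) else 0)"
proof (induction k)
  case (Suc k)
  then show ?case using hb_gen[of k u] by simp
qed simp

lemma hb_sum: "(\<Sum>j\<le>n. hb u j * gen j) = 0"
  using hb_partial_sum[of n u] hb_gen[of n u] by (simp flip: lessThan_Suc_atMost)

text \<open>
  For a syzygy \<open>w\<close>, the sum of \<open>w j * gen j\<close> over \<open>j \<le> k\<close> is divisible by \<open>x^(a k)\<close>, as
  every summand is, and by \<open>y^(b (k+1))\<close>, as it is minus the sum over \<open>j > k\<close>. By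
  \<open>hb_partial_sum\<close>, the quotient is what the \<open>k\<close>-th coordinate of a preimage must be.
\<close>

lemma syzygy_hb:
  assumes "(\<Sum>j\<le>n. w j * gen j) = 0"
  obtains u where "\<And>j. j \<le> n \<Longrightarrow> w j = hb u j"
proof -
  define s where "s = (\<lambda>k. \<Sum>j<k. w j * gen j)"
  have s: "s (Suc n) = 0" using assms by (simp add: s_def lessThan_Suc_atMost)
  have dvd: "xy (a k) (b (Suc k)) dvd s (Suc k)" if k: "k < n" for k
  proof (rule xy_dvdI, intro conjI)
    fix i j assume nz: "mcoeff (s (Suc k)) i j \<noteq> 0"
    then obtain l where "l \<in> {..<Suc k}" "mcoeff (w l * gen l) i j \<noteq> 0"
      unfolding s_def mcoeff_sum by (rule sum.not_neutral_contains_not_neutral)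
    then have "l < Suc k" "mcoeff (gen l * w l) i j \<noteq> 0" by (simp_all add: mult.commute)
    then show "a k \<le> i" using a_mono[of l k] k by (auto simp: gen_def mcoeff_xy_mult split: if_splits)
    have "s (Suc n) = s (Suc k) + (\<Sum>j\<in>{Suc k..<Suc n}. w j * gen j)"
      unfolding s_def using k sum.atLeastLessThan_concat[of 0 "Suc k" "Suc n" "\<lambda>j. w j * gen j"]
      by (simp add: lessThan_atLeast0)
    then have "mcoeff (\<Sum>j\<in>{Suc k..<Suc n}. w j * gen j) i j \<noteq> 0"
      using nz s by (metis add.right_neutral mcoeff_simps(1,2))
    then obtain l where l: "l \<in> {Suc k..<Suc n}" "mcoeff (w l * gen l) i j \<noteq> 0"
      unfolding mcoeff_sum by (rule sum.not_neutral_contains_not_neutral)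
    then have "mcoeff (gen l * w l) i j \<noteq> 0" by (simp add: mult.commute)
    with l show "b (Suc k) \<le> j" using b_mono[of "Suc k" l] by (auto simp: gen_def mcoeff_xy_mult split: if_splits)
  qed
  \<comment> \<open>the coordinates are forced by \<open>hb_partial_sum\<close>, and the divisions are exact\<close>
  define u where "u = (\<lambda>k. s (Suc k) div xy (a k) (b (Suc k)))"
  have u: "s (Suc k) = xy (a k) (b (Suc k)) * u k" if "k < n" for k
    using dvd[OF that] by (simp add: u_def)
  have "w j = hb u j" if j: "j \<le> n" for j
  proof -
    have "w j * gen j = s (Suc j) - s j" by (simp add: s_def)
    also have "\<dots> = hb u j * gen j"
      unfolding hb_gen[OF j]
      using j s u[of j] u[of "j - 1"] by (cases "j = n"; cases "j = 0") (simp_all add: s_def)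
    finally show ?thesis by (simp add: gen_def xy_nonzero)
  qed
  then show ?thesis using that[of u] by simp
qed

lemma hb_inj:
  assumes "\<And>j. j \<le> n \<Longrightarrow> hb u j = 0" "k < n"
  shows "u k = 0"
proof -
  have "(\<Sum>j<Suc k. hb u j * gen j) = 0" using assms by (intro sum.neutral) auto
  then have "xy (a k) (b (Suc k)) * u k = 0"
    using hb_partial_sum[of "Suc k" u] assms(2) by (simp del: sum.lessThan_Suc)
  then show ?thesis by (simp add: xy_nonzero)
qed

lemma resolves_staircase:
  "resolves (J :: 'k::field poly poly set) rank diff (coord_functional 0)"
  unfolding resolves_def
proof (intro conjI allI)
  have [simp]: "rank 0 = Suc 0" "rank (Suc 0) = Suc n" "rank (Suc (Suc 0)) = n" "rank (Suc (Suc (Suc i))) = 0" for i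
    by (simp_all add: rank_def)
  note co = coord_functional_def
  show "slin (coord_functional 0 :: _ \<Rightarrow> 'k poly poly)" by (rule slinI) (simp_all add: co)
  show "coord_functional 0 (trunc (rank 0) v) = coord_functional 0 v" for v :: "_ \<Rightarrow> 'k poly poly"
    by (simp add: co trunc_def)
  show "\<exists>v. coord_functional 0 v - 1 \<in> (J :: 'k poly poly set)"
    by (rule exI[of _ "\<lambda>_. 1"]) (simp add: co ideal_rta_zero[OF ideal_J])
  show "vlin (diff i :: (_ \<Rightarrow> 'k poly poly) \<Rightarrow> _)" for i
    by (rule vlinI) (auto simp: diff_def hb_def fun_eq_iff algebra_simps sum.distrib sum_distrib_left)
  show "diff i (trunc (rank (Suc i)) v) = diff i v" for i and v :: "_ \<Rightarrow> 'k poly poly"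
    by (cases "i = 0"; cases "i = 1") (auto simp: diff_def hb_def fun_eq_iff trunc_def intro!: sum.cong)
  show "trunc (rank i) (diff i v) = diff i v" for i and v :: "_ \<Rightarrow> 'k poly poly"
    by (cases "i = 0"; cases "i = 1") (auto simp: diff_def hb_def fun_eq_iff trunc_def)
  show "coord_functional 0 v \<in> J \<longleftrightarrow> (\<exists>w. trunc (rank 0) v = diff 0 w)" for v :: "_ \<Rightarrow> 'k poly poly"
    by (auto simp: co mem_J_iff diff_def trunc_def fun_eq_iff)
  fix i and v :: "nat \<Rightarrow> 'k poly poly"
  consider "i = 0" | "i = 1" | k where "i = Suc (Suc k)" by (metis One_nat_def not0_implies_Suc)
  then show "diff i v = 0 \<longleftrightarrow> (\<exists>w. trunc (rank (Suc i)) v = diff (Suc i) w)"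
  proof cases
    case 1
    have "diff 0 v = 0 \<longleftrightarrow> (\<Sum>l\<le>n. v l * gen l) = 0" by (auto simp: diff_def fun_eq_iff)
    also have "\<dots> \<longleftrightarrow> (\<exists>u. \<forall>j\<le>n. v j = hb u j)"
    proof
      assume "\<exists>u. \<forall>j\<le>n. v j = hb u j"
      then obtain u where "\<forall>j\<le>n. v j = hb u j" ..
      then have "(\<Sum>l\<le>n. v l * gen l) = (\<Sum>l\<le>n. hb u l * gen l)" by (intro sum.cong) auto
      then show "(\<Sum>l\<le>n. v l * gen l) = 0" by (simp add: hb_sum)
    next
      assume "(\<Sum>l\<le>n. v l * gen l) = 0"
      from syzygy_hb[OF this] obtain u where "\<And>j. j \<le> n \<Longrightarrow> v j = hb u j" by auto
      then show "\<exists>u. \<forall>j\<le>n. v j = hb u j" by (intro exI[of _ u]) simp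
    qed
    also have "\<dots> \<longleftrightarrow> (\<exists>u. trunc (Suc n) v = hb u)"
      by (auto simp: fun_eq_iff trunc_def less_Suc_eq_le hb_def)
    finally show ?thesis using 1 by (simp add: diff_def)
  next
    case 2
    have "hb v = 0 \<longleftrightarrow> trunc n v = 0"
    proof
      assume "hb v = 0"
      then show "trunc n v = 0" using hb_inj[of v] by (simp add: trunc_def fun_eq_iff)
    next
      assume "trunc n v = 0"
      then have "v k = 0" if "k < n" for k using that by (metis trunc_def zero_fun_apply)
      then show "hb v = 0" by (auto simp: hb_def fun_eq_iff)
    qed
    then show ?thesis using 2 by (simp add: diff_def zero_fun_def)
  next
    case 3
    then show ?thesis by (simp add: diff_def trunc_def zero_fun_def)
  qed
qed

end

section \<open>The canonical trace of a staircase\<close>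

lemma ideal_trace:
  fixes J :: "'a::comm_ring_1 set"
  assumes J: "ideal J ring_of_type_algebra"
  shows "ideal (trace_ideal (quot J) M) (quot J)"
  unfolding trace_ideal_def
  by (rule ring.genideal_ideal[OF cring.axioms(1)[OF cring_quot[OF J]]])
    (auto simp: linear_maps_def regular_module_def)

lemma graded_max_ideal_subset_iff:
  fixes I :: "'k::field poly poly set"
  assumes I: "ideal I Kxy" and P: "ideal P (quot I)"
  shows "graded_max_ideal I \<subseteq> P \<longleftrightarrow> coset I (xy 1 0) \<in> P \<and> coset I (xy 0 1) \<in> P"
proof
  have "xy 1 0 \<in> Idl\<^bsub>Kxy\<^esub> {xy 1 0, xy 0 1 :: 'k poly poly}" "xy 0 1 \<in> Idl\<^bsub>Kxy\<^esub> {xy 1 0, xy 0 1 :: 'k poly poly}"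
    using genideal_rta_superset[of "{xy 1 0, xy 0 1 :: 'k poly poly}"] by auto
  then show "graded_max_ideal I \<subseteq> P \<Longrightarrow> coset I (xy 1 0) \<in> P \<and> coset I (xy 0 1) \<in> P"
    by (auto simp: graded_max_ideal_def)
next
  obtain K where K: "ideal K Kxy" "I \<subseteq> K" "P = coset I ` K"
    using P ideal_quot_iff[OF I] by blast
  assume "coset I (xy 1 0) \<in> P \<and> coset I (xy 0 1) \<in> P"
  then have "{xy 1 0, xy 0 1} \<subseteq> K"
    unfolding K(3) by (simp add: coset_in_image_iff[OF I K(1,2)])
  then have "Idl\<^bsub>Kxy\<^esub> {xy 1 0, xy 0 1} \<subseteq> K" by (rule genideal_rta_least[OF K(1)])
  then show "graded_max_ideal I \<subseteq> P" unfolding graded_max_ideal_def K(3) by blast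
qed

lemma up_closed_Un_strips: "up_closed {(i, j). p \<le> i \<or> q \<le> j}"
  by (auto simp: up_closed_def)

context staircase
begin

text \<open>
  If the residue ring has dimension \<open>e\<close>, the canonical module is \<open>Ext\<close> in degree \<open>2 - e\<close>. It is
  computed by vectors if the Hilbert-Burch resolution ends in this degree.
\<close>

lemma canonical_trace_memI:
  assumes dim: "krull_dim (quot (J :: 'k::field poly poly set)) = enat e" "2 - e = Suc k"
    and top: "diff (Suc k) = (\<lambda>(_ :: nat \<Rightarrow> 'k poly poly) _. 0)"
    and v: "\<And>j. j < rank k \<Longrightarrow> diff k v j \<in> (J :: 'k poly poly set)" and i: "i < rank (Suc k)"
  shows "coset J (v i) \<in> canonical_trace J"
  unfolding canonical_trace_def canonical_module_def dim(1) the_enat.simps dim(2)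
  by (rule trace_top_Ext_memI[OF ideal_J resolves_staircase]) (use v i top in \<open>auto simp: zero_fun_def\<close>)

lemma canonical_trace_subset:
  assumes dim: "krull_dim (quot (J :: 'k::field poly poly set)) = enat e" "2 - e = Suc k"
    and top: "diff (Suc k) = (\<lambda>(_ :: nat \<Rightarrow> 'k poly poly) _. 0)"
    and K: "ideal K Kxy" "J \<subseteq> K"
    and sub: "\<And>v. \<forall>j<rank k. diff k v j \<in> (J :: 'k poly poly set) \<Longrightarrow> \<forall>i<rank (Suc k). v i \<in> K"
  shows "canonical_trace J \<subseteq> coset J ` K"
  unfolding canonical_trace_def canonical_module_def dim(1) the_enat.simps dim(2)
  by (rule trace_top_Ext_subset[OF ideal_J resolves_staircase _ K sub]) (use top in \<open>simp_all add: zero_fun_def\<close>)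

lemma nearly_gorenstein_iff:
  "nearly_gorenstein_quot (J :: 'k::field poly poly set) \<longleftrightarrow>
     coset (J :: 'k poly poly set) (xy 1 0) \<in> canonical_trace J \<and> coset (J :: 'k poly poly set) (xy 0 1) \<in> canonical_trace J"
  unfolding nearly_gorenstein_quot_def canonical_trace_def
  by (rule graded_max_ideal_subset_iff[OF ideal_J ideal_trace[OF ideal_J]])

lemma nearly_gorenstein_if_one_in_trace:
  assumes "coset (J :: 'k::field poly poly set) 1 \<in> canonical_trace J"
  shows "nearly_gorenstein_quot (J :: 'k::field poly poly set)"
proof -
  have "canonical_trace J = carrier (quot (J :: 'k poly poly set))"
    using ideal.one_imp_carrier[OF ideal_trace[OF ideal_J]] assms
    unfolding canonical_trace_def by (simp add: quot_one[OF ideal_J])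
  then show ?thesis by (simp add: nearly_gorenstein_iff quot_carrier[OF ideal_J])
qed

lemma nearly_gorenstein_principal:
  assumes "n = 0" "krull_dim (quot (J :: 'k::field poly poly set)) = enat 1"
  shows "nearly_gorenstein_quot (J :: 'k::field poly poly set)"
proof (rule nearly_gorenstein_if_one_in_trace)
  have "gen 0 \<in> (J :: 'k poly poly set)" by (auto simp: gen_def xy_in_mono_ideal_iff mem_exps)
  then have d0: "diff 0 (\<lambda>_. 1) j \<in> (J :: 'k poly poly set)" for j
  proof -
    have "diff 0 (\<lambda>_. 1) j = (if j = 0 then gen 0 else 0 :: 'k poly poly)"
      unfolding diff_def using assms(1) by simp
    then show ?thesis using \<open>gen 0 \<in> J\<close> by (simp add: ideal_rta_zero[OF ideal_J])
  qed
  have top: "diff (Suc 0) = (\<lambda>(_ :: nat \<Rightarrow> 'k poly poly) _. 0)"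
    unfolding diff_def hb_def using assms(1) by (simp add: fun_eq_iff)
  have r: "rank (Suc 0) = 1"
    unfolding rank_def using assms(1) by simp
  show "coset (J :: 'k poly poly set) 1 \<in> canonical_trace J"
    using canonical_trace_memI[of 1 0 "\<lambda>_. 1 :: 'k poly poly" 0] assms(2)
    by (simp add: top d0 r)
qed

end

text \<open>
  The staircases with at least two corners that reach both coordinate axes; these describe the
  ideals with \<open>n \<ge> 1\<close> for which the residue ring has dimension 0.
\<close>

locale artinian_staircase = staircase +
  assumes n_pos: "0 < n" and a_last: "a n = 0" and b_first: "b 0 = 0"
begin

lemma J_pure_x: "(i, 0) \<in> exps \<longleftrightarrow> a 0 \<le> i"
proof
  assume "(i, 0) \<in> exps"
  then obtain k where k: "k \<le> n" "a k \<le> i" "b k = 0" by (auto simp: mem_exps)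
  then have "k = 0" using b_mono[of 0 k] by simp
  then show "a 0 \<le> i" using k by simp
qed (auto simp: mem_exps b_first)

lemma J_pure_y: "(0, j) \<in> exps \<longleftrightarrow> b n \<le> j"
proof
  assume "(0, j) \<in> exps"
  then obtain k where k: "k \<le> n" "a k = 0" "b k \<le> j" by (auto simp: mem_exps)
  then have "k = n" using a_mono[of k n] a_last by simp
  then show "b n \<le> j" using k by simp
qed (auto simp: mem_exps a_last)

text \<open>
  In row \<open>k + 1\<close> of \<open>hb v\<close> the entry \<open>v k\<close> is multiplied by \<open>x^(a k - a (k+1))\<close>, and the other
  summand is a multiple of \<open>y\<close>. So the coefficient of \<open>v k\<close> at \<open>x^t\<close> survives as a coefficient at a
  pure power of \<open>x\<close>, which has to be a multiple of the corner \<open>x^(a 0)\<close>.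
\<close>

lemma hb_mem_J_x:
  assumes v: "hb v (Suc k) \<in> J" and k: "k < n" and t: "mcoeff (v k) t 0 \<noteq> 0"
  shows "a 0 + a (Suc k) \<le> a k + t"
proof -
  have "mcoeff (hb v (Suc k)) (a k - a (Suc k) + t) 0 = - mcoeff (v k) t 0"
    using k b_less[of "Suc k"] by (cases "Suc k < n") (simp_all add: hb_def mcoeff_xy_mult)
  then have "(a k - a (Suc k) + t, 0) \<in> exps"
    using v t unfolding mono_ideal_def by force
  then show ?thesis using a_less[OF k] by (simp add: J_pure_x)
qed

lemma hb_mem_J_y:
  assumes v: "hb v k \<in> J" and k: "k < n" and t: "mcoeff (v k) 0 t \<noteq> 0"
  shows "b n + b k \<le> b (Suc k) + t"
proof -
  have "mcoeff (hb v k) 0 (b (Suc k) - b k + t) = mcoeff (v k) 0 t"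
    using k a_less[of "k - 1"] by (cases k) (auto simp: hb_def mcoeff_xy_mult)
  then have "(0, b (Suc k) - b k + t) \<in> exps"
    using v t unfolding mono_ideal_def by force
  then show ?thesis using b_less[OF k] by (simp add: J_pure_y)
qed

context
  assumes dim: "krull_dim (quot (J :: 'k::field poly poly set)) = enat 0"
begin

lemma trace_memI:
  assumes "\<And>j. j \<le> n \<Longrightarrow> hb v j \<in> (J :: 'k poly poly set)" "i < n"
  shows "coset J (v i) \<in> canonical_trace J"
  using canonical_trace_memI[OF dim, of 1 v i] assms
  by (simp add: diff_def rank_def less_Suc_eq_le numeral_2_eq_2)

text \<open>
  If no index satisfies the inequality, \<open>hb_mem_J_x\<close> forces the entries of all admissible vectors
  into the ideal \<open>(x^2, y)\<close>, which does not contain \<open>x\<close>.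
\<close>

lemma x_in_trace:
  assumes "coset (J :: 'k poly poly set) (xy 1 0) \<in> canonical_trace J" and "1 < a 0"
  shows "\<exists>k<n. a 0 + a (Suc k) \<le> a k + 1"
proof (rule ccontr)
  assume neg: "\<not> ?thesis"
  let ?K = "mono_ideal {(i, j). 2 \<le> i \<or> 1 \<le> j} :: 'k poly poly set"
  have K: "ideal ?K Kxy" by (rule ideal_mono_ideal[OF up_closed_Un_strips])
  have JK: "J \<subseteq> ?K"
    unfolding mono_ideal_subset_iff[OF K] xy_in_mono_ideal_iff
  proof clarify
    fix i j assume "(i, j) \<in> exps" "\<not> 1 \<le> j"
    then show "2 \<le> i" using J_pure_x[of i] assms(2) by (cases "j = 0") auto
  qed
  have "\<forall>i<n. v i \<in> ?K" if v: "\<forall>j<Suc n. hb v j \<in> (J :: 'k poly poly set)" for v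
  proof (intro allI impI)
    fix k assume k: "k < n"
    have "mcoeff (v k) t 0 = 0" if "t \<le> 1" for t
    proof (rule ccontr)
      assume nz: "mcoeff (v k) t 0 \<noteq> 0"
      have "hb v (Suc k) \<in> J" using v k by simp
      from hb_mem_J_x[OF this k nz] show False using neg k that by fastforce
    qed
    then have "2 \<le> i \<or> 1 \<le> j" if "mcoeff (v k) i j \<noteq> 0" for i j
      using that by (cases "j = 0"; cases "i \<le> 1") auto
    then show "v k \<in> ?K" by (simp add: mono_ideal_def)
  qed
  then have "canonical_trace J \<subseteq> coset J ` ?K"
    by (intro canonical_trace_subset[OF dim _ _ K JK, of 1])
      (simp_all add: diff_def rank_def fun_eq_iff numeral_2_eq_2)
  then have "xy 1 0 \<in> ?K" using assms(1) coset_in_image_iff[OF ideal_J K JK] by blast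
  then show False by (simp add: xy_in_mono_ideal_iff)
qed

lemma y_in_trace:
  assumes "coset (J :: 'k poly poly set) (xy 0 1) \<in> canonical_trace J" and "1 < b n"
  shows "\<exists>k<n. b n + b k \<le> b (Suc k) + 1"
proof (rule ccontr)
  assume neg: "\<not> ?thesis"
  let ?K = "mono_ideal {(i, j). 1 \<le> i \<or> 2 \<le> j} :: 'k poly poly set"
  have K: "ideal ?K Kxy" by (rule ideal_mono_ideal[OF up_closed_Un_strips])
  have JK: "J \<subseteq> ?K"
    unfolding mono_ideal_subset_iff[OF K] xy_in_mono_ideal_iff
  proof clarify
    fix i j assume "(i, j) \<in> exps" "\<not> 2 \<le> j"
    then show "1 \<le> i" using J_pure_y[of j] assms(2) by (cases "i = 0") auto
  qed
  have "\<forall>i<n. v i \<in> ?K" if v: "\<forall>j<Suc n. hb v j \<in> (J :: 'k poly poly set)" for v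
  proof (intro allI impI)
    fix k assume k: "k < n"
    have "mcoeff (v k) 0 t = 0" if "t \<le> 1" for t
    proof (rule ccontr)
      assume nz: "mcoeff (v k) 0 t \<noteq> 0"
      have "hb v k \<in> J" using v k by simp
      from hb_mem_J_y[OF this k nz] show False using neg k that by fastforce
    qed
    then have "1 \<le> i \<or> 2 \<le> j" if "mcoeff (v k) i j \<noteq> 0" for i j
      using that by (cases "i = 0"; cases "j \<le> 1") auto
    then show "v k \<in> ?K" by (simp add: mono_ideal_def)
  qed
  then have "canonical_trace J \<subseteq> coset J ` ?K"
    by (intro canonical_trace_subset[OF dim _ _ K JK, of 1])
      (simp_all add: diff_def rank_def fun_eq_iff numeral_2_eq_2)
  then have "xy 0 1 \<in> ?K" using assms(1) coset_in_image_iff[OF ideal_J K JK] by blast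
  then show False by (simp add: xy_in_mono_ideal_iff)
qed

lemma nearly_gorenstein_two_gens:
  assumes "n = 1"
  shows "nearly_gorenstein_quot (J :: 'k poly poly set)"
proof (rule nearly_gorenstein_if_one_in_trace)
  have "hb (\<lambda>_. 1) j \<in> (J :: 'k poly poly set)" if "j \<le> n" for j
  proof -
    have "hb (\<lambda>_. 1) j = (if j = 0 then xy 0 (b n) else - xy (a 0) 0 :: 'k poly poly)"
      unfolding hb_def using that assms a_last b_first by (cases j) auto
    moreover have "xy 0 (b n) \<in> (J :: 'k poly poly set)" "xy (a 0) 0 \<in> (J :: 'k poly poly set)"
      by (simp_all add: xy_in_mono_ideal_iff J_pure_x J_pure_y)
    ultimately show ?thesis by (simp add: ideal_rta_uminus[OF ideal_J])
  qed
  then show "coset (J :: 'k poly poly set) 1 \<in> canonical_trace J"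
    using trace_memI[of "\<lambda>_. 1" 0] n_pos by simp
qed

lemma nearly_gorenstein_three_gens:
  assumes n: "n = 2"
  shows "nearly_gorenstein_quot (J :: 'k poly poly set) \<longleftrightarrow>
    (a 0 - a 1 = 1 \<or> a 1 = 1) \<and> (b 2 - b 1 = 1 \<or> b 1 = 1)" (is "_ \<longleftrightarrow> ?x \<and> ?y")
proof
  have lt: "a 1 < a 0" "0 < a 1" "0 < b 1" "b 1 < b 2"
    using a_less[of 0] a_less[of 1] b_less[of 0] b_less[of 1] n a_last b_first by (simp_all add: numeral_2_eq_2)
  have mem1: "xy (a 0) j \<in> (J :: 'k poly poly set)" for j
    unfolding xy_in_mono_ideal_iff mem_exps by (rule exI[of _ 0]) (simp add: b_first)
  have mem2: "xy i (b 2) \<in> (J :: 'k poly poly set)" for i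
    unfolding xy_in_mono_ideal_iff mem_exps by (rule exI[of _ 2]) (use n a_last in simp)
  have mem3: "xy i j \<in> (J :: 'k poly poly set)" if "a 1 \<le> i" "b 1 \<le> j" for i j
    unfolding xy_in_mono_ideal_iff mem_exps by (rule exI[of _ 1]) (use n that in simp)
  {
    assume "nearly_gorenstein_quot (J :: 'k poly poly set)"
    then have "coset (J :: 'k poly poly set) (xy 1 0) \<in> canonical_trace J"
       "coset (J :: 'k poly poly set) (xy 0 1) \<in> canonical_trace J"
      by (simp_all add: nearly_gorenstein_iff)
    from x_in_trace[OF this(1)] y_in_trace[OF this(2)] lt n
    obtain k l where "k < 2" "a 0 + a (Suc k) \<le> a k + 1" "l < 2" "b 2 + b l \<le> b (Suc l) + 1"
      by auto
    moreover have "k = 0 \<or> k = 1" "l = 0 \<or> l = 1" using calculation by auto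
    ultimately show "?x \<and> ?y"
      using lt n a_last b_first by (auto simp: numeral_2_eq_2)
  }
  assume xy: "?x \<and> ?y"
  have hb: "hb v j = (if j = 0 then xy 0 (b 1) * v 0 else if j = 1 then xy 0 (b 2 - b 1) * v 1 - xy (a 0 - a 1) 0 * v 0
      else if j = 2 then - (xy (a 1) 0 * v 1) else 0)" for v :: "nat \<Rightarrow> 'k poly poly" and j
    unfolding hb_def using n a_last b_first by (auto simp: numeral_2_eq_2)
  have trI: "coset J (v i) \<in> canonical_trace J"
    if "xy 0 (b 1) * v 0 \<in> J" "xy 0 (b 2 - b 1) * v 1 - xy (a 0 - a 1) 0 * v 0 \<in> J" "xy (a 1) 0 * v 1 \<in> J" "i < 2"
    for v :: "nat \<Rightarrow> 'k poly poly" and i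
  proof (rule trace_memI)
    show "hb v j \<in> J" for j
      using that(1-3) by (simp add: hb ideal_rta_zero[OF ideal_J] ideal_rta_uminus[OF ideal_J])
    show "i < n" using that(4) n by simp
  qed
  note neg = ideal_rta_uminus[OF ideal_J] and z = ideal_rta_zero[OF ideal_J]
  \<comment> \<open>the admissible vectors are \<open>(x, 0)\<close> if \<open>a 1 = 1\<close> and \<open>(y^(b 2 - b 1), x)\<close> if \<open>a 0 - a 1 = 1\<close>\<close>
  have "coset (J :: 'k poly poly set) (xy 1 0) \<in> canonical_trace J"
  proof (cases "a 1 = 1")
    case True
    then show ?thesis
      using trI[of "\<lambda>i. if i = 0 then xy 1 0 else 0" 0] mem1[of 0] mem3[of 1 "b 1"] lt
      by (simp add: xy_mult z neg)
  next
    case False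
    then have "a 0 = Suc (a 1)" using xy lt by auto
    then show ?thesis
      using trI[of "\<lambda>i. if i = 0 then xy 0 (b 2 - b 1) else xy 1 0" 1] mem1[of 0] mem2[of 0] lt
      by (simp add: xy_mult z)
  qed
  \<comment> \<open>here they are \<open>(0, y)\<close> if \<open>b 1 = 1\<close> and \<open>(y, x^(a 0 - a 1))\<close> if \<open>b 2 - b 1 = 1\<close>\<close>
  moreover have "coset (J :: 'k poly poly set) (xy 0 1) \<in> canonical_trace J"
  proof (cases "b 1 = 1")
    case True
    then show ?thesis
      using trI[of "\<lambda>i. if i = 0 then 0 else xy 0 1" 1] mem2[of 0] mem3[of "a 1" 1] lt
      by (simp add: xy_mult z)
  next
    case False
    then have "b 2 = Suc (b 1)" using xy lt by auto
    then show ?thesis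
      using trI[of "\<lambda>i. if i = 0 then xy 0 1 else xy (a 0 - a 1) 0" 0] mem1[of 0] mem2[of 0] lt
      by (simp add: xy_mult z)
  qed
  ultimately show "nearly_gorenstein_quot (J :: 'k poly poly set)" by (simp add: nearly_gorenstein_iff)
qed

text \<open>
  As \<open>a n = 0\<close>, the inequality of \<open>x_in_trace\<close> says that the \<open>n - 1\<close> steps \<open>a l - a (l+1)\<close> with
  \<open>l \<noteq> k\<close> have total length at most 1, and each of them is at least 1.
\<close>

lemma nearly_gorenstein_imp_at_most_three_gens:
  assumes "nearly_gorenstein_quot (J :: 'k poly poly set)"
  shows "n \<le> 2"
proof (rule ccontr)
  assume n: "\<not> n \<le> 2"
  have "1 < a 0" using a_mono[of 0 n] n by simp
  moreover have "coset (J :: 'k poly poly set) (xy 1 0) \<in> canonical_trace J"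
    using assms by (simp add: nearly_gorenstein_iff)
  ultimately obtain k where k: "k < n" "a 0 + a (Suc k) \<le> a k + 1"
    using x_in_trace by blast
  then show False
    using a_mono[of 0 k] a_mono[of "Suc k" n] n by simp
qed

end

end

section \<open>Krull dimension of residue rings\<close>

definition prime_set :: "'a::comm_ring_1 set \<Rightarrow> bool" where
  "prime_set K \<longleftrightarrow> ideal K ring_of_type_algebra \<and> 1 \<notin> K \<and> (\<forall>a b. a * b \<in> K \<longrightarrow> a \<in> K \<or> b \<in> K)"

lemma prime_set_power:
  assumes "prime_set K" "x ^ m \<in> K"
  shows "0 < m \<and> x \<in> K"
proof (rule conjI)
  have K: "1 \<notin> K" "\<And>a b. a * b \<in> K \<Longrightarrow> a \<in> K \<or> b \<in> K" using assms(1) by (auto simp: prime_set_def)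
  show "0 < m" using assms(2) K(1) by (cases m) auto
  show "x \<in> K" using assms(2)
  proof (induction m)
    case (Suc m)
    then show ?case using K(2)[of x "x ^ m"] by auto
  qed (use K(1) in simp)
qed

lemma xy_power: "xy i j = xy 1 0 ^ i * xy 0 1 ^ j"
  by (simp add: xy_def)

lemma prime_set_xy:
  assumes "prime_set K" "xy i j \<in> K"
  shows "xy 1 0 \<in> K \<and> 0 < i \<or> xy 0 1 \<in> K \<and> 0 < j"
proof -
  have "xy 1 0 ^ i \<in> K \<or> xy 0 1 ^ j \<in> K"
    using assms unfolding xy_power[of i j] prime_set_def by blast
  then show ?thesis using prime_set_power[OF assms(1)] by blast
qed

lemma prime_set_preimage:
  fixes J :: "'a::comm_ring_1 set"
  assumes J: "ideal J ring_of_type_algebra" and P: "primeideal P (quot J)"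
  shows "prime_set {s. coset J s \<in> P}" "J \<subseteq> {s. coset J s \<in> P}" "P = coset J ` {s. coset J s \<in> P}"
proof -
  obtain K where K: "ideal K ring_of_type_algebra" "J \<subseteq> K" "P = coset J ` K" "1 \<notin> K"
    "\<forall>a b. a * b \<in> K \<longrightarrow> a \<in> K \<or> b \<in> K"
    using P unfolding primeideal_quot_iff[OF J] by blast
  have eq: "{s. coset J s \<in> P} = K"
    unfolding K(3) using coset_in_image_iff[OF J K(1,2)] by blast
  show "prime_set {s. coset J s \<in> P}" "J \<subseteq> {s. coset J s \<in> P}" "P = coset J ` {s. coset J s \<in> P}"
    unfolding eq using K by (simp_all add: prime_set_def)
qed

lemma primeideal_quot_image:
  fixes J :: "'a::comm_ring_1 set"
  assumes J: "ideal J ring_of_type_algebra" and K: "prime_set K" "J \<subseteq> K"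
  shows "primeideal (coset J ` K) (quot J)"
  using K unfolding primeideal_quot_iff[OF J] prime_set_def by blast

definition prime_chain :: "'a::comm_ring_1 set \<Rightarrow> nat \<Rightarrow> (nat \<Rightarrow> 'a set) \<Rightarrow> bool" where
  "prime_chain J m K \<longleftrightarrow> (\<forall>i\<le>m. prime_set (K i) \<and> J \<subseteq> K i) \<and> (\<forall>i<m. K i \<subset> K (Suc i))"

lemma prime_chain_quot_iff:
  fixes J :: "'a::comm_ring_1 set"
  assumes J: "ideal J ring_of_type_algebra"
  shows "(\<exists>P. (\<forall>i\<le>m. primeideal (P i) (quot J)) \<and> (\<forall>i<m. P i \<subset> P (Suc i))) \<longleftrightarrow>
    (\<exists>K. prime_chain J m K)"
proof (rule iffI; elim exE)
  fix P :: "nat \<Rightarrow> 'a set set" assume P: "(\<forall>i\<le>m. primeideal (P i) (quot J)) \<and> (\<forall>i<m. P i \<subset> P (Suc i))"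
  define K where "K = (\<lambda>i. {s. coset J s \<in> P i})"
  have pr: "prime_set (K i) \<and> J \<subseteq> K i \<and> P i = coset J ` K i" if "i \<le> m" for i
    unfolding K_def using prime_set_preimage[OF J, of "P i"] P that by simp
  have "K i \<subset> K (Suc i)" if i: "i < m" for i
  proof -
    have "P i \<subset> P (Suc i)" using P i by simp
    moreover from this have "K i \<subseteq> K (Suc i)" by (auto simp: K_def)
    ultimately show ?thesis using pr[of i] pr[of "Suc i"] i by auto
  qed
  then have "prime_chain J m K" using pr by (simp add: prime_chain_def)
  then show "\<exists>K. prime_chain J m K" by (rule exI[of _ K])
next
  fix K :: "nat \<Rightarrow> 'a set" assume K: "prime_chain J m K"
  have "coset J ` K i \<subset> coset J ` K (Suc i)" if i: "i < m" for i
  proof -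
    have id: "ideal (K i) ring_of_type_algebra" "J \<subseteq> K i" and lt: "K i \<subset> K (Suc i)"
      using K i by (simp_all add: prime_chain_def prime_set_def)
    obtain s where "s \<in> K (Suc i)" "s \<notin> K i" using lt by blast
    then have "coset J s \<in> coset J ` K (Suc i)" "coset J s \<notin> coset J ` K i"
      using coset_in_image_iff[OF J id, of s] by auto
    then show ?thesis using lt by blast
  qed
  moreover have "primeideal (coset J ` K i) (quot J)" if "i \<le> m" for i
    using primeideal_quot_image[OF J] K that by (simp add: prime_chain_def)
  ultimately show "\<exists>P. (\<forall>i\<le>m. primeideal (P i) (quot J)) \<and> (\<forall>i<m. P i \<subset> P (Suc i))"
    by (intro exI[of _ "\<lambda>i. coset J ` K i"]) simp
qed

lemma krull_dim_quot:
  fixes J :: "'a::comm_ring_1 set"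
  assumes J: "ideal J ring_of_type_algebra"
  shows "krull_dim (quot J) = Sup {enat l |l. \<exists>K. prime_chain J l K}"
  unfolding krull_dim_def prime_chain_quot_iff[OF J] ..

lemma krull_dim_quot_geI:
  fixes J :: "'a::comm_ring_1 set"
  assumes J: "ideal J ring_of_type_algebra" and K: "prime_chain J m K"
  shows "enat m \<le> krull_dim (quot J)"
  unfolding krull_dim_quot[OF J] by (rule Sup_upper) (use K in auto)

lemma krull_dim_quot_eqI:
  fixes J :: "'a::comm_ring_1 set"
  assumes J: "ideal J ring_of_type_algebra" and lower: "prime_chain J m K"
    and upper: "\<And>l K. prime_chain J l K \<Longrightarrow> l \<le> m"
  shows "krull_dim (quot J) = enat m"
proof (rule antisym)
  show "krull_dim (quot J) \<le> enat m"
    unfolding krull_dim_quot[OF J] by (rule Sup_least) (use upper in auto)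
qed (rule krull_dim_quot_geI[OF J lower])

lemma prime_chain_two:
  assumes "prime_set P" "prime_set Q" "J \<subseteq> P" "P \<subset> Q"
  shows "prime_chain J 1 (\<lambda>i. if i = 0 then P else Q)"
  using assms by (auto simp: prime_chain_def)

text \<open>
  An element of least degree generates, by division with remainder.
\<close>

lemma ideal_poly_principal:
  fixes L :: "'k::field poly set"
  assumes L: "ideal L ring_of_type_algebra"
  obtains q where "q \<in> L" "\<And>f. f \<in> L \<Longrightarrow> q dvd f"
proof (cases "L \<subseteq> {0}")
  case True
  then show ?thesis using that[of 0] ideal_rta_zero[OF L] by auto
next
  case False
  then obtain q0 where q0: "q0 \<in> L \<and> q0 \<noteq> 0" by auto
  define q where "q = arg_min degree (\<lambda>q. q \<in> L \<and> q \<noteq> 0)"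
  have q: "q \<in> L \<and> q \<noteq> 0" unfolding q_def by (rule arg_min_natI[of "\<lambda>q. q \<in> L \<and> q \<noteq> 0" q0], rule q0)
  have min: "degree q \<le> degree f" if "f \<in> L" "f \<noteq> 0" for f
    unfolding q_def by (rule arg_min_nat_le) (use that in auto)
  have "q dvd f" if f: "f \<in> L" for f
  proof -
    have "f mod q = f - (f div q) * q" by (simp add: minus_div_mult_eq_mod)
    then have "f mod q \<in> L"
      using ideal_rta_diff[OF L f ideal_rta_mult[OF L, of q "f div q"]] q by simp
    then have "f mod q = 0"
      using min[of "f mod q"] degree_mod_less[of q f] q by fastforce
    then show ?thesis by auto
  qed
  then show ?thesis using that q by blast
qed

text \<open>
  If \<open>\<rho>\<close> is a surjective homomorphism onto \<open>K[t]\<close>, the primes containing its kernel correspond to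
  primes of \<open>K[t]\<close>, and a principal ideal domain has dimension 1. The argument works directly with
  generators \<open>q\<close> and \<open>q2\<close> of the images of \<open>K1\<close> and \<open>K2\<close>: \<open>q2\<close> divides \<open>q\<close>, say
  \<open>q = q2 * c\<close>, and primality of \<open>K1\<close> leaves only \<open>K2 = K1\<close> or that \<open>q2\<close> is a unit.
\<close>

lemma no_prime_chain_over_PID:
  fixes \<rho> :: "'a::comm_ring_1 \<Rightarrow> 'k::field poly"
  assumes diff: "\<And>f g. \<rho> (f - g) = \<rho> f - \<rho> g" and mult: "\<And>f g. \<rho> (f * g) = \<rho> f * \<rho> g"
    and one: "\<rho> 1 = 1" and surj: "surj \<rho>"
    and K: "prime_set K0" "prime_set K1" "prime_set K2" "K0 \<subset> K1" "K1 \<subset> K2"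
    and ker: "\<And>f. \<rho> f = 0 \<Longrightarrow> f \<in> K0"
  shows False
proof -
  have id: "ideal K0 ring_of_type_algebra" "ideal K1 ring_of_type_algebra" "ideal K2 ring_of_type_algebra"
    using K by (auto simp: prime_set_def)
  have lift: "f \<in> K" if "\<rho> f \<in> \<rho> ` K" "ideal K ring_of_type_algebra" "K0 \<subseteq> K" for f K
  proof -
    obtain g where g: "g \<in> K" "\<rho> f = \<rho> g" using \<open>\<rho> f \<in> \<rho> ` K\<close> by blast
    then have "f - g \<in> K" using ker[of "f - g"] diff \<open>K0 \<subseteq> K\<close> by auto
    from ideal_rta_add[OF that(2) this g(1)] show ?thesis by simp
  qed
  have zero: "\<rho> 0 = 0" using diff[of 0 0] by simp
  have add: "\<rho> (f + g) = \<rho> f + \<rho> g" for f g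
    using diff[of f "0 - g"] diff[of 0 g] by (simp add: zero)
  have img: "ideal (\<rho> ` K) ring_of_type_algebra" if "ideal K ring_of_type_algebra" for K
    unfolding ideal_rta_iff
  proof (intro conjI ballI allI)
    show "0 \<in> \<rho> ` K" using ideal_rta_zero[OF that] zero by (metis imageI)
    fix a b assume "a \<in> \<rho> ` K" "b \<in> \<rho> ` K"
    then show "a + b \<in> \<rho> ` K" using ideal_rta_add[OF that] by (auto simp flip: add)
  next
    fix c a assume "a \<in> \<rho> ` K"
    moreover obtain c' where "c = \<rho> c'" using surj by (auto simp: surj_def)
    ultimately show "c * a \<in> \<rho> ` K" using ideal_rta_mult[OF that] by (auto simp flip: mult)
  qed
  obtain q where q: "q \<in> \<rho> ` K1" "\<And>f. f \<in> \<rho> ` K1 \<Longrightarrow> q dvd f"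
    using ideal_poly_principal[OF img[OF id(2)]] by blast
  obtain q2 where q2: "q2 \<in> \<rho> ` K2" "\<And>f. f \<in> \<rho> ` K2 \<Longrightarrow> q2 dvd f"
    using ideal_poly_principal[OF img[OF id(3)]] by blast
  have q0: "q \<noteq> 0"
  proof
    assume "q = 0"
    then have "\<rho> f = 0" if "f \<in> K1" for f using q(2)[of "\<rho> f"] that by simp
    then show False using ker K(4) by blast
  qed
  have "q \<in> \<rho> ` K2" using q(1) K(5) by blast
  then obtain c where c: "q = q2 * c" using q2(2) by (auto elim: dvdE)
  obtain g2 where g2: "g2 \<in> K2" "q2 = \<rho> g2" using q2(1) by blast
  obtain g3 where g3: "c = \<rho> g3" using surj by (auto simp: surj_def)
  have "\<rho> (g2 * g3) \<in> \<rho> ` K1" using q(1) by (simp add: mult c g2(2) g3)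
  then have "g2 * g3 \<in> K1" by (rule lift) (use id K(4) in auto)
  then consider "g2 \<in> K1" | "g3 \<in> K1" using K(2) by (auto simp: prime_set_def)
  then show False
  proof cases
    case 1
    have "f \<in> K1" if "f \<in> K2" for f
    proof (rule lift)
      obtain e where e: "\<rho> f = q2 * e" using q2(2)[OF imageI[OF \<open>f \<in> K2\<close>]] by (auto elim: dvdE)
      obtain e' where "e = \<rho> e'" using surj by (auto simp: surj_def)
      then have "\<rho> f = \<rho> (g2 * e')" by (simp add: e g2(2) mult)
      then show "\<rho> f \<in> \<rho> ` K1" using ideal_rta_mult_right[OF id(2) 1, of e'] by simp
    qed (use id K(4) in auto)
    then show False using K(5) by blast
  next
    case 2
    then have "q dvd c" using q(2) g3 by simp
    then obtain e where "c = q * e" by (auto elim: dvdE)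
    then have "q = q2 * (q * e)" using c by simp
    then have "q * (q2 * e) = q * 1" by (simp add: mult.left_commute)
    then have "q2 * e = 1" using q0 mult_left_cancel by blast
    moreover obtain e' where "e = \<rho> e'" using surj by (auto simp: surj_def)
    ultimately have "\<rho> 1 = \<rho> (g2 * e')" by (simp add: g2(2) mult one)
    then have "\<rho> 1 \<in> \<rho> ` K2" using ideal_rta_mult_right[OF id(3) g2(1), of e'] by simp
    then have "1 \<in> K2" by (rule lift) (use id K(4,5) in auto)
    then show False using K(3) by (simp add: prime_set_def)
  qed
qed

text \<open>
  The homomorphisms \<open>at_y0\<close> and \<open>at_x0\<close> restrict a polynomial to the \<open>x\<close>-axis and to the \<open>y\<close>-axis.
  Their kernels are \<open>(y)\<close> and \<open>(x)\<close>.
\<close>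

definition at_y0 :: "'k::field poly poly \<Rightarrow> 'k poly" where
  "at_y0 f = coeff f 0"

definition at_x0 :: "'k::field poly poly \<Rightarrow> 'k poly" where
  "at_x0 f = map_poly (\<lambda>p. coeff p 0) f"

lemma coeff_at_x0: "coeff (at_x0 f) j = coeff (coeff f j) 0"
  by (simp add: at_x0_def coeff_map_poly)

lemma at_y0_hom:
  fixes f g :: "'k::field poly poly"
  shows "at_y0 (f - g) = at_y0 f - at_y0 g" "at_y0 (f * g) = at_y0 f * at_y0 g"
    "at_y0 (1 :: 'k poly poly) = 1" "surj (at_y0 :: 'k poly poly \<Rightarrow> _)"
proof -
  show "surj (at_y0 :: 'k poly poly \<Rightarrow> _)" by (rule surjI[of _ "\<lambda>g. [:g:]"]) (simp add: at_y0_def)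
qed (simp_all add: at_y0_def coeff_mult_0)

lemma at_x0_hom:
  fixes f g :: "'k::field poly poly"
  shows "at_x0 (f - g) = at_x0 f - at_x0 g" "at_x0 (f * g) = at_x0 f * at_x0 g"
    "at_x0 (1 :: 'k poly poly) = 1" "surj (at_x0 :: 'k poly poly \<Rightarrow> _)"
proof -
  show "at_x0 (f - g) = at_x0 f - at_x0 g" by (rule poly_eqI) (simp add: coeff_at_x0)
  show "at_x0 (f * g) = at_x0 f * at_x0 g"
    by (rule poly_eqI) (simp add: coeff_at_x0 coeff_mult coeff_sum)
  show "at_x0 (1 :: 'k poly poly) = 1" by (rule poly_eqI) (simp add: coeff_at_x0 coeff_1)
  have "at_x0 (map_poly (\<lambda>c. [:c:]) g) = g" for g :: "'k poly"
    by (rule poly_eqI) (simp add: coeff_at_x0 coeff_map_poly)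
  then show "surj (at_x0 :: 'k poly poly \<Rightarrow> _)" by (rule surjI)
qed

lemma at_y0_eq_0_iff: "at_y0 f = 0 \<longleftrightarrow> f \<in> mono_ideal {(i, j). 1 \<le> j}"
  by (auto simp: at_y0_def mono_ideal_def mcoeff_def poly_eq_iff not_less_eq_eq) (metis One_nat_def not_less_eq_eq le_zero_eq)

lemma at_x0_eq_0_iff: "at_x0 f = 0 \<longleftrightarrow> f \<in> mono_ideal {(i, j). 1 \<le> i}"
  by (auto simp: coeff_at_x0 mono_ideal_def mcoeff_def poly_eq_iff) (metis One_nat_def not_less_eq_eq le_zero_eq)

lemma prime_set_kernel:
  fixes \<rho> :: "'k::field poly poly \<Rightarrow> 'b::idom"
  assumes "ideal {f. \<rho> f = 0} Kxy" "\<And>f g. \<rho> (f * g) = \<rho> f * \<rho> g" "\<rho> 1 \<noteq> 0"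
  shows "prime_set {f. \<rho> f = 0}"
  using assms by (auto simp: prime_set_def)

abbreviation xy_ideal :: "'k::field poly poly set" where
  "xy_ideal \<equiv> mono_ideal {(i, j). 1 \<le> i \<or> 1 \<le> j}"

lemma xy_ideal_iff: "f \<in> xy_ideal \<longleftrightarrow> mcoeff f 0 0 = 0"
  by (auto simp: mono_ideal_def not_less_eq_eq) (metis One_nat_def le_0_eq not_less_eq_eq)

lemma xy_ideal_eq: "xy_ideal = Idl\<^bsub>Kxy\<^esub> {xy 1 0, xy 0 1}"
proof -
  have eq: "{(i, j). 1 \<le> i \<or> 1 \<le> j} = up {(1, 0), (0, 1)}" by (auto simp: up_def)
  show ?thesis unfolding eq Idl_monomials[symmetric] by simp
qed

lemma prime_x: "prime_set (mono_ideal {(i, j). 1 \<le> i} :: 'k::field poly poly set)"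
proof -
  have "{f. at_x0 f = 0} = (mono_ideal {(i, j). 1 \<le> i} :: 'k poly poly set)" using at_x0_eq_0_iff by blast
  moreover have "ideal (mono_ideal {(i, j). 1 \<le> i} :: 'k poly poly set) Kxy"
    by (rule ideal_mono_ideal) (auto simp: up_closed_def)
  ultimately show ?thesis using prime_set_kernel[of at_x0] at_x0_hom(2,3) by (metis zero_neq_one)
qed

lemma prime_y: "prime_set (mono_ideal {(i, j). 1 \<le> j} :: 'k::field poly poly set)"
proof -
  have "{f. at_y0 f = 0} = (mono_ideal {(i, j). 1 \<le> j} :: 'k poly poly set)" using at_y0_eq_0_iff by blast
  moreover have "ideal (mono_ideal {(i, j). 1 \<le> j} :: 'k poly poly set) Kxy"
    by (rule ideal_mono_ideal) (auto simp: up_closed_def)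
  ultimately show ?thesis using prime_set_kernel[of at_y0] at_y0_hom(2,3) by (metis zero_neq_one)
qed

lemma prime_xy: "prime_set (xy_ideal :: 'k::field poly poly set)"
proof -
  have eq: "{f. mcoeff f 0 0 = 0} = (xy_ideal :: 'k poly poly set)"
    by (rule Set.set_eqI) (simp only: xy_ideal_iff mem_Collect_eq)
  have "ideal {f :: 'k poly poly. mcoeff f 0 0 = 0} Kxy"
    unfolding eq by (rule ideal_mono_ideal[OF up_closed_Un_strips])
  moreover have "mcoeff (f * g) 0 0 = mcoeff f 0 0 * mcoeff g 0 0" for f g :: "'k poly poly"
    by (simp add: mcoeff_mult)
  moreover have "mcoeff (1 :: 'k poly poly) 0 0 = 1"
    using mcoeff_xy[of 0 0 0 0] by (simp add: xy_0_0)
  ultimately show ?thesis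
    unfolding eq[symmetric] prime_set_def by simp
qed

lemma prime_set_contains_xy:
  assumes K: "prime_set K" and x: "xy 1 0 \<in> K" "xy 0 1 \<in> K"
  shows "K = xy_ideal"
proof
  have id: "ideal K Kxy" using K by (simp add: prime_set_def)
  show sub: "xy_ideal \<subseteq> K"
    unfolding xy_ideal_eq by (rule genideal_rta_least[OF id]) (use x in auto)
  show "K \<subseteq> xy_ideal"
  proof
    fix f assume f: "f \<in> K"
    show "f \<in> xy_ideal"
    proof (rule ccontr)
      assume "f \<notin> xy_ideal"
      then have c: "mcoeff f 0 0 \<noteq> 0" by (simp only: xy_ideal_iff not_False_eq_True)
      have "f - [:[:mcoeff f 0 0:]:] \<in> K"
        by (rule subsetD[OF sub]) (simp only: xy_ideal_iff, simp add: mcoeff_def)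
      from ideal_rta_diff[OF id f this] have "[:[:mcoeff f 0 0:]:] \<in> K" by simp
      from ideal_rta_mult[OF id this, of "[:[:inverse (mcoeff f 0 0):]:]"]
      have "1 \<in> K" using c by (simp add: one_pCons)
      then show False using K by (simp add: prime_set_def)
    qed
  qed
qed

lemma mono_ideal_mono: "U \<subseteq> V \<Longrightarrow> mono_ideal U \<subseteq> mono_ideal V"
  by (auto simp: mono_ideal_def)

section \<open>Dimension, depth and number of generators of a staircase\<close>

lemma mono_ideal_mcoeff_0: "f \<in> mono_ideal U \<Longrightarrow> (i, j) \<notin> U \<Longrightarrow> mcoeff f i j = 0"
  by (auto simp: mono_ideal_def)

lemma xy_mult_mem:
  assumes "ideal K Kxy" "xy i j \<in> K" "i \<le> i'" "j \<le> j'"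
  shows "xy i' j' \<in> K"
  using ideal_rta_mult[OF assms(1,2), of "xy (i' - i) (j' - j)"] assms(3,4) by (simp add: xy_mult)

context staircase
begin

text \<open>
  If the staircase misses one of the axes, all its corners are divisible by \<open>x\<close> or all are
  divisible by \<open>y\<close>, so \<open>(x)\<close> or \<open>(y)\<close> followed by \<open>(x, y)\<close> is a chain of primes over \<open>J\<close>.
\<close>

lemma prime_chain_one:
  assumes "0 < a n \<or> 0 < b 0"
  obtains K :: "nat \<Rightarrow> 'k::field poly poly set" where "prime_chain J 1 K"
proof (cases "0 < a n")
  case True
  have "J \<subseteq> (mono_ideal {(i, j). 1 \<le> i} :: 'k poly poly set)"
  proof (rule mono_ideal_mono, clarify)
    fix i j assume "(i, j) \<in> exps"
    then obtain k where "k \<le> n" "a k \<le> i" by (auto simp: mem_exps)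
    then show "1 \<le> i" using a_mono[of k n] True by simp
  qed
  moreover have "mono_ideal {(i, j). 1 \<le> i} \<subset> (xy_ideal :: 'k poly poly set)"
  proof
    show "mono_ideal {(i, j). 1 \<le> i} \<subseteq> (xy_ideal :: 'k poly poly set)"
      by (rule mono_ideal_mono) auto
    have "xy 0 1 \<in> (xy_ideal :: 'k poly poly set)" "xy 0 1 \<notin> (mono_ideal {(i, j). 1 \<le> i} :: 'k poly poly set)"
      unfolding xy_in_mono_ideal_iff by simp_all
    then show "mono_ideal {(i, j). 1 \<le> i} \<noteq> (xy_ideal :: 'k poly poly set)" by metis
  qed
  ultimately show ?thesis by (rule that[OF prime_chain_two[OF prime_x prime_xy]])
next
  case False
  have "J \<subseteq> (mono_ideal {(i, j). 1 \<le> j} :: 'k poly poly set)"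
  proof (rule mono_ideal_mono, clarify)
    fix i j assume "(i, j) \<in> exps"
    then obtain k where "k \<le> n" "b k \<le> j" by (auto simp: mem_exps)
    then show "1 \<le> j" using b_mono[of 0 k] assms False by simp
  qed
  moreover have "mono_ideal {(i, j). 1 \<le> j} \<subset> (xy_ideal :: 'k poly poly set)"
  proof
    show "mono_ideal {(i, j). 1 \<le> j} \<subseteq> (xy_ideal :: 'k poly poly set)"
      by (rule mono_ideal_mono) auto
    have "xy 1 0 \<in> (xy_ideal :: 'k poly poly set)" "xy 1 0 \<notin> (mono_ideal {(i, j). 1 \<le> j} :: 'k poly poly set)"
      unfolding xy_in_mono_ideal_iff by simp_all
    then show "mono_ideal {(i, j). 1 \<le> j} \<noteq> (xy_ideal :: 'k poly poly set)" by metis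
  qed
  ultimately show ?thesis by (rule that[OF prime_chain_two[OF prime_y prime_xy]])
qed

text \<open>
  A prime that contains the single corner contains \<open>x\<close> or \<open>y\<close>, so every chain lives in the
  coordinate ring of an axis.
\<close>

lemma krull_dim_principal:
  assumes n: "n = 0" and ab: "0 < a 0 \<or> 0 < b 0"
  shows "krull_dim (quot (J :: 'k::field poly poly set)) = enat 1"
proof -
  obtain K0 :: "nat \<Rightarrow> 'k poly poly set" where K0: "prime_chain J 1 K0"
    using prime_chain_one ab n by auto
  show ?thesis
  proof (rule krull_dim_quot_eqI[OF ideal_J K0], rule ccontr)
    fix l and K :: "nat \<Rightarrow> 'k poly poly set"
    assume K: "prime_chain J l K" and l: "\<not> l \<le> 1"
    then have pr: "prime_set (K 0)" "prime_set (K 1)" "prime_set (K 2)" and J: "J \<subseteq> K 0"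
      and lt: "K 0 \<subset> K 1" "K 1 \<subset> K 2"
      by (simp_all add: prime_chain_def numeral_2_eq_2)
    have id: "ideal (K 0) Kxy" using pr by (simp add: prime_set_def)
    have "xy (a 0) (b 0) \<in> (J :: 'k poly poly set)" by (auto simp: xy_in_mono_ideal_iff mem_exps)
    then have "xy (a 0) (b 0) \<in> K 0" using J by blast
    then consider "xy 1 0 \<in> K 0" | "xy 0 1 \<in> K 0" using prime_set_xy[OF pr(1)] by blast
    then show False
    proof cases
      case 1
      then have "mono_ideal {(i, j). 1 \<le> i} \<subseteq> K 0"
        unfolding mono_ideal_subset_iff[OF id] using xy_mult_mem[OF id] by auto
      then show False
        using no_prime_chain_over_PID[OF at_x0_hom pr lt] at_x0_eq_0_iff by blast
    next
      case 2
      then have "mono_ideal {(i, j). 1 \<le> j} \<subseteq> K 0"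
        unfolding mono_ideal_subset_iff[OF id] using xy_mult_mem[OF id] by auto
      then show False
        using no_prime_chain_over_PID[OF at_y0_hom pr lt] at_y0_eq_0_iff by blast
    qed
  qed
qed

text \<open>
  The inner corner between the first two corners of the staircase is not in \<open>J\<close>, but its products with
  \<open>x\<close> and with \<open>y\<close> are multiples of these two corners.
\<close>

lemma socle_element:
  assumes n: "0 < n"
  shows "xy (a 0 - 1) (b 1 - 1) \<notin> (J :: 'k::field poly poly set)"
    and "p \<in> xy_ideal \<Longrightarrow> p * xy (a 0 - 1) (b 1 - 1) \<in> (J :: 'k::field poly poly set)"
proof -
  have lt: "a 1 < a 0" "b 0 < b 1" using a_less[OF n] b_less[OF n] by simp_all
  have "\<not> (a k \<le> a 0 - 1 \<and> b k \<le> b 1 - 1)" if "k \<le> n" for k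
    using that lt b_mono[of 1 k] by (cases "k = 0") auto
  then show "xy (a 0 - 1) (b 1 - 1) \<notin> (J :: 'k poly poly set)"
    by (auto simp: xy_in_mono_ideal_iff mem_exps)
  assume "p \<in> (xy_ideal :: 'k poly poly set)"
  then obtain q r where p: "p = q * xy 1 0 + r * xy 0 1"
    unfolding xy_ideal_eq mem_genideal_insert by blast
  have "xy (a 0) (b 1 - 1) \<in> (J :: 'k poly poly set)"
    unfolding xy_in_mono_ideal_iff mem_exps by (rule exI[of _ 0]) (use lt in auto)
  moreover have "xy (a 0 - 1) (b 1) \<in> (J :: 'k poly poly set)"
    unfolding xy_in_mono_ideal_iff mem_exps by (rule exI[of _ 1]) (use lt n in auto)
  moreover have "p * xy (a 0 - 1) (b 1 - 1) = q * xy (a 0) (b 1 - 1) + r * xy (a 0 - 1) (b 1)"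
    using lt by (simp add: p distrib_right mult.assoc xy_mult)
  ultimately show "p * xy (a 0 - 1) (b 1 - 1) \<in> (J :: 'k poly poly set)"
    by (simp add: ideal_rta_add[OF ideal_J] ideal_rta_mult[OF ideal_J])
qed

text \<open>
  The socle element is nonzero in the residue ring and killed by every element of the graded
  maximal ideal, so none of them can start a regular sequence.
\<close>

lemma depth_zero:
  assumes n: "0 < n"
  shows "depth (quot (J :: 'k::field poly poly set)) (graded_max_ideal J) = 0"
proof -
  have "xs = []" if xs: "regular_sequence (quot (J :: 'k poly poly set)) xs" "set xs \<subseteq> graded_max_ideal J" for xs
  proof (rule ccontr)
    assume ne: "xs \<noteq> []"
    define s :: "'k poly poly" where "s = xy (a 0 - 1) (b 1 - 1)"
    have "xs ! 0 \<in> graded_max_ideal J" using xs(2) ne by auto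
    then obtain p where p: "p \<in> xy_ideal" "xs ! 0 = coset J p"
      unfolding graded_max_ideal_def xy_ideal_eq[symmetric] by blast
    have zero: "ideal {\<zero>\<^bsub>quot J\<^esub>} (quot (J :: 'k poly poly set))"
      by (rule ring.zeroideal[OF cring.axioms(1)[OF cring_quot[OF ideal_J]]])
    have Idl0: "Idl\<^bsub>quot J\<^esub> {} \<subseteq> {\<zero>\<^bsub>quot (J :: 'k poly poly set)\<^esub>}"
      by (rule ring.genideal_minimal[OF cring.axioms(1)[OF cring_quot[OF ideal_J]] zero]) simp
    have id: "ideal (Idl\<^bsub>quot J\<^esub> {}) (quot (J :: 'k poly poly set))"
      by (rule ring.genideal_ideal[OF cring.axioms(1)[OF cring_quot[OF ideal_J]]]) simp
    have "xs ! 0 \<otimes>\<^bsub>quot J\<^esub> coset J s = coset J 0"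
      using socle_element(2)[OF n p(1)]
      by (simp add: p(2) quot_mult[OF ideal_J] coset_eq_iff[OF ideal_J] s_def)
    also have "\<dots> \<in> Idl\<^bsub>quot J\<^esub> (set (take 0 xs))"
      using additive_subgroup.zero_closed[OF ideal.axioms(1)[OF id]] by (simp add: quot_zero[OF ideal_J])
    finally have "coset J s \<in> Idl\<^bsub>quot J\<^esub> (set (take 0 xs))"
      using xs(1) ne unfolding regular_sequence_def quot_carrier[OF ideal_J] by blast
    then have "coset J s = coset J 0" using Idl0 by (auto simp: quot_zero[OF ideal_J])
    then have "s \<in> J" by (simp add: coset_eq_iff[OF ideal_J])
    moreover have "s \<notin> J" unfolding s_def by (rule socle_element(1)[OF n])
    ultimately show False by simp
  qed
  then have "{enat (length xs) |xs. regular_sequence (quot (J :: 'k poly poly set)) xs \<and> set xs \<subseteq> graded_max_ideal J} \<subseteq> {0}"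
    by (auto simp: zero_enat_def)
  then have "depth (quot (J :: 'k poly poly set)) (graded_max_ideal J) \<le> 0"
    unfolding depth_def by (intro Sup_least) auto
  then show ?thesis by simp
qed

lemma cohen_macaulay_artinian:
  assumes n: "0 < n" and CM: "cohen_macaulay_quot (J :: 'k::field poly poly set)"
  shows "a n = 0" "b 0 = 0"
proof -
  have "\<not> (0 < a n \<or> 0 < b 0)"
  proof
    assume "0 < a n \<or> 0 < b 0"
    then obtain K :: "nat \<Rightarrow> 'k poly poly set" where "prime_chain J 1 K" by (rule prime_chain_one)
    then have "enat 1 \<le> krull_dim (quot (J :: 'k poly poly set))" by (rule krull_dim_quot_geI[OF ideal_J])
    also have "\<dots> = enat 0"
      using CM unfolding cohen_macaulay_quot_def depth_zero[OF n] by (simp add: zero_enat_def)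
    finally show False by simp
  qed
  then show "a n = 0" "b 0 = 0" by simp_all
qed

lemma gen_not_multiple:
  assumes "k \<le> n" "i \<le> a k" "j \<le> b k" "(i, j) \<in> exps"
  shows "i = a k \<and> j = b k"
proof -
  obtain m where m: "m \<le> n" "a m \<le> i" "b m \<le> j" using assms(4) by (auto simp: mem_exps)
  have "m = k"
    using a_mono[of m k] b_mono[of k m] assms m by (cases "m < k"; cases "k < m") auto
  then show ?thesis using m assms by simp
qed

text \<open>
  The projection of \<open>J\<close> onto \<open>J / (x,y)J\<close> in coordinates.
\<close>

definition corner_coeffs :: "'k::field poly poly \<Rightarrow> nat \<Rightarrow> 'k" where
  "corner_coeffs f = (\<lambda>k. if k \<le> n then mcoeff f (a k) (b k) else 0)"

lemma a_eq_iff: "k \<le> n \<Longrightarrow> l \<le> n \<Longrightarrow> a k = a l \<longleftrightarrow> k = l"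
  using a_mono[of k l] a_mono[of l k] by (cases "k \<le> l") auto

lemma corner_coeffs_gen: "k \<le> n \<Longrightarrow> corner_coeffs (gen k) = unit_vec k"
  by (rule ext) (simp add: corner_coeffs_def gen_def mcoeff_xy unit_vec_def a_eq_iff)

text \<open>
  Modulo \<open>(x, y)\<close> the polynomial \<open>h\<close> is its constant term, and no corner is a proper multiple of a
  monomial in \<open>J\<close>.
\<close>

lemma corner_coeffs_mult:
  assumes f: "f \<in> J"
  shows "corner_coeffs (h * f) = vscale (mcoeff h 0 0) (corner_coeffs f)"
proof
  fix k
  show "corner_coeffs (h * f) k = vscale (mcoeff h 0 0) (corner_coeffs f) k"
  proof (cases "k \<le> n")
    case True
    have "h - [:[:mcoeff h 0 0:]:] \<in> xy_ideal" by (simp only: xy_ideal_iff, simp add: mcoeff_def)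
    then obtain p q where pq: "h - [:[:mcoeff h 0 0:]:] = p * xy 1 0 + q * xy 0 1"
      unfolding xy_ideal_eq mem_genideal_insert by blast
    then have "h = p * xy 1 0 + q * xy 0 1 + [:[:mcoeff h 0 0:]:]"
      by (metis diff_add_cancel)
    from arg_cong[OF this, of "\<lambda>t. t * f"]
    have "h * f = (p * xy 1 0 + q * xy 0 1 + [:[:mcoeff h 0 0:]:]) * f" .
    then have h: "h * f = xy 1 0 * (p * f) + xy 0 1 * (q * f) + [:[:mcoeff h 0 0:]:] * f"
      by (simp only: distrib_left distrib_right mult_ac)
    have pf: "p * f \<in> J" "q * f \<in> J" by (simp_all add: ideal_rta_mult[OF ideal_J f])
    have "mcoeff (xy 1 0 * (p * f)) (a k) (b k) = 0"
    proof (cases "1 \<le> a k")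
      case le: True
      then have "(a k - 1, b k) \<notin> exps" using gen_not_multiple[OF True, of "a k - 1" "b k"] by auto
      then show ?thesis using mono_ideal_mcoeff_0[OF pf(1)] by (simp add: mcoeff_xy_mult)
    qed (simp add: mcoeff_xy_mult)
    moreover have "mcoeff (xy 0 1 * (q * f)) (a k) (b k) = 0"
    proof (cases "1 \<le> b k")
      case le: True
      then have "(a k, b k - 1) \<notin> exps" using gen_not_multiple[OF True, of "a k" "b k - 1"] by auto
      then show ?thesis using mono_ideal_mcoeff_0[OF pf(2)] by (simp add: mcoeff_xy_mult)
    qed (simp add: mcoeff_xy_mult)
    ultimately have "mcoeff (h * f) (a k) (b k) = mcoeff ([:[:mcoeff h 0 0:]:] * f) (a k) (b k)"
      by (subst h) simp
    also have "\<dots> = mcoeff h 0 0 * mcoeff f (a k) (b k)" by (simp add: mcoeff_def)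
    finally show ?thesis using True by (simp add: corner_coeffs_def)
  qed (simp add: corner_coeffs_def)
qed

end

lemma vector_space_vscale: "vector_space (vscale :: 'k::field \<Rightarrow> _)"
  by unfold_locales (auto simp: fun_eq_iff algebra_simps)

lemma independent_unit_vecs:
  "\<not> Modules.module.dependent (vscale :: 'k::field \<Rightarrow> _) (unit_vec ` {..n})"
proof -
  interpret V: vector_space "vscale :: 'k \<Rightarrow> _" by (rule vector_space_vscale)
  have inj: "unit_vec i = (unit_vec j :: nat \<Rightarrow> 'k) \<longleftrightarrow> i = j" for i j
    by (auto simp: unit_vec_def fun_eq_iff)
  show ?thesis
  proof (rule V.independent_if_scalars_zero)
    fix f :: "(nat \<Rightarrow> 'k) \<Rightarrow> 'k" and v :: "nat \<Rightarrow> 'k"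
    assume s: "(\<Sum>x\<in>unit_vec ` {..n}. vscale (f x) x) = 0" and "v \<in> unit_vec ` {..n}"
    then obtain k where k: "k \<le> n" "v = unit_vec k" by auto
    have "(\<Sum>x\<in>unit_vec ` {..n}. vscale (f x) x) = (\<Sum>j\<le>n. vscale (f (unit_vec j)) (unit_vec j))"
      by (subst sum.reindex) (auto simp: inj_on_def inj)
    then have "(\<Sum>j\<le>n. vscale (f (unit_vec j)) (unit_vec j)) k = 0" using s by simp
    moreover have "(\<Sum>j\<le>n. vscale (f (unit_vec j)) (unit_vec j)) k = (\<Sum>j\<le>n. if j = k then f (unit_vec j) else 0)"
      unfolding sum_fun_apply by (rule sum.cong) (auto simp: unit_vec_def)
    ultimately show "f v = 0" using k by simp
  qed simp
qed

context staircase
begin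

text \<open>
  By \<open>corner_coeffs_mult\<close> the images of any generators of \<open>J\<close> span \<open>K^(n+1)\<close>.
\<close>

lemma card_generators_ge:
  assumes G: "finite G" "(J :: 'k::field poly poly set) = Idl\<^bsub>Kxy\<^esub> G"
  shows "Suc n \<le> card G"
proof -
  interpret V: vector_space "vscale :: 'k \<Rightarrow> _" by (rule vector_space_vscale)
  have GJ: "G \<subseteq> J" using genideal_rta_superset G(2) by blast
  have "ideal {f \<in> J. corner_coeffs f \<in> V.span (corner_coeffs ` G)} Kxy"
    unfolding ideal_rta_iff
  proof (intro conjI ballI allI; clarsimp)
    have "corner_coeffs (0 :: 'k poly poly) = 0" by (simp add: corner_coeffs_def fun_eq_iff)
    then show "0 \<in> J \<and> corner_coeffs 0 \<in> V.span (corner_coeffs ` G)"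
      using ideal_rta_zero[OF ideal_J] by (simp add: V.span_zero)
  next
    fix f g :: "'k poly poly" assume fg: "f \<in> J" "g \<in> J"
      "corner_coeffs f \<in> V.span (corner_coeffs ` G)" "corner_coeffs g \<in> V.span (corner_coeffs ` G)"
    have "corner_coeffs (f + g) = corner_coeffs f + corner_coeffs g"
      by (simp add: corner_coeffs_def fun_eq_iff)
    then show "f + g \<in> J \<and> corner_coeffs (f + g) \<in> V.span (corner_coeffs ` G)"
      using fg by (simp add: V.span_add ideal_rta_add[OF ideal_J])
  next
    fix c f :: "'k poly poly" assume f: "f \<in> J" "corner_coeffs f \<in> V.span (corner_coeffs ` G)"
    then show "c * f \<in> J \<and> corner_coeffs (c * f) \<in> V.span (corner_coeffs ` G)"
      by (simp add: corner_coeffs_mult V.span_scale ideal_rta_mult[OF ideal_J])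
  qed
  moreover have "G \<subseteq> {f \<in> J. corner_coeffs f \<in> V.span (corner_coeffs ` G)}"
    using GJ by (auto intro: V.span_base)
  ultimately have sub: "J \<subseteq> {f \<in> J. corner_coeffs f \<in> V.span (corner_coeffs ` G)}"
    unfolding G(2) by (rule genideal_rta_least)
  have "unit_vec k \<in> V.span (corner_coeffs ` G)" if k: "k \<le> n" for k
  proof -
    have "gen k \<in> (J :: 'k poly poly set)" using k by (auto simp: gen_def xy_in_mono_ideal_iff mem_exps)
    from subsetD[OF sub this] show ?thesis by (simp add: corner_coeffs_gen[OF k])
  qed
  then have "card (unit_vec ` {..n} :: (nat \<Rightarrow> 'k) set) \<le> card (corner_coeffs ` G)"
    using V.independent_span_bound[OF _ independent_unit_vecs] G(1) by blast
  also have "card (unit_vec ` {..n} :: (nat \<Rightarrow> 'k) set) = Suc n"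
    by (subst card_image) (auto simp: inj_on_def unit_vec_def fun_eq_iff)
  finally show ?thesis using card_image_le[OF G(1), of corner_coeffs] by simp
qed

lemma min_num_gens_J: "min_num_gens Kxy (J :: 'k::field poly poly set) = Suc n"
  unfolding min_num_gens_def
proof (rule Least_equality)
  have "card (gen ` {..n} :: 'k poly poly set) \<le> Suc n" using card_image_le[of "{..n}" gen] by simp
  moreover have "Suc n \<le> card (gen ` {..n} :: 'k poly poly set)"
    by (rule card_generators_ge[OF _ mono_ideal_exps]) simp
  ultimately show "\<exists>G. finite G \<and> card G = Suc n \<and> G \<subseteq> carrier Kxy \<and> (J :: 'k poly poly set) = Idl\<^bsub>Kxy\<^esub> G"
    using mono_ideal_exps by (intro exI[of _ "gen ` {..n}"]) simp
next
  fix m assume "\<exists>G. finite G \<and> card G = m \<and> G \<subseteq> carrier Kxy \<and> (J :: 'k poly poly set) = Idl\<^bsub>Kxy\<^esub> G"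
  then show "Suc n \<le> m" using card_generators_ge by blast
qed

end

context artinian_staircase
begin

text \<open>
  \<open>J\<close> contains powers of \<open>x\<close> and \<open>y\<close>, so \<open>(x, y)\<close> is the only prime over it.
\<close>

lemma krull_dim_artinian: "krull_dim (quot (J :: 'k::field poly poly set)) = enat 0"
proof (rule krull_dim_quot_eqI[OF ideal_J])
  have "(0, 0) \<notin> exps" using J_pure_x[of 0] a_less[OF n_pos] by simp
  then have "1 \<le> i \<or> 1 \<le> j" if "(i, j) \<in> exps" for i j using that by (cases i; cases j) auto
  then have "exps \<subseteq> {(i, j). 1 \<le> i \<or> 1 \<le> j}" by blast
  then show "prime_chain J 0 (\<lambda>_. xy_ideal :: 'k poly poly set)"
    using mono_ideal_mono prime_xy by (simp only: prime_chain_def) blast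
next
  fix l and K :: "nat \<Rightarrow> 'k poly poly set" assume K: "prime_chain J l K"
  have eq: "K i = xy_ideal" if "i \<le> l" for i
  proof (rule prime_set_contains_xy)
    show pr: "prime_set (K i)" using K that by (simp add: prime_chain_def)
    have "J \<subseteq> K i" using K that by (simp add: prime_chain_def)
    moreover have "xy (a 0) 0 \<in> (J :: 'k poly poly set)" "xy 0 (b n) \<in> (J :: 'k poly poly set)"
      by (simp_all add: xy_in_mono_ideal_iff J_pure_x J_pure_y)
    ultimately show "xy 1 0 \<in> K i" "xy 0 1 \<in> K i" using prime_set_xy[OF pr] by blast+
  qed
  show "l \<le> 0"
  proof (rule ccontr)
    assume "\<not> l \<le> 0"
    moreover have "\<forall>i<l. K i \<subset> K (Suc i)" using K by (simp add: prime_chain_def)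
    ultimately have "K 0 \<subset> K 1" by simp
    moreover have "K 0 = K 1" using \<open>\<not> l \<le> 0\<close> eq[of 0] eq[of 1] by simp
    ultimately show False by simp
  qed
qed

end

section \<open>The staircase of a monomial ideal\<close>

text \<open>
  The corner \<open>(A, B)\<close> is the leftmost point in the lowest row of \<open>U\<close>. All further corners lie
  to the left of it. The lowest row \<open>B'\<close> that has a point left of \<open>A\<close> starts an upward closed
  set whose first corner lies further to the left, to which the induction applies.
\<close>

lemma staircase_exists:
  assumes "up_closed U" "(A, B) \<in> U" "\<And>i j. (i, j) \<in> U \<Longrightarrow> B \<le> j" "\<And>i. (i, B) \<in> U \<Longrightarrow> A \<le> i"
  shows "\<exists>n a b. staircase n a b \<and> a 0 = A \<and> b 0 = B \<and> U = {(i, j). \<exists>k\<le>n. a k \<le> i \<and> b k \<le> j}"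
  using assms
proof (induction A arbitrary: U B rule: less_induct)
  case (less A)
  have up: "(i', j') \<in> U" if "(i, j) \<in> U" "i \<le> i'" "j \<le> j'" for i j i' j'
    using less.prems(1) that unfolding up_closed_def by blast
  show ?case
  proof (cases "\<exists>j i. i < A \<and> (i, j) \<in> U")
    case False
    have "U = {(i, j). A \<le> i \<and> B \<le> j}"
      using False less.prems(3) up[OF less.prems(2)] by (auto simp: not_less)
    moreover have "staircase 0 (\<lambda>_. A) (\<lambda>_. B)" by unfold_locales auto
    ultimately show ?thesis by (intro exI[of _ 0] exI[of _ "\<lambda>_. A"] exI[of _ "\<lambda>_. B"]) auto
  next
    case True
    define B' where "B' = (LEAST j. \<exists>i. i < A \<and> (i, j) \<in> U)"
    have B': "\<exists>i. i < A \<and> (i, B') \<in> U" unfolding B'_def by (rule LeastI_ex[OF True])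
    have B'_le: "B' \<le> j" if "(i, j) \<in> U" "i < A" for i j
      unfolding B'_def by (rule Least_le) (use that in blast)
    define A' where "A' = (LEAST i. (i, B') \<in> U)"
    have A': "(A', B') \<in> U" unfolding A'_def by (rule LeastI_ex) (use B' in blast)
    have A'_le: "A' \<le> i" if "(i, B') \<in> U" for i
      unfolding A'_def by (rule Least_le) (use that in blast)
    have A'_less: "A' < A" using B' A'_le by fastforce
    have B_less: "B < B'"
      using B' less.prems(3,4) by (metis le_neq_implies_less not_less)
    define U' where "U' = {(i, j). (i, j) \<in> U \<and> B' \<le> j}"
    have "\<exists>n a b. staircase n a b \<and> a 0 = A' \<and> b 0 = B' \<and> U' = {(i, j). \<exists>k\<le>n. a k \<le> i \<and> b k \<le> j}"
    proof (rule less.IH[OF A'_less])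
      show "up_closed U'"
        unfolding up_closed_def U'_def using up by auto
    qed (use A' A'_le in \<open>auto simp: U'_def\<close>)
    then obtain n a b where ab: "staircase n a b" "a 0 = A'" "b 0 = B'" "U' = {(i, j). \<exists>k\<le>n. a k \<le> i \<and> b k \<le> j}"
      by blast
    have "staircase (Suc n) (case_nat A a) (case_nat B b)"
      using ab A'_less B_less by (auto simp: staircase_def split: nat.split)
    moreover have "U = {(i, j). \<exists>k\<le>Suc n. case_nat A a k \<le> i \<and> case_nat B b k \<le> j}"
    proof (rule Set.set_eqI, clarify)
      fix i j
      have "(\<exists>k\<le>Suc n. case_nat A a k \<le> i \<and> case_nat B b k \<le> j) \<longleftrightarrow> A \<le> i \<and> B \<le> j \<or> (\<exists>k\<le>n. a k \<le> i \<and> b k \<le> j)"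
        by (metis (no_types, lifting) Suc_le_mono not0_implies_Suc old.nat.simps(4,5) zero_le)
      also have "\<dots> \<longleftrightarrow> A \<le> i \<and> B \<le> j \<or> (i, j) \<in> U'" by (simp add: ab(4))
      also have "\<dots> \<longleftrightarrow> (i, j) \<in> U"
        using up[OF less.prems(2)] less.prems(3) B'_le by (auto simp: U'_def not_less) (metis not_less)
      finally show "(i, j) \<in> U \<longleftrightarrow> (i, j) \<in> {(i, j). \<exists>k\<le>Suc n. case_nat A a k \<le> i \<and> case_nat B b k \<le> j}"
        by simp
    qed
    ultimately show ?thesis
      by (intro exI[of _ "Suc n"] exI[of _ "case_nat A a"] exI[of _ "case_nat B b"]) simp
  qed
qed

lemma monomial_ideal_staircase:
  fixes I :: "'k::field poly poly set"
  assumes "monomial_ideal I" "I \<noteq> {0}"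
  obtains n a b where "staircase n a b" "I = mono_ideal (staircase.exps n a b)"
proof -
  obtain E where E: "I = mono_ideal (up E)"
    using assms(1) by (auto simp: monomial_ideal_def Idl_monomials)
  have ne: "\<exists>j i. (i, j) \<in> up E"
  proof (rule ccontr)
    assume "\<not> ?thesis"
    then have z: "mcoeff f i j = 0" if "f \<in> I" for f i j using that by (auto simp: E mono_ideal_def)
    have "f = 0" if "f \<in> I" for f by (rule mcoeff_eqI) (simp add: z[OF that])
    then have "I \<subseteq> {0}" by blast
    moreover have "0 \<in> I" unfolding E by (rule ideal_rta_zero[OF ideal_mono_ideal[OF up_closed_up]])
    ultimately show False using assms(2) by blast
  qed
  define B where "B = (LEAST j. \<exists>i. (i, j) \<in> up E)"
  define A where "A = (LEAST i. (i, B) \<in> up E)"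
  have B: "\<exists>i. (i, B) \<in> up E" unfolding B_def by (rule LeastI_ex[OF ne])
  have "(A, B) \<in> up E" unfolding A_def by (rule LeastI_ex[OF B])
  moreover have "B \<le> j" if "(i, j) \<in> up E" for i j unfolding B_def by (rule Least_le) (use that in blast)
  moreover have "A \<le> i" if "(i, B) \<in> up E" for i unfolding A_def by (rule Least_le) (rule that)
  ultimately obtain n a b where "staircase n a b" "up E = {(i, j). \<exists>k\<le>n. a k \<le> i \<and> b k \<le> j}"
    using staircase_exists[OF up_closed_up, of A B E] by blast
  moreover from this have "up E = staircase.exps n a b"
    using staircase.mem_exps by fastforce
  ultimately show ?thesis using that[of n a b] E by simp
qed

section \<open>Nearly Gorenstein residue rings of monomial ideals\<close>

lemma min_num_gens_le:
  assumes "finite G" "(I :: 'k::field poly poly set) = Idl\<^bsub>Kxy\<^esub> G"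
  shows "min_num_gens Kxy I \<le> card G"
  unfolding min_num_gens_def by (rule Least_le) (use assms in auto)

text \<open>
  If \<open>b = 0\<close> or \<open>c = 0\<close>, the generator \<open>x^b y^c\<close> divides one of the other two, and two generators
  would be enough. So \<open>(x^a, x^b y^c, y^d)\<close> is a presentation by the corners of a staircase.
\<close>

lemma three_generators_staircase:
  fixes I :: "'k::field poly poly set"
  assumes bc: "b < a" "c < d" and I: "I = Idl\<^bsub>Kxy\<^esub> {xy a 0, xy b c, xy 0 d}"
    and \<mu>: "min_num_gens Kxy I = 3"
  defines "as \<equiv> (\<lambda>k. [a, b, 0] ! k)" and "bs \<equiv> (\<lambda>k. [0, c, d] ! k)"
  shows "artinian_staircase 2 as bs" "I = mono_ideal (staircase.exps 2 as bs)"
proof -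
  have I_up: "I = mono_ideal (up {(a, 0), (b, c), (0, d)})"
    unfolding I Idl_monomials[symmetric] by simp
  have two: "min_num_gens Kxy I \<le> 2" if "up {(a, 0), (b, c), (0, d)} = up {p, q}" for p q
  proof -
    have "I = Idl\<^bsub>Kxy\<^esub> ((\<lambda>(i, j). xy i j) ` {p, q})"
      unfolding I_up that Idl_monomials ..
    then have "min_num_gens Kxy I \<le> card ((\<lambda>(i, j). xy i j) ` {p, q} :: 'k poly poly set)"
      by (rule min_num_gens_le[rotated]) simp
    also have "\<dots> \<le> card {p, q}" by (rule card_image_le) simp
    also have "\<dots> \<le> 2" by (simp add: card_insert_if)
    finally show ?thesis .
  qed
  have "0 < b"
  proof (rule ccontr)
    assume "\<not> 0 < b"
    then have "up {(a, 0), (b, c), (0, d)} = up {(a, 0), (0, c)}" using bc by (auto simp: up_def)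
    then show False using two \<mu> by force
  qed
  moreover have "0 < c"
  proof (rule ccontr)
    assume "\<not> 0 < c"
    then have "up {(a, 0), (b, c), (0, d)} = up {(b, 0), (0, d)}" using bc by (auto simp: up_def)
    then show False using two \<mu> by force
  qed
  ultimately have st: "staircase 2 as bs"
    using bc by unfold_locales (auto simp: as_def bs_def less_2_cases_iff)
  then show "artinian_staircase 2 as bs"
    by (simp add: artinian_staircase_def artinian_staircase_axioms_def as_def bs_def numeral_2_eq_2)
  have "{..2::nat} = {0, 1, 2}" by auto
  then have "(\<lambda>k. (as k, bs k)) ` {..2} = {(a, 0), (b, c), (0, d)}"
    by (simp add: as_def bs_def numeral_2_eq_2)
  then show "I = mono_ideal (staircase.exps 2 as bs)"
    by (simp add: I_up staircase.exps_def[OF st])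
qed

text \<open>
  In the case of three generators, the exponents given on the right-hand side form a staircase by
  themselves. The criterion applies to them directly, and they need not be compared with
  the staircase found first.
\<close>

theorem proposition3p5:
  fixes I :: "'k::field poly poly set"
  assumes "monomial_ideal I"
    and "I \<noteq> {\<zero>\<^bsub>Kxy\<^esub>}"
    and "I \<noteq> carrier Kxy"
    and "cohen_macaulay_quot I"
  shows "nearly_gorenstein_quot I \<longleftrightarrow>
    min_num_gens Kxy I = 1 \<or>
    min_num_gens Kxy I = 2 \<or>
    (min_num_gens Kxy I = 3 \<and>
      (\<exists>a b c d :: nat. b < a \<and> c < d \<and>
        I = Idl\<^bsub>Kxy\<^esub> {xy a 0, xy b c, xy 0 d} \<and>
        (a - b = 1 \<or> b = 1) \<and>
        (d - c = 1 \<or> c = 1) \<and>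
        b + c \<ge> 1))"
proof -
  obtain n a b where st: "staircase n a b" and I: "I = mono_ideal (staircase.exps n a b)"
    using monomial_ideal_staircase[OF assms(1)] assms(2) by auto
  interpret staircase n a b by (rule st)
  have \<mu>: "min_num_gens Kxy I = Suc n" unfolding I by (rule min_num_gens_J)
  show ?thesis
  proof (cases "n = 0")
    case True
    have "0 < a 0 \<or> 0 < b 0"
    proof (rule ccontr)
      assume "\<not> (0 < a 0 \<or> 0 < b 0)"
      then have "(i, j) \<in> exps" for i j by (auto simp: mem_exps)
      then have "I = UNIV" by (auto simp: I mono_ideal_def)
      then show False using assms(3) by simp
    qed
    then have "nearly_gorenstein_quot I"
      unfolding I by (rule nearly_gorenstein_principal[OF True krull_dim_principal[OF True]])
    then show ?thesis using \<mu> True by simp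
  next
    case False
    then have n: "0 < n" by simp
    have "a n = 0" "b 0 = 0"
      using cohen_macaulay_artinian[OF n, where 'k = 'k] assms(4) by (simp_all add: I)
    then interpret artinian_staircase n a b by unfold_locales (use n in auto)
    note dim = krull_dim_artinian[where 'k = 'k]
    consider "n = 1" | "n = 2" | "2 < n" using n by linarith
    then show ?thesis
    proof cases
      case 1
      then show ?thesis using nearly_gorenstein_two_gens[OF dim] \<mu> by (simp add: I)
    next
      case 2
      have I3: "I = Idl\<^bsub>Kxy\<^esub> {xy (a 0) 0, xy (a 1) (b 1), xy 0 (b 2)}"
      proof -
        have "{..n} = {0, 1, 2}" using 2 by auto
        then show ?thesis
          unfolding I mono_ideal_exps using 2 a_last b_first by (simp add: gen_def)
      qed
      show ?thesis
      proof
        assume "nearly_gorenstein_quot I"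
        then have "(a 0 - a 1 = 1 \<or> a 1 = 1) \<and> (b 2 - b 1 = 1 \<or> b 1 = 1)"
          using nearly_gorenstein_three_gens[OF dim 2] by (simp add: I)
        moreover have "a 1 < a 0" "b 1 < b 2" "1 \<le> a 1 + b 1"
          using a_less[of 0] b_less[of 1] b_less[of 0] 2 by (simp_all add: numeral_2_eq_2)
        ultimately have "\<exists>a b c d :: nat. b < a \<and> c < d \<and> I = Idl\<^bsub>Kxy\<^esub> {xy a 0, xy b c, xy 0 d} \<and>
            (a - b = 1 \<or> b = 1) \<and> (d - c = 1 \<or> c = 1) \<and> b + c \<ge> 1"
          using I3 by blast
        then show "min_num_gens Kxy I = 1 \<or> min_num_gens Kxy I = 2 \<or> (min_num_gens Kxy I = 3 \<and>
          (\<exists>a b c d :: nat. b < a \<and> c < d \<and> I = Idl\<^bsub>Kxy\<^esub> {xy a 0, xy b c, xy 0 d} \<and>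
            (a - b = 1 \<or> b = 1) \<and> (d - c = 1 \<or> c = 1) \<and> b + c \<ge> 1))"
          using \<mu> 2 by simp
      next
        assume "min_num_gens Kxy I = 1 \<or> min_num_gens Kxy I = 2 \<or> (min_num_gens Kxy I = 3 \<and>
          (\<exists>a b c d :: nat. b < a \<and> c < d \<and> I = Idl\<^bsub>Kxy\<^esub> {xy a 0, xy b c, xy 0 d} \<and>
            (a - b = 1 \<or> b = 1) \<and> (d - c = 1 \<or> c = 1) \<and> b + c \<ge> 1))"
        then obtain a' b' c' d' where *: "b' < a'" "c' < d'" "I = Idl\<^bsub>Kxy\<^esub> {xy a' 0, xy b' c', xy 0 d'}"
            "a' - b' = 1 \<or> b' = 1" "d' - c' = 1 \<or> c' = 1"
          using \<mu> 2 by auto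
        have \<mu>3: "min_num_gens Kxy I = 3" using \<mu> 2 by simp
        interpret T: artinian_staircase 2 "\<lambda>k. [a', b', 0] ! k" "\<lambda>k. [0, c', d'] ! k"
          by (rule three_generators_staircase(1)[OF *(1-3) \<mu>3])
        have "nearly_gorenstein_quot (mono_ideal T.exps :: 'k poly poly set)"
          using T.nearly_gorenstein_three_gens[OF T.krull_dim_artinian[where 'k = 'k] refl] *(4,5)
          by (simp add: numeral_2_eq_2)
        then show "nearly_gorenstein_quot I"
          using three_generators_staircase(2)[OF *(1-3) \<mu>3] by simp
      qed
    next
      case 3
      then have "\<not> nearly_gorenstein_quot I"
        using nearly_gorenstein_imp_at_most_three_gens[OF dim] by (auto simp: I)
      then show ?thesis using \<mu> 3 by simp
    qed
  qed
qed

end
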